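(* Let $0\to\mathfrak{n}\to\widehat{\mathfrak{g}}\xrightarrow{q}\mathfrak{g}\to0$ be an extension of Lie algebras, $V$ a $\mathfrak{g}$-module, $0\le n\le k$ integers, and $\sigma_0,\dots,\sigma_n:\mathfrak{g}\to\widehat{\mathfrak{g}}$ linear sections of $q$. For $f\in\operatorname{Sym}^k(\mathfrak{n},V)^{\widehat{\mathfrak{g}}}$ we have $$(k-n+1)\cdot d_{\mathfrak{g}}\big(\Delta_f(\sigma_0,\dots,\sigma_n)\big)=\sum_{i=0}^n(-1)^i\Delta_f(\sigma_0,\dots,\widehat{\sigma}_i,\dots,\sigma_n),$$ where $\widehat{\sigma}_i$ means that $\sigma_i$ is omitted (for $n=0$ the right-hand side is understood to be $0$).
   Context: Lie algebras and vector spaces are over $\mathbb{K}\in\{\mathbb{R},\mathbb{C}\}$. $\mathfrak{n}$ is identified with $\ker q\subseteq\widehat{\mathfrak{g}}$. $C^p(\mathfrak{g},W)$ is the space of alternating $p$-linear maps $\mathfrak{g}^p\to W$, and $d_{\mathfrak{g}}:C^p(\mathfrak{g},V)\to C^{p+1}(\mathfrak{g},V)$ is the Chevalley–Eilenberg differential $$d_{\mathfrak{g}}\omega(x_0,\dots,x_p)=\sum_j(-1)^jx_j.\omega(\dots,\widehat{x}_j,\dots)+\sum_{i<j}(-1)^{i+j}\omega([x_i,x_j],x_0,\dots,\widehat{x}_i,\dots,\widehat{x}_j,\dots,x_p).$$ $\operatorname{Sym}^k(\mathfrak{n},V)$ is the space of symmetric $k$-linear maps $\mathfrak{n}^k\to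 V$, and $\operatorname{Sym}^k(\mathfrak{n},V)^{\widehat{\mathfrak{g}}}$ is the subspace of $\widehat{\mathfrak{g}}$-equivariant ones: $q(x).f(y_1,\dots,y_k)=\sum_{i}f(y_1,\dots,[x,y_i],\dots,y_k)$ for all $x\in\widehat{\mathfrak{g}}$, $y_i\in\mathfrak{n}$. For $f\in\operatorname{Sym}^k(\mathfrak{n},V)$ and cochains $\varphi_i\in C^{p_i}(\mathfrak{g},\mathfrak{n})$ put $f_{\varphi_1,\dots,\varphi_k}:=\tilde{f}\circ(\varphi_1\wedge_{\otimes_s}\cdots\wedge_{\otimes_s}\varphi_k)\in C^{p_1+\cdots+p_k}(\mathfrak{g},V)$, where $\tilde{f}:S^k(\mathfrak{n})\to V$ is the linear map on the symmetric tensor power induced by $f$ and $\wedge_{\otimes_s}$ is the wedge product for the multiplication of the symmetric algebra $S(\mathfrak{n})$; explicitly $$f_{\varphi_1,\dots,\varphi_k}(x_1,\dots,x_N)=\tfrac{1}{p_1!\cdots p_k!}\sum_{\tau\in S_N}\operatorname{sgn}(\tau)f\big(\varphi_1(x_{\tau(1)},\dots,x_{\tau(p_1)}),\varphi_2(x_{\tau(p_1+1)},\dots),\dots\big),\quad N=\sum p_i.$$ Let $\Delta_n=\{t\in\mathbb{R}^{n+1}:t_i\ge0,\ \sum_it_i=1\}$. For $t\in\Delta_n$ put $\sigma_t:=\sum_{i=0}^nt_i\sigma_i$ (a linear section of $q$), with curvature $R_t\in C^2(\mathfrak{g},\mathfrak{n})$, $R_t(x,y)=[\sigma_t(x),\sigma_t(y)]-\sigma_t([x,y])$,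 and $\alpha_i:=\sigma_i-\sigma_0\in C^1(\mathfrak{g},\mathfrak{n})$. Define $$\Delta_f(\sigma_0,\dots,\sigma_n):=\frac1{c_n}\int_{\Delta_n}f_{\alpha_1,\dots,\alpha_n,R_t,\dots,R_t}\,dO\ \in C^{2k-n}(\mathfrak{g},V)$$ (with $k-n$ entries $R_t$), where $dO$ is the surface measure on $\Delta_n$ and $c_n$ is the constant Gram determinant factor of the parametrization $(t_1,\dots,t_n)\mapsto(1-\sum t_i,t_1,\dots,t_n)$; equivalently, $\frac{1}{c_n}\int_{\Delta_n}F\,dO=\int_{\{t_i\ge0,\ \sum_{i=1}^n t_i\le1\}}F(1-\sum t_i,t_1,\dots,t_n)\,dt_1\cdots dt_n$. The integrand is polynomial in $t$ with values in $V$ (after evaluation) and is integrated coefficientwise. For $n=0$, $\Delta_f(\sigma_0)=f_{R_{\sigma_0},\dots,R_{\sigma_0}}$ with $R_{\sigma_0}(x,y)=[\sigma_0(x),\sigma_0(y)]-\sigma_0([x,y])$. *)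

theory Defs
  imports "HOL-Analysis.Analysis" "HOL-Homology.Simplices" "HOL-Combinatorics.Permutations"
begin

section \<open>Lie algebras, modules and extensions\<close>

locale lie_algebra = vector_space scale
  for scale :: "'k::field \<Rightarrow> 'a::ab_group_add \<Rightarrow> 'a" +
  fixes br :: "'a \<Rightarrow> 'a \<Rightarrow> 'a"
  assumes br_linear_left: "Vector_Spaces.linear scale scale (\<lambda>x. br x y)"
    and br_linear_right: "Vector_Spaces.linear scale scale (br x)"
    and br_self: "br x x = 0"
    and jacobi: "br x (br y z) + br y (br z x) + br z (br x y) = 0"

locale lie_module = lie_algebra sg brg + V: vector_space sv
  for sg :: "'k::field \<Rightarrow> 'g::ab_group_add \<Rightarrow> 'g"
    and brg :: "'g \<Rightarrow> 'g \<Rightarrow> 'g"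
    and sv :: "'k \<Rightarrow> 'v::ab_group_add \<Rightarrow> 'v" +
  fixes act :: "'g \<Rightarrow> 'v \<Rightarrow> 'v"
  assumes act_linear_left: "Vector_Spaces.linear sg sv (\<lambda>x. act x v)"
    and act_linear_right: "Vector_Spaces.linear sv sv (act x)"
    and act_br: "act (brg x y) v = act x (act y v) - act y (act x v)"

text \<open>
  An extension \<open>0 \<rightarrow> \<nn> \<rightarrow> \<hh> \<rightarrow> \<gg> \<rightarrow> 0\<close> is given by the surjective homomorphism
  \<open>q : \<hh> \<rightarrow> \<gg>\<close>; the ideal \<open>\<nn>\<close> is its kernel.
\<close>

locale lie_extension = H: lie_algebra sh brh + G: lie_algebra sg brg
  for sh :: "'k::field \<Rightarrow> 'h::ab_group_add \<Rightarrow> 'h"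
    and brh :: "'h \<Rightarrow> 'h \<Rightarrow> 'h"
    and sg :: "'k \<Rightarrow> 'g::ab_group_add \<Rightarrow> 'g"
    and brg :: "'g \<Rightarrow> 'g \<Rightarrow> 'g" +
  fixes q :: "'h \<Rightarrow> 'g"
  assumes q_linear: "Vector_Spaces.linear sh sg q"
    and q_br: "q (brh x y) = brg (q x) (q y)"
    and q_surj: "surj q"

definition ext_kernel :: "('h \<Rightarrow> 'g::zero) \<Rightarrow> 'h set"
  where "ext_kernel q = {x. q x = 0}"

definition linear_section ::
    "('k::field \<Rightarrow> 'h::ab_group_add \<Rightarrow> 'h) \<Rightarrow> ('k \<Rightarrow> 'g::ab_group_add \<Rightarrow> 'g)
      \<Rightarrow> ('h \<Rightarrow> 'g) \<Rightarrow> ('g \<Rightarrow> 'h) \<Rightarrow> bool"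
  where "linear_section sh sg q s \<longleftrightarrow> Vector_Spaces.linear sg sh s \<and> (\<forall>x. q (s x) = x)"


section \<open>Multilinear maps and cochains\<close>

text \<open>
  A map of \<open>k\<close> arguments is a function on lists, of which only the values on lists of
  length \<open>k\<close> (with entries in the domain \<open>S\<close>) are meaningful.
\<close>

definition sym_multilinear_on ::
    "('k::field \<Rightarrow> 'h::ab_group_add \<Rightarrow> 'h) \<Rightarrow> ('k \<Rightarrow> 'v::ab_group_add \<Rightarrow> 'v)
      \<Rightarrow> 'h set \<Rightarrow> nat \<Rightarrow> ('h list \<Rightarrow> 'v) \<Rightarrow> bool"
  where "sym_multilinear_on sh sv S k f \<longleftrightarrow>
    (\<forall>ys. length ys = k \<and> set ys \<subseteq> S \<longrightarrow>
      (\<forall>i<k. \<forall>a\<in>S. \<forall>b\<in>S. f (ys[i := a + b]) = f (ys[i := a]) + f (ys[i := b])) \<and>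
      (\<forall>i<k. \<forall>c. \<forall>a\<in>S. f (ys[i := sh c a]) = sv c (f (ys[i := a]))) \<and>
      (\<forall>\<tau>. \<tau> permutes {..<k} \<longrightarrow> f (permute_list \<tau> ys) = f ys))"

definition equivariant_on ::
    "('h \<Rightarrow> 'h \<Rightarrow> 'h) \<Rightarrow> ('g \<Rightarrow> 'v::ab_group_add \<Rightarrow> 'v) \<Rightarrow> ('h \<Rightarrow> 'g)
      \<Rightarrow> 'h set \<Rightarrow> nat \<Rightarrow> ('h list \<Rightarrow> 'v) \<Rightarrow> bool"
  where "equivariant_on brh act q S k f \<longleftrightarrow>
    (\<forall>x ys. length ys = k \<and> set ys \<subseteq> S \<longrightarrow>
      act (q x) (f ys) = (\<Sum>i<k. f (ys[i := brh x (ys ! i)])))"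

text \<open>\<open>nths xs (- I)\<close> is the list \<open>xs\<close> with the entries at the positions in \<open>I\<close> omitted.\<close>

definition ce_diff ::
    "('g \<Rightarrow> 'g \<Rightarrow> 'g) \<Rightarrow> ('k::field \<Rightarrow> 'v::ab_group_add \<Rightarrow> 'v) \<Rightarrow> ('g \<Rightarrow> 'v \<Rightarrow> 'v)
      \<Rightarrow> ('g list \<Rightarrow> 'v) \<Rightarrow> 'g list \<Rightarrow> 'v"
  where "ce_diff brg sv act \<omega> xs =
    (\<Sum>j<length xs. sv ((-1) ^ j) (act (xs ! j) (\<omega> (nths xs (- {j}))))) +
    (\<Sum>j<length xs. \<Sum>i<j.
      sv ((-1) ^ (i + j)) (\<omega> (brg (xs ! i) (xs ! j) # nths xs (- {i, j}))))"

text \<open>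
  In a list of pairs \<open>(p, \<phi>)\<close>, the number \<open>p\<close> is the degree of the cochain \<open>\<phi>\<close>;
  \<open>apply_blocks\<close> feeds consecutive blocks of the arguments to the cochains.
\<close>

fun apply_blocks :: "(nat \<times> ('g list \<Rightarrow> 'h)) list \<Rightarrow> 'g list \<Rightarrow> 'h list"
  where
    "apply_blocks [] xs = []"
  | "apply_blocks ((p, \<phi>) # \<phi>s) xs = \<phi> (take p xs) # apply_blocks \<phi>s (drop p xs)"

definition sym_wedge ::
    "('k::field_char_0 \<Rightarrow> 'v::ab_group_add \<Rightarrow> 'v) \<Rightarrow> ('h list \<Rightarrow> 'v)
      \<Rightarrow> (nat \<times> ('g list \<Rightarrow> 'h)) list \<Rightarrow> 'g list \<Rightarrow> 'v"
  where "sym_wedge sv f \<phi>s xs =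
    sv (1 / (\<Prod>(p, \<phi>)\<leftarrow>\<phi>s. fact p))
      (\<Sum>\<tau> | \<tau> permutes {..<sum_list (map fst \<phi>s)}.
        sv (of_int (sign \<tau>)) (f (apply_blocks \<phi>s (permute_list \<tau> xs))))"


section \<open>Coefficientwise integration over the standard simplex\<close>

definition bary :: "nat \<Rightarrow> (nat \<Rightarrow> real) \<Rightarrow> nat \<Rightarrow> real"
  where "bary n t i = (if i = 0 then 1 - (\<Sum>j=1..n. t j) else if i \<le> n then t i else 0)"

text \<open>
  The surface integral over the standard simplex divided by the Gram factor, for real
  integrands.
\<close>

definition simplex_integral :: "nat \<Rightarrow> ((nat \<Rightarrow> real) \<Rightarrow> real) \<Rightarrow> real"
  where "simplex_integral n F =
    (LINT t : {t \<in> {1..n} \<rightarrow>\<^sub>E UNIV. (\<forall>i\<in>{1..n}. 0 \<le> t i) \<and> (\<Sum>i=1..n. t i) \<le> 1} |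
      (\<Pi>\<^sub>M i\<in>{1..n}. lborel). F (bary n t))"

text \<open>
  A \<open>V\<close>-valued function that is polynomial on the simplex is integrated by integrating the
  monomials and keeping the coefficients \<open>c m\<close>, for multi-indices \<open>m\<close>. No topology on \<open>V\<close>
  is involved.
\<close>

definition has_poly_simplex_integral ::
    "('k::real_normed_field \<Rightarrow> 'v::ab_group_add \<Rightarrow> 'v) \<Rightarrow> nat
      \<Rightarrow> ((nat \<Rightarrow> real) \<Rightarrow> 'v) \<Rightarrow> 'v \<Rightarrow> bool"
  where "has_poly_simplex_integral sv n F v \<longleftrightarrow>
    (\<exists>(M :: (nat \<Rightarrow> nat) set) c. finite M \<and>
      (\<forall>t\<in>standard_simplex n. F t = (\<Sum>m\<in>M. sv (of_real (\<Prod>i\<le>n. t i ^ m i)) (c m))) \<and>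
      v = (\<Sum>m\<in>M. sv (of_real (simplex_integral n (\<lambda>t. \<Prod>i\<le>n. t i ^ m i))) (c m)))"

definition poly_simplex_integral ::
    "('k::real_normed_field \<Rightarrow> 'v::ab_group_add \<Rightarrow> 'v) \<Rightarrow> nat
      \<Rightarrow> ((nat \<Rightarrow> real) \<Rightarrow> 'v) \<Rightarrow> 'v"
  where "poly_simplex_integral sv n F = (THE v. has_poly_simplex_integral sv n F v)"

text \<open>The integral does not depend on the chosen polynomial representation.\<close>

lemma integrable_simplex_monomial:
  "set_integrable (\<Pi>\<^sub>M i\<in>{1..n}. lborel)
     {t \<in> {1..n} \<rightarrow>\<^sub>E UNIV. (\<forall>i\<in>{1..n}. 0 \<le> t i) \<and> (\<Sum>i=1..n. t i) \<le> 1}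
     (\<lambda>t. \<Prod>i\<le>n. bary n t i ^ m i)"
    (is "set_integrable ?P ?A ?F")
proof -
  interpret product_sigma_finite "\<lambda>_. lborel :: real measure" ..
  have sp: "space ?P = {1..n} \<rightarrow>\<^sub>E UNIV" by (simp add: space_PiM)
  have mb: "(\<lambda>t. bary n t i) \<in> borel_measurable ?P" for i
    unfolding bary_def by (cases "i = 0"; cases "i \<le> n") auto
  have F[measurable]: "?F \<in> borel_measurable ?P"
    using mb by measurable
  have A_eq: "?A = {t \<in> space ?P. (\<forall>i\<in>{1..n}. 0 \<le> t i) \<and> (\<Sum>i=1..n. t i) \<le> 1}"
    unfolding sp ..
  have A: "?A \<in> sets ?P"
    unfolding A_eq by measurable
  have le1: "t i \<le> 1" if "t \<in> ?A" "i \<in> {1..n}" for t i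
  proof -
    have "t i \<le> (\<Sum>i=1..n. t i)" using that by (intro member_le_sum) auto
    then show ?thesis using that by simp
  qed
  have sub: "?A \<subseteq> (\<Pi>\<^sub>E i\<in>{1..n}. {0..1})"
  proof
    fix t assume t: "t \<in> ?A"
    then have "t i \<in> {0..1}" if "i \<in> {1..n}" for i
      using le1[OF t that] that by simp
    with t show "t \<in> (\<Pi>\<^sub>E i\<in>{1..n}. {0..1})"
      by (auto simp only: PiE_iff mem_Collect_eq)
  qed
  have "emeasure ?P ?A \<le> emeasure ?P (\<Pi>\<^sub>E i\<in>{1..n}. {0..1})"
    using sub by (intro emeasure_mono sets_PiM_I_finite) auto
  also have "\<dots> = (\<Prod>i\<in>{1..n}. emeasure lborel {0..1::real})"
    by (intro emeasure_PiM) auto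
  also have "\<dots> < \<infinity>" by simp
  finally have fin: "emeasure ?P ?A < \<infinity>" .
  have bound: "norm (?F t) \<le> 1" if "t \<in> ?A" for t
  proof -
    have "0 \<le> bary n t i \<and> bary n t i \<le> 1" for i
    proof -
      have "0 \<le> (\<Sum>i=1..n. t i)" using that by (intro sum_nonneg) auto
      then show ?thesis using le1[OF that, of i] that by (auto simp: bary_def)
    qed
    then have "0 \<le> ?F t" "?F t \<le> 1"
      by (auto intro!: prod_nonneg prod_le_1 simp: power_le_one)
    then show ?thesis by simp
  qed
  show ?thesis
    unfolding set_integrable_def
    by (rule integrableI_bounded_set_indicator[where B = 1, OF A F fin]) (use bound in auto)
qed

lemma bary_in_standard_simplex:
  assumes "\<forall>i\<in>{1..n}. 0 \<le> t i" "(\<Sum>i=1..n. t i) \<le> 1"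
  shows "bary n t \<in> standard_simplex n"
proof -
  have "t i \<le> 1" if "i \<in> {1..n}" for i
    using member_le_sum[of i "{1..n}" t] assms that by auto
  moreover have "(\<Sum>i\<le>n. bary n t i) = 1"
  proof -
    have "(\<Sum>i\<le>n. bary n t i) = bary n t 0 + (\<Sum>i=1..n. bary n t i)"
      by (simp add: atMost_atLeast0 sum.atLeast_Suc_atMost)
    also have "(\<Sum>i=1..n. bary n t i) = (\<Sum>i=1..n. t i)"
      by (intro sum.cong) (auto simp: bary_def)
    finally show ?thesis by (simp add: bary_def)
  qed
  moreover have "0 \<le> (\<Sum>i=1..n. t i)"
    using assms(1) by (intro sum_nonneg) auto
  ultimately show ?thesis
    using assms unfolding standard_simplex_def mem_Collect_eq
    by (intro conjI allI impI) (auto simp: bary_def)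
qed

lemma simplex_integral_combination:
  fixes a :: "(nat \<Rightarrow> nat) \<Rightarrow> real"
  assumes "finite M" "\<And>t. t \<in> standard_simplex n \<Longrightarrow> F t = (\<Sum>m\<in>M. a m * (\<Prod>i\<le>n. t i ^ m i))"
  shows "simplex_integral n F = (\<Sum>m\<in>M. a m * simplex_integral n (\<lambda>t. \<Prod>i\<le>n. t i ^ m i))"
proof -
  let ?P = "(\<Pi>\<^sub>M i\<in>{1..n}. lborel) :: (nat \<Rightarrow> real) measure"
  let ?A = "{t \<in> {1..n} \<rightarrow>\<^sub>E UNIV. (\<forall>i\<in>{1..n}. 0 \<le> t i) \<and> (\<Sum>i=1..n. t i) \<le> (1::real)}"
  have "simplex_integral n F = (LINT t|?P. (\<Sum>m\<in>M. a m * (indicator ?A t * (\<Prod>i\<le>n. bary n t i ^ m i))))"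
    unfolding simplex_integral_def set_lebesgue_integral_def
  proof (intro Bochner_Integration.integral_cong refl)
    fix t
    show "indicator ?A t *\<^sub>R F (bary n t) =
        (\<Sum>m\<in>M. a m * (indicator ?A t * (\<Prod>i\<le>n. bary n t i ^ m i)))"
    proof (cases "t \<in> ?A")
      case True
      then have "bary n t \<in> standard_simplex n" by (intro bary_in_standard_simplex) auto
      from assms(2)[OF this] show ?thesis using True by simp
    next
      case False
      then have "indicator ?A t = (0 :: real)" by (rule indicator_simps)
      then show ?thesis by simp
    qed
  qed
  also have "\<dots> = (\<Sum>m\<in>M. a m * simplex_integral n (\<lambda>t. \<Prod>i\<le>n. t i ^ m i))"
    using integrable_simplex_monomial[of n]
    by (subst Bochner_Integration.integral_sum)
       (auto simp: set_integrable_def simplex_integral_def set_lebesgue_integral_def)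
  finally show ?thesis .
qed

lemma has_poly_simplex_integral_unique:
  assumes "vector_space sv"
    and v: "has_poly_simplex_integral sv n F v" and w: "has_poly_simplex_integral sv n F w"
  shows "v = w"
proof -
  interpret K: vector_space sv by fact
  define rs where "rs r = sv (of_real r)" for r
  interpret R: vector_space rs
    by unfold_locales (auto simp: rs_def K.scale_right_distrib K.scale_left_distrib)
  define B where "B = R.extend_basis {}"
  have B: "R.independent B" "R.span B = UNIV"
    unfolding B_def
    by (rule R.independent_extend_basis[OF R.independent_empty]
        R.span_extend_basis[OF R.independent_empty])+
  have eq: "R.representation B u b = simplex_integral n (\<lambda>t. R.representation B (F t) b)"
    if hu: "has_poly_simplex_integral sv n F u" for u b
  proof -
    obtain M :: "(nat \<Rightarrow> nat) set" and c where M: "finite M"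
        "\<And>t. t \<in> standard_simplex n \<Longrightarrow> F t = (\<Sum>m\<in>M. rs (\<Prod>i\<le>n. t i ^ m i) (c m))"
        "u = (\<Sum>m\<in>M. rs (simplex_integral n (\<lambda>t. \<Prod>i\<le>n. t i ^ m i)) (c m))"
      using hu[unfolded has_poly_simplex_integral_def, folded rs_def]
      by (elim exE conjE) (rule that, assumption, erule (1) bspec, assumption)
    have rep: "R.representation B (\<Sum>m\<in>M. rs (a m) (c m)) b
        = (\<Sum>m\<in>M. R.representation B (c m) b * a m)" for a
    proof -
      have "R.representation B (\<Sum>m\<in>M. rs (a m) (c m))
          = (\<lambda>b. \<Sum>m\<in>M. R.representation B (rs (a m) (c m)) b)"
        by (rule R.representation_sum) (use B in auto)
      then show ?thesis
        using B by (simp add: R.representation_scale mult.commute)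
    qed
    have "simplex_integral n (\<lambda>t. R.representation B (F t) b)
        = (\<Sum>m\<in>M. R.representation B (c m) b * simplex_integral n (\<lambda>t. \<Prod>i\<le>n. t i ^ m i))"
      by (rule simplex_integral_combination) (auto simp: M rep)
    also have "\<dots> = R.representation B u b"
      by (simp add: M(3) rep)
    finally show ?thesis ..
  qed
  have rep_eq: "R.representation B v = R.representation B w"
    by (rule ext) (simp only: eq[OF v] eq[OF w])
  have expand: "(\<Sum>b | R.representation B u b \<noteq> 0. rs (R.representation B u b) b) = u" for u
    by (rule R.sum_nonzero_representation_eq[OF B(1)]) (simp add: B(2))
  from expand[of v] show ?thesis
    unfolding rep_eq expand by (rule sym)
qed

lemma poly_simplex_integral_eqI:
  assumes "vector_space sv" "has_poly_simplex_integral sv n F v"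
  shows "poly_simplex_integral sv n F = v"
  unfolding poly_simplex_integral_def
  using has_poly_simplex_integral_unique[OF assms(1)] assms(2) by blast

section \<open>The simplex cochains of a symmetric invariant map\<close>

definition affine_section ::
    "('k::real_normed_field \<Rightarrow> 'h::ab_group_add \<Rightarrow> 'h) \<Rightarrow> ('g \<Rightarrow> 'h) list
      \<Rightarrow> (nat \<Rightarrow> real) \<Rightarrow> 'g \<Rightarrow> 'h"
  where "affine_section sh \<sigma>s t x = (\<Sum>i<length \<sigma>s. sh (of_real (t i)) ((\<sigma>s ! i) x))"

definition curvature ::
    "('h \<Rightarrow> 'h \<Rightarrow> 'h::ab_group_add) \<Rightarrow> ('g \<Rightarrow> 'g \<Rightarrow> 'g) \<Rightarrow> ('g \<Rightarrow> 'h) \<Rightarrow> 'g list \<Rightarrow> 'h"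
  where "curvature brh brg s xs =
    brh (s (xs ! 0)) (s (xs ! 1)) - s (brg (xs ! 0) (xs ! 1))"

definition section_diff :: "('g \<Rightarrow> 'h::ab_group_add) list \<Rightarrow> nat \<Rightarrow> 'g list \<Rightarrow> 'h"
  where "section_diff \<sigma>s i xs = (\<sigma>s ! i) (xs ! 0) - (\<sigma>s ! 0) (xs ! 0)"

text \<open>
  \<open>simplex_cochain sh brh brg sv k f [\<sigma>\<^sub>0, \<dots>, \<sigma>\<^sub>n]\<close> is \<open>\<Delta>\<^sub>f(\<sigma>\<^sub>0, \<dots>, \<sigma>\<^sub>n)\<close>, a cochain of degree
  \<open>2 k - n\<close>, for \<open>n \<le> k\<close> and \<open>f\<close> of \<open>k\<close> arguments.
\<close>

definition simplex_cochain ::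
    "('k::real_normed_field \<Rightarrow> 'h::ab_group_add \<Rightarrow> 'h) \<Rightarrow> ('h \<Rightarrow> 'h \<Rightarrow> 'h)
      \<Rightarrow> ('g \<Rightarrow> 'g \<Rightarrow> 'g) \<Rightarrow> ('k \<Rightarrow> 'v::ab_group_add \<Rightarrow> 'v) \<Rightarrow> nat
      \<Rightarrow> ('h list \<Rightarrow> 'v) \<Rightarrow> ('g \<Rightarrow> 'h) list \<Rightarrow> 'g list \<Rightarrow> 'v"
  where "simplex_cochain sh brh brg sv k f \<sigma>s xs =
    (let n = length \<sigma>s - 1 in
      poly_simplex_integral sv n (\<lambda>t.
        sym_wedge sv f
          (map (\<lambda>i. (1, section_diff \<sigma>s i)) [1..<Suc n] @
           replicate (k - n) (2, curvature brh brg (affine_section sh \<sigma>s t)))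
          xs))"

end

theory Submission
  imports Defs
begin

text \<open>
  The theorem is Stokes' theorem on the simplex. Write \<open>\<alpha>\<^sub>i = \<sigma>\<^sub>i - \<sigma>\<^sub>0\<close>, let \<open>R\<^sub>t\<close> be the
  curvature of \<open>\<sigma>\<^sub>t\<close>, and let \<open>d\<^sup>t\<close> be the covariant differential on \<open>\<nn>\<close>-valued cochains that
  \<open>\<sigma>\<^sub>t\<close> induces. For fixed \<open>t\<close>, equivariance of \<open>f\<close> gives a product rule: the differential of
  \<open>f(\<alpha>\<^sub>1, \<dots>, \<alpha>\<^sub>n, R\<^sub>t, \<dots>, R\<^sub>t)\<close> is a signed sum of terms in which \<open>d\<^sup>t\<close> is applied to one entry
  (\<open>ce_diff_wedge\<close>). The terms that contain \<open>d\<^sup>t R\<^sub>t\<close> vanish by the Bianchi identity, and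
  \<open>d\<^sup>t \<alpha>\<^sub>i\<close> is the derivative \<open>\<partial>\<^sub>i R\<^sub>t\<close> along the edge from the vertex \<open>0\<close> to the vertex \<open>i\<close>
  (\<open>deriv_h_curvature\<close>). As \<open>2\<close>-forms commute with everything, \<open>k - n + 1\<close> times the differential
  equals the divergence \<open>\<Sum>\<^sub>i (-1)\<^sup>i\<^sup>-\<^sup>1 \<partial>\<^sub>i f(\<alpha>\<^sub>1, \<dots>, \<alpha>\<^sub>n, R\<^sub>t, \<dots>, R\<^sub>t)\<close>, where \<open>\<alpha>\<^sub>i\<close> is omitted and
  \<open>R\<^sub>t\<close> occurs \<open>k - n + 1\<close> times.

  Integrating \<open>\<partial>\<^sub>i\<close> leaves the face opposite to the vertex \<open>0\<close> minus the face opposite to the vertex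
  \<open>i\<close> (\<open>stokes_simplex\<close>). On the latter face the integrand is the one for the sections without
  \<open>\<sigma>\<^sub>i\<close>. On the former, all \<open>n\<close> summands contribute; together they form the integrand
  for \<open>\<sigma>\<^sub>1, \<dots>, \<sigma>\<^sub>n\<close>, whose one-forms are \<open>\<sigma>\<^sub>j - \<sigma>\<^sub>1 = \<alpha>\<^sub>j - \<alpha>\<^sub>1\<close>: expanding the
  alternating expression in these differences, a term with \<open>\<alpha>\<^sub>1\<close> in two places vanishes
  (\<open>wedge_change_base_point\<close>).

  Two choices keep the calculations short. First, a wedge product is the alternating sum of a
  function \<open>g\<close> on lists that has no symmetry of its own, and the Chevalley--Eilenberg differential
  of the alternating sum of \<open>g\<close> is the alternating sum of a simple expression in \<open>g\<close>
  (\<open>ce_diff_alternation\<close>). The product rule can then be read off from how this expression meets the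
  blocks of arguments, and shuffles do not enter. Second, \<open>V\<close> has no topology, so the
  derivatives along the simplex are formal; Stokes' theorem reduces to monomials, where it is
  an identity between Dirichlet integrals \<open>\<Prod>\<^sub>i m\<^sub>i! / (n + \<Sum>\<^sub>i m\<^sub>i)!\<close>
  (\<open>simplex_integral_monomial\<close>).
\<close>

section \<open>Lists with omitted entries and alternating sums\<close>

lemma nths_omit_one:
  assumes "j < length xs"
  shows "nths xs (- {j}) = take j xs @ drop (Suc j) xs"
proof -
  have "nths (take j xs @ xs ! j # drop (Suc j) xs) (- {j}) = take j xs @ drop (Suc j) xs"
  proof -
    have 1: "nths (take j xs) (- {j}) = take j xs"
      by (rule nths_all) auto
    have 2: "{i. Suc (i + j) \<in> - {j}} = UNIV" "{i. i + j \<in> - {j}} = - {0}" by auto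
    show ?thesis using assms by (simp add: nths_append 1 nths_Cons nths_all min_def 2)
  qed
  then show ?thesis using assms by (simp flip: id_take_nth_drop)
qed

lemma length_nths_omit_one: "j < length xs \<Longrightarrow> length (nths xs (- {j})) = length xs - 1"
  by (simp add: nths_omit_one)

lemma nth_nths_omit_one:
  assumes "j < length xs" "b < length xs - 1"
  shows "nths xs (- {j}) ! b = (if b < j then xs ! b else xs ! Suc b)"
  using assms by (auto simp: nths_omit_one nth_append min_def)

lemma nths_omit_two:
  assumes "i < j" "j < length xs"
  shows "nths xs (- {i, j}) = take i xs @ take (j - Suc i) (drop (Suc i) xs) @ drop (Suc j) xs"
proof -
  have "xs = take j xs @ xs ! j # drop (Suc j) xs" using assms by (simp flip: id_take_nth_drop)
  then have "nths xs (- {i, j}) = nths (take j xs @ xs ! j # drop (Suc j) xs) (- {i, j})" by simp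
  also have "\<dots> = nths (take j xs) (- {i, j}) @ drop (Suc j) xs"
  proof -
    have 2: "{ia. Suc (ia + j) \<in> - {i, j}} = UNIV" using assms by auto
    show ?thesis using assms by (simp add: nths_append nths_Cons nths_all min_def 2)
  qed
  also have "nths (take j xs) (- {i, j}) = nths (take j xs) (- {i})"
    by (auto simp: nths_def intro!: arg_cong[where f = "map fst"] filter_cong dest!: set_zip_rightD)
  also have "\<dots> = take i xs @ take (j - Suc i) (drop (Suc i) xs)"
    using assms by (simp add: nths_omit_one min_def drop_take)
  finally show ?thesis by simp
qed

lemma nths_omit_one_omit_one:
  assumes "a < length xs" "b < length xs - 1"
  shows "nths (nths xs (- {a})) (- {b}) = nths xs (- {a, if b < a then b else Suc b})"
proof (cases "b < a")
  case True
  then show ?thesis using assms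
    by (simp add: nths_omit_one nths_omit_two insert_commute[of a b] min_def drop_take)
next
  case False
  then show ?thesis using assms
    by (simp add: nths_omit_one nths_omit_two min_def take_drop)
qed

text \<open>Choosing two positions one after the other: the second choice \<open>b\<close> is made in the list from which
  position \<open>a\<close> is already gone, so it refers to the position \<open>b\<close> or \<open>Suc b\<close> of the original list.\<close>

lemma sum_ordered_pairs_omitting:
  fixes T :: "nat \<Rightarrow> nat \<Rightarrow> 'a::comm_monoid_add"
  shows "(\<Sum>a<Suc n. \<Sum>b<n. T a (if b < a then b else Suc b)) = (\<Sum>j<Suc n. \<Sum>i<j. T j i + T i j)"
proof -
  have "(\<Sum>b<n. T a (if b < a then b else Suc b)) = (\<Sum>b<a. T a b) + (\<Sum>b\<in>{a<..<Suc n}. T a b)"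
    if "a < Suc n" for a
  proof -
    have "(\<Sum>b<n. T a (if b < a then b else Suc b))
        = (\<Sum>b<a. T a (if b < a then b else Suc b)) + (\<Sum>b\<in>{a..<n}. T a (if b < a then b else Suc b))"
      using that by (subst sum.union_disjoint[symmetric]) (auto intro!: sum.cong)
    also have "(\<Sum>b\<in>{a..<n}. T a (if b < a then b else Suc b)) = (\<Sum>b\<in>{a<..<Suc n}. T a b)"
      by (rule sum.reindex_bij_witness[of _ "\<lambda>b. b - 1" Suc]) auto
    finally show ?thesis by simp
  qed
  then have "(\<Sum>a<Suc n. \<Sum>b<n. T a (if b < a then b else Suc b))
      = (\<Sum>a<Suc n. \<Sum>b<a. T a b) + (\<Sum>a<Suc n. \<Sum>b\<in>{a<..<Suc n}. T a b)"
    by (simp add: sum.distrib del: sum.lessThan_Suc)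
  also have "(\<Sum>a<Suc n. \<Sum>b\<in>{a<..<Suc n}. T a b) = (\<Sum>b<Suc n. \<Sum>a<b. T a b)"
    unfolding sum.Sigma[OF finite_lessThan ballI[OF finite_greaterThanLessThan]]
      sum.Sigma[OF finite_lessThan ballI[OF finite_lessThan]]
    by (rule sum.reindex_bij_witness[of _ "\<lambda>(x,y). (y,x)" "\<lambda>(x,y). (y,x)"]) auto
  finally show ?thesis by (simp add: sum.distrib del: sum.lessThan_Suc)
qed

text \<open>The sum of \<open>sgn \<tau> g(x\<^sub>\<tau>\<^sub>1, \<dots>, x\<^sub>\<tau>\<^sub>N)\<close> over all permutations \<open>\<tau>\<close>
  (\<open>alternation_eq_sum_permutes\<close>), organised by the argument that comes first. The recursion has
  the same shape as the first sum of the Chevalley--Eilenberg differential.\<close>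

primrec alternation ::
    "('k::field \<Rightarrow> 'v::ab_group_add \<Rightarrow> 'v) \<Rightarrow> nat \<Rightarrow> ('x list \<Rightarrow> 'v) \<Rightarrow> 'x list \<Rightarrow> 'v"
  where
    "alternation sv 0 g xs = g []"
  | "alternation sv (Suc N) g xs =
      (\<Sum>j<Suc N. sv ((-1) ^ j) (alternation sv N (\<lambda>ys. g (xs ! j # ys)) (nths xs (- {j}))))"

definition swap_adjacent :: "nat \<Rightarrow> 'x list \<Rightarrow> 'x list"
  where "swap_adjacent i xs = take i xs @ xs ! Suc i # xs ! i # drop (Suc (Suc i)) xs"

definition pull_front :: "nat \<Rightarrow> 'x list \<Rightarrow> 'x list"
  where "pull_front p xs = xs ! p # take p xs @ drop (Suc p) xs"

context vector_space
begin

lemma alternation_cong: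
  assumes "\<And>ys. length ys = N \<Longrightarrow> g ys = h ys"
  shows "alternation scale N g xs = alternation scale N h xs"
  using assms
proof (induction N arbitrary: g h xs)
  case (Suc N)
  have "alternation scale N (\<lambda>ys. g (xs ! j # ys)) (nths xs (- {j}))
      = alternation scale N (\<lambda>ys. h (xs ! j # ys)) (nths xs (- {j}))" for j
    by (rule Suc.IH) (use Suc.prems in auto)
  then show ?case by simp
qed simp

lemma alternation_sum:
  "alternation scale N (\<lambda>ys. \<Sum>i\<in>I. g i ys) xs = (\<Sum>i\<in>I. alternation scale N (g i) xs)"
proof (induction N arbitrary: g xs)
  case (Suc N)
  show ?case
    by (simp only: alternation.simps Suc.IH scale_sum_right) (rule sum.swap)
qed simp

lemma alternation_scale:
  "alternation scale N (\<lambda>ys. scale c (g ys)) xs = scale c (alternation scale N g xs)"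
proof (induction N arbitrary: g xs)
  case (Suc N)
  show ?case
    by (simp only: alternation.simps Suc.IH scale_sum_right scale_scale mult.commute)
qed simp

lemma alternation_add:
  "alternation scale N (\<lambda>ys. g ys + h ys) xs = alternation scale N g xs + alternation scale N h xs"
  using alternation_sum[of N "\<lambda>b. if b then g else h" UNIV xs] by (simp add: UNIV_bool add.commute)

lemma alternation_minus:
  "alternation scale N (\<lambda>ys. - g ys) xs = - alternation scale N g xs"
  using alternation_scale[of N "-1" g xs] by simp

lemma alternation_diff:
  "alternation scale N (\<lambda>ys. g ys - h ys) xs = alternation scale N g xs - alternation scale N h xs"
  using alternation_add[of N g "\<lambda>ys. - h ys" xs] by (simp add: alternation_minus)

text \<open>The expansion by the first two arguments. Each pair \<open>i < j\<close> occurs in both orders and with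
  opposite signs, since the choice of \<open>i\<close> before \<open>j\<close> lowers the position of \<open>j\<close> by one.\<close>

lemma alternation_Suc_Suc:
  assumes "length xs = Suc (Suc N)"
  shows "alternation scale (Suc (Suc N)) g xs =
    (\<Sum>j<Suc (Suc N). \<Sum>i<j. scale ((-1) ^ (i + j))
      (alternation scale N (\<lambda>ys. g (xs ! j # xs ! i # ys)) (nths xs (- {i, j}))
        - alternation scale N (\<lambda>ys. g (xs ! i # xs ! j # ys)) (nths xs (- {i, j}))))"
proof -
  \<comment> \<open>the sign with which the argument \<open>a\<close> followed by the argument \<open>c\<close> enters the expansion; for \<open>c > a\<close> the position of \<open>c\<close> has dropped by one\<close>
  define T where "T a c = scale ((if c < a then 1 else -1) * (-1) ^ (a + c))
     (alternation scale N (\<lambda>ys. g (xs ! a # xs ! c # ys)) (nths xs (- {a, c})))" for a c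
  have "alternation scale (Suc (Suc N)) g xs = (\<Sum>a<Suc (Suc N). \<Sum>b<Suc N. scale ((-1) ^ a * (-1) ^ b)
      (alternation scale N (\<lambda>ys. g (xs ! a # nths xs (- {a}) ! b # ys)) (nths (nths xs (- {a})) (- {b}))))"
    by (simp only: alternation.simps scale_sum_right scale_scale)
  also have "\<dots> = (\<Sum>a<Suc (Suc N). \<Sum>b<Suc N. T a (if b < a then b else Suc b))"
    by (intro sum.cong refl)
      (auto simp: assms T_def nth_nths_omit_one nths_omit_one_omit_one power_add)
  also have "\<dots> = (\<Sum>j<Suc (Suc N). \<Sum>i<j. T j i + T i j)"
    by (rule sum_ordered_pairs_omitting)
  also have "\<dots> = (\<Sum>j<Suc (Suc N). \<Sum>i<j. scale ((-1) ^ (i + j))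
      (alternation scale N (\<lambda>ys. g (xs ! j # xs ! i # ys)) (nths xs (- {i, j}))
        - alternation scale N (\<lambda>ys. g (xs ! i # xs ! j # ys)) (nths xs (- {i, j}))))"
    by (intro sum.cong refl)
      (auto simp: T_def scale_right_diff_distrib insert_commute add.commute)
  finally show ?thesis .
qed

text \<open>The alternating sums below are reordered by adjacent transpositions only. At the front
  of the list the sign is visible in the expansion by two arguments; elsewhere it follows
  by induction.\<close>

lemma alternation_swap_adjacent:
  assumes "Suc i < N" "length xs = N"
  shows "alternation scale N (\<lambda>ys. g (swap_adjacent i ys)) xs = - alternation scale N g xs"
  using assms
proof (induction i arbitrary: N g xs)
  case 0
  then obtain M where M: "N = Suc (Suc M)" by (metis less_imp_Suc_add add_Suc add_0)
  show ?case unfolding M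
    using 0 by (simp only: M alternation_Suc_Suc)
      (simp add: swap_adjacent_def sum_negf[symmetric] scale_minus_right[symmetric] del: scale_minus_right sum.lessThan_Suc)
next
  case (Suc i)
  then obtain M where M: "N = Suc M" by (metis less_imp_Suc_add)
  have "alternation scale M (\<lambda>ys. g (swap_adjacent (Suc i) (xs ! j # ys))) (nths xs (- {j}))
      = - alternation scale M (\<lambda>ys. g (xs ! j # ys)) (nths xs (- {j}))" if "j < N" for j
    using Suc.IH[of M "nths xs (- {j})" "\<lambda>ys. g (xs ! j # ys)"] Suc.prems that M
    by (simp add: swap_adjacent_def length_nths_omit_one)
  then show ?case unfolding M
    by (simp add: sum_negf[symmetric] M del: sum.lessThan_Suc)
qed

lemma alternation_pull_front:
  fixes g :: "'x list \<Rightarrow> 'b"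
  assumes "p < N" "length xs = N"
  shows "alternation scale N (\<lambda>ys. g (pull_front p ys)) xs = scale ((-1) ^ p) (alternation scale N g xs)"
  using assms
proof (induction p)
  case 0
  then show ?case
    by (simp add: pull_front_def Cons_nth_drop_Suc cong: alternation_cong)
next
  case (Suc p)
  have "pull_front (Suc p) ys = pull_front p (swap_adjacent p ys)" if "length ys = N" for ys :: "'x list"
    using Suc.prems that
    by (simp add: pull_front_def swap_adjacent_def nth_append min_def take_Suc_conv_app_nth)
  then have "alternation scale N (\<lambda>ys. g (pull_front (Suc p) ys)) xs
      = alternation scale N (\<lambda>ys. g (pull_front p (swap_adjacent p ys))) xs"
    by (intro alternation_cong) simp
  also have "\<dots> = - alternation scale N (\<lambda>ys. g (pull_front p ys)) xs"
    using Suc.prems by (intro alternation_swap_adjacent) auto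
  finally show ?case using Suc by simp
qed

end

section \<open>Permutations and the differential of an alternating sum\<close>

definition cycle_to_front :: "nat \<Rightarrow> nat \<Rightarrow> nat"
  where "cycle_to_front j i = (if i = 0 then j else if i \<le> j then i - 1 else i)"

definition shift_perm :: "(nat \<Rightarrow> nat) \<Rightarrow> nat \<Rightarrow> nat"
  where "shift_perm \<tau> i = (case i of 0 \<Rightarrow> 0 | Suc i' \<Rightarrow> Suc (\<tau> i'))"

lemma cycle_to_front_0: "cycle_to_front 0 = id"
  by (auto simp: cycle_to_front_def)

lemma cycle_to_front_Suc: "cycle_to_front (Suc j) = Transposition.transpose j (Suc j) \<circ> cycle_to_front j"
  by (auto simp: cycle_to_front_def Transposition.transpose_def fun_eq_iff le_Suc_eq)

lemma cycle_to_front_permutes: "j < n \<Longrightarrow> cycle_to_front j permutes {..<n}"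
proof (induction j)
  case 0
  then show ?case unfolding cycle_to_front_0 by (intro permutes_id)
next
  case (Suc j)
  then show ?case unfolding cycle_to_front_Suc
    by (intro permutes_compose permutes_swap_id) auto
qed

lemma sign_cycle_to_front: "sign (cycle_to_front j) = (-1) ^ j"
proof (induction j)
  case (Suc j)
  have "permutation (cycle_to_front j)"
    by (rule permutes_imp_permutation[OF finite_lessThan cycle_to_front_permutes[OF lessI]])
  then show ?case unfolding cycle_to_front_Suc
    by (subst sign_compose) (simp_all add: permutation_swap_id sign_swap_id Suc)
qed (simp add: cycle_to_front_0)

lemma shift_perm_eq_map_permutation:
  assumes "\<tau> permutes {..<n}"
  shows "shift_perm \<tau> = map_permutation {..<n} Suc \<tau>"
proof
  fix i
  have inv: "inv_into {..<n} Suc (Suc i') = i'" if "i' < n" for i'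
    using that by (intro inv_into_f_eq) auto
  show "shift_perm \<tau> i = map_permutation {..<n} Suc \<tau> i"
    using assms inv by (cases i) (auto simp: shift_perm_def map_permutation_def restrict_id_def permutes_not_in image_iff)
qed

lemma sign_shift_perm: "\<tau> permutes {..<n} \<Longrightarrow> sign (shift_perm \<tau>) = sign \<tau>"
  by (simp add: shift_perm_eq_map_permutation sign_map_permutation)

lemma shift_perm_permutes:
  assumes "\<tau> permutes {..<n}"
  shows "shift_perm \<tau> permutes {..<Suc n}"
proof -
  have "map_permutation {..<n} Suc \<tau> permutes (Suc ` {..<n})"
    by (rule map_permutation_permutes) (use assms in \<open>auto simp: bij_betw_def\<close>)
  then show ?thesis
    using assms by (subst shift_perm_eq_map_permutation) (auto intro: permutes_subset)
qed

lemma permute_list_cycle_to_front: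
  assumes "j < length xs"
  shows "permute_list (cycle_to_front j) xs = xs ! j # nths xs (- {j})"
  using assms
  by (intro nth_equalityI)
    (auto simp: permute_list_nth cycle_to_front_permutes length_nths_omit_one nth_Cons' nth_nths_omit_one,
     auto simp: cycle_to_front_def)

lemma permute_list_shift_perm:
  assumes "\<tau> permutes {..<length ys}"
  shows "permute_list (shift_perm \<tau>) (y # ys) = y # permute_list \<tau> ys"
proof (intro nth_equalityI)
  fix i assume "i < length (permute_list (shift_perm \<tau>) (y # ys))"
  then show "permute_list (shift_perm \<tau>) (y # ys) ! i = (y # permute_list \<tau> ys) ! i"
    using shift_perm_permutes[OF assms] assms
    by (cases i) (auto simp: permute_list_nth shift_perm_def)
qed simp

text \<open>Permutations of \<open>{..<Suc n}\<close> are sorted by the image \<open>j\<close> of \<open>0\<close>. Composition with the cycle that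
  brings \<open>j\<close> to the front has sign \<open>(-1) ^ j\<close> and preserves the order of the other entries, which
  is the convention of \<open>alternation\<close>. Injectivity and equal cardinalities give the bijection.\<close>

lemma bij_betw_permutes_Suc:
  "bij_betw (\<lambda>(j, \<tau>). cycle_to_front j \<circ> shift_perm \<tau>)
     ({..<Suc n} \<times> {\<tau>. \<tau> permutes {..<n}}) {\<rho>. \<rho> permutes {..<Suc n}}"
proof -
  let ?F = "\<lambda>(j, \<tau>). cycle_to_front j \<circ> shift_perm \<tau>"
  let ?A = "{..<Suc n} \<times> {\<tau>. \<tau> permutes {..<n}}"
  have inj: "inj_on ?F ?A"
  proof (rule inj_onI, clarsimp)
    fix j \<tau> j' \<tau>'
    assume *: "j < Suc n" "cycle_to_front j \<circ> shift_perm \<tau> = cycle_to_front j' \<circ> shift_perm \<tau>'"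
    from fun_cong[OF *(2), of 0] have jj: "j = j'"
      by (simp add: shift_perm_def cycle_to_front_def)
    have "inj (cycle_to_front j)"
      by (rule permutes_inj[OF cycle_to_front_permutes[OF *(1)]])
    then have "shift_perm \<tau> i = shift_perm \<tau>' i" for i
      using fun_cong[OF *(2), of i] by (auto simp: jj dest: injD)
    from this[of "Suc _"] show "j = j' \<and> \<tau> = \<tau>'"
      by (auto simp: jj shift_perm_def)
  qed
  have fin: "finite {\<rho>. \<rho> permutes {..<Suc n}}" by (rule finite_permutations) simp
  have sub: "?F ` ?A \<subseteq> {\<rho>. \<rho> permutes {..<Suc n}}"
    by (auto intro!: permutes_compose shift_perm_permutes cycle_to_front_permutes)
  have "card (?F ` ?A) = card {\<rho>. \<rho> permutes {..<Suc n}}"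
    using inj by (simp add: card_image card_cartesian_product card_permutations)
  then have "?F ` ?A = {\<rho>. \<rho> permutes {..<Suc n}}"
    by (rule card_subset_eq[OF fin sub])
  with inj show ?thesis by (simp add: bij_betw_def)
qed

context vector_space
begin

lemma alternation_eq_sum_permutes:
  assumes "length xs = N"
  shows "alternation scale N g xs =
    (\<Sum>\<tau> | \<tau> permutes {..<N}. scale (of_int (sign \<tau>)) (g (permute_list \<tau> xs)))"
  using assms
proof (induction N arbitrary: g xs)
  case 0
  then show ?case by simp
next
  case (Suc N)
  have "(\<Sum>\<rho> | \<rho> permutes {..<Suc N}. scale (of_int (sign \<rho>)) (g (permute_list \<rho> xs)))
      = (\<Sum>(j, \<tau>)\<in>{..<Suc N} \<times> {\<tau>. \<tau> permutes {..<N}}.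
          scale (of_int (sign (cycle_to_front j \<circ> shift_perm \<tau>))) (g (permute_list (cycle_to_front j \<circ> shift_perm \<tau>) xs)))"
    by (subst sum.reindex_bij_betw[OF bij_betw_permutes_Suc, symmetric]) (simp add: case_prod_unfold)
  also have "\<dots> = (\<Sum>(j, \<tau>)\<in>{..<Suc N} \<times> {\<tau>. \<tau> permutes {..<N}}.
          scale ((-1) ^ j) (scale (of_int (sign \<tau>)) (g (xs ! j # permute_list \<tau> (nths xs (- {j}))))))"
  proof (intro sum.cong refl, clarsimp)
    fix j \<tau> assume j: "j < Suc N" and \<tau>: "\<tau> permutes {..<N}"
    have perm: "permutation (cycle_to_front j)" "permutation (shift_perm \<tau>)"
      by (rule permutes_imp_permutation[OF finite_lessThan], rule cycle_to_front_permutes[OF j] shift_perm_permutes[OF \<tau>])+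
    have "permute_list (cycle_to_front j \<circ> shift_perm \<tau>) xs = xs ! j # permute_list \<tau> (nths xs (- {j}))"
      using Suc.prems j \<tau> shift_perm_permutes[OF \<tau>]
      by (simp add: permute_list_compose permute_list_cycle_to_front permute_list_shift_perm length_nths_omit_one)
    then show "scale (of_int (sign (cycle_to_front j \<circ> shift_perm \<tau>)))
          (g (permute_list (cycle_to_front j \<circ> shift_perm \<tau>) xs))
        = scale ((- 1) ^ j * of_int (sign \<tau>)) (g (xs ! j # permute_list \<tau> (nths xs (- {j}))))"
      by (simp add: sign_compose perm sign_cycle_to_front sign_shift_perm[OF \<tau>])
  qed
  also have "\<dots> = (\<Sum>j<Suc N. scale ((-1) ^ j) (\<Sum>\<tau> | \<tau> permutes {..<N}.
          (scale (of_int (sign \<tau>)) (g (xs ! j # permute_list \<tau> (nths xs (- {j})))))))"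
    by (simp only: sum.cartesian_product[symmetric] scale_sum_right)
  also have "\<dots> = alternation scale (Suc N) g xs"
    using Suc by (simp add: length_nths_omit_one del: sum.lessThan_Suc)
  finally show ?case ..
qed

text \<open>The expansion by the place at which a given argument is inserted, dual to the defining
  expansion by the argument that is inserted at a given place.\<close>

lemma alternation_insert:
  assumes "length zs = N"
  shows "alternation scale (Suc N) g (y # zs) =
    (\<Sum>p<Suc N. scale ((-1) ^ p) (alternation scale N (\<lambda>ws. g (take p ws @ y # drop p ws)) zs))"
  using assms
proof (induction N arbitrary: g zs)
  case 0
  then show ?case by simp
next
  case (Suc N)
  have c: "{j. Suc j \<in> - {0}} = UNIV" "\<And>j. {i. i \<noteq> j} = - {j}" by auto
  have "alternation scale (Suc (Suc N)) g (y # zs) = alternation scale (Suc N) (\<lambda>ws. g (y # ws)) zs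
     + (\<Sum>j<Suc N. scale ((-1) ^ Suc j)
         (alternation scale (Suc N) (\<lambda>ws. g (zs ! j # ws)) (y # nths zs (- {j}))))"
    by (subst alternation.simps(2), subst sum.lessThan_Suc_shift)
      (simp add: nths_Cons nths_all c del: alternation.simps sum.lessThan_Suc)
  also have "(\<Sum>j<Suc N. scale ((-1) ^ Suc j)
         (alternation scale (Suc N) (\<lambda>ws. g (zs ! j # ws)) (y # nths zs (- {j}))))
    = (\<Sum>j<Suc N. scale ((-1) ^ Suc j) (\<Sum>p<Suc N. scale ((-1) ^ p)
         (alternation scale N (\<lambda>ws. g (zs ! j # take p ws @ y # drop p ws)) (nths zs (- {j})))))"
    by (intro sum.cong refl arg_cong[where f = "scale _"] Suc.IH) (simp add: Suc.prems length_nths_omit_one)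
  also have "\<dots> = (\<Sum>p<Suc N. \<Sum>j<Suc N. scale ((-1) ^ Suc p) (scale ((-1) ^ j)
         (alternation scale N (\<lambda>ws. g (zs ! j # take p ws @ y # drop p ws)) (nths zs (- {j})))))"
    by (simp only: scale_sum_right scale_scale, subst sum.swap) (simp add: mult.commute)
  also have "\<dots> = (\<Sum>p<Suc N. scale ((-1) ^ Suc p)
       (alternation scale (Suc N) (\<lambda>ws. g (take (Suc p) ws @ y # drop (Suc p) ws)) zs))"
    by (simp only: alternation.simps(2) scale_sum_right take_Suc_Cons drop_Suc_Cons append_Cons)
  finally show ?case
    by (subst sum.lessThan_Suc_shift) (simp del: alternation.simps sum.lessThan_Suc)
qed

lemma alternation_linear:
  assumes "Vector_Spaces.linear scale scale F"
  shows "alternation scale N (\<lambda>ys. F (g ys)) xs = F (alternation scale N g xs)"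
proof -
  interpret F: Vector_Spaces.linear scale scale F by fact
  show ?thesis
    by (induction N arbitrary: g xs) (simp_all add: F.sum F.scale F.add)
qed

end

definition contract :: "('g \<Rightarrow> 'g \<Rightarrow> 'g) \<Rightarrow> nat \<Rightarrow> 'g list \<Rightarrow> 'g list"
  where "contract br j xs = take j xs @ br (xs ! j) (xs ! Suc j) # drop (Suc (Suc j)) xs"

text \<open>The bracketed pair moves from position \<open>p\<close> to the front with sign \<open>+1\<close>, as both of its members
  pass the same \<open>p\<close> entries. There, the two orders of each pair contribute equally because
  the bracket is antisymmetric, whence the factor \<open>-2\<close>.\<close>

lemma alternation_contract:
  fixes br :: "'g::ab_group_add \<Rightarrow> 'g \<Rightarrow> 'g"
  assumes "vector_space sv" and xs: "length xs = Suc (Suc M)" and p: "p < Suc M"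
    and br: "\<And>x y. br y x = - br x y"
    and odd: "\<And>us a vs. length us + length vs = M \<Longrightarrow> g (us @ (- a) # vs) = - g (us @ a # vs)"
  shows "alternation sv (Suc (Suc M)) (\<lambda>ys. g (contract br p ys)) xs =
    sv (- 2) (\<Sum>j<Suc (Suc M). \<Sum>i<j. sv ((-1) ^ (i + j))
      (alternation sv M (\<lambda>ys. g (take p ys @ br (xs ! i) (xs ! j) # drop p ys)) (nths xs (- {i, j}))))"
proof -
  interpret vector_space sv by fact
  define G where "G ys = g (take p (drop 2 ys) @ br (ys ! 0) (ys ! 1) # drop p (drop 2 ys))" for ys
  have G1: "G (a # b # ys) = - g (take p ys @ br b a # drop p ys)" if "length ys = M" for a b ys
    using that p by (simp add: G_def br[of b a] odd)
  have G2: "G (a # b # ys) = g (take p ys @ br a b # drop p ys)" for a b ys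
    by (simp add: G_def)
  \<comment> \<open>the right member of the pair is pulled first; the left one then stands at position \<open>Suc p\<close>\<close>
  have "g (contract br p ys) = G (pull_front (Suc p) (pull_front (Suc p) ys))"
    if "length ys = Suc (Suc M)" for ys
    using p that by (simp add: G_def contract_def pull_front_def min_def take_Suc_conv_app_nth nth_append)
  then have "alternation sv (Suc (Suc M)) (\<lambda>ys. g (contract br p ys)) xs
      = alternation sv (Suc (Suc M)) (\<lambda>ys. G (pull_front (Suc p) (pull_front (Suc p) ys))) xs"
    by (rule alternation_cong)
  also have "\<dots> = alternation sv (Suc (Suc M)) G xs"
    using p xs by (simp add: alternation_pull_front[where g = "\<lambda>ys. G (pull_front (Suc p) ys)"]
        alternation_pull_front power_add[symmetric] del: alternation.simps)
  also have "\<dots> = (\<Sum>j<Suc (Suc M). \<Sum>i<j. sv ((-1) ^ (i + j))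
      (alternation sv M (\<lambda>ys. - g (take p ys @ br (xs ! i) (xs ! j) # drop p ys)) (nths xs (- {i, j}))
      - alternation sv M (\<lambda>ys. g (take p ys @ br (xs ! i) (xs ! j) # drop p ys)) (nths xs (- {i, j}))))"
    unfolding alternation_Suc_Suc[OF xs]
    by (intro sum.cong refl arg_cong[where f = "sv _"] arg_cong2[where f = minus] alternation_cong)
      (rule G1 G2, assumption?)+
  also have "\<dots> = sv (- 2) (\<Sum>j<Suc (Suc M). \<Sum>i<j. sv ((-1) ^ (i + j))
      (alternation sv M (\<lambda>ys. g (take p ys @ br (xs ! i) (xs ! j) # drop p ys)) (nths xs (- {i, j}))))"
  proof -
    have "sv c (- u - u) = sv (- 2) (sv c u)" for c u
    proof -
      have "- u - u = sv (-2) u" using scale_left_distrib[of "-1" "-1" u] by simp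
      then show ?thesis by (simp add: mult.commute)
    qed
    then show ?thesis by (simp only: alternation_minus scale_sum_right)
  qed
  finally show ?thesis .
qed

lemma sum_rotate:
  "(\<Sum>p\<in>P. \<Sum>j<(n::nat). \<Sum>i<j. F p j i) = (\<Sum>j<n. \<Sum>i<j. \<Sum>p\<in>P. F p j i :: 'a::comm_monoid_add)"
  by (subst sum.swap) (intro sum.cong refl sum.swap)

text \<open>The differential can be computed before antisymmetrising. In the first sum of the differential,
  the choice of \<open>x\<^sub>j\<close> is the expansion of the alternating sum by its first argument.
  In the second sum, the bracket stands in front of the remaining arguments; \<open>alternation_insert\<close>
  distributes it over all places, and \<open>alternation_contract\<close> recognises each of them
  as the alternating sum of \<open>g\<close> with two neighbours bracketed, up to \<open>-2\<close>. The oddness of \<open>g\<close>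
  transfers the antisymmetry of the bracket to the values of \<open>g\<close>.\<close>

theorem ce_diff_alternation:
  fixes sv :: "'k::field_char_0 \<Rightarrow> 'v::ab_group_add \<Rightarrow> 'v" and brg :: "'g::ab_group_add \<Rightarrow> 'g \<Rightarrow> 'g"
  assumes "vector_space sv" and xs: "length xs = Suc N"
    and act: "\<And>x. Vector_Spaces.linear sv sv (act x)"
    and br: "\<And>x y. brg y x = - brg x y"
    and odd: "\<And>us a vs. length us + length vs + 1 = N \<Longrightarrow> g (us @ (- a) # vs) = - g (us @ a # vs)"
  shows "ce_diff brg sv act (alternation sv N g) xs =
    alternation sv (Suc N) (\<lambda>ys. act (ys ! 0) (g (tl ys))
      - sv (1 / 2) (\<Sum>j<N. sv ((-1) ^ j) (g (contract brg j ys)))) xs"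
proof -
  interpret vector_space sv by fact
  have first: "(\<Sum>j<length xs. sv ((-1) ^ j) (act (xs ! j) (alternation sv N g (nths xs (- {j})))))
      = alternation sv (Suc N) (\<lambda>ys. act (ys ! 0) (g (tl ys))) xs"
    by (simp add: xs alternation_linear[OF act] del: sum.lessThan_Suc)
  have second: "(\<Sum>j<length xs. \<Sum>i<j. sv ((-1) ^ (i + j))
        (alternation sv N g (brg (xs ! i) (xs ! j) # nths xs (- {i, j}))))
      = alternation sv (Suc N) (\<lambda>ys. sv (- 1 / 2) (\<Sum>j<N. sv ((-1) ^ j) (g (contract brg j ys)))) xs"
  proof (cases N)
    case 0
    then show ?thesis using xs by simp
  next
    case (Suc M)
    have len: "length (nths xs (- {i, j})) = M" if "i < j" "j < Suc (Suc M)" for i j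
      using that xs Suc by (simp add: nths_omit_two)
    have "(\<Sum>j<length xs. \<Sum>i<j. sv ((-1) ^ (i + j))
        (alternation sv N g (brg (xs ! i) (xs ! j) # nths xs (- {i, j}))))
      = (\<Sum>j<Suc (Suc M). \<Sum>i<j. sv ((-1) ^ (i + j)) (\<Sum>p<Suc M. sv ((-1) ^ p)
          (alternation sv M (\<lambda>ys. g (take p ys @ brg (xs ! i) (xs ! j) # drop p ys)) (nths xs (- {i, j})))))"
      unfolding xs Suc
      by (intro sum.cong refl arg_cong[where f = "sv _"] alternation_insert len) auto
    also have "\<dots> = (\<Sum>p<Suc M. sv ((-1) ^ p) (\<Sum>j<Suc (Suc M). \<Sum>i<j. sv ((-1) ^ (i + j))
          (alternation sv M (\<lambda>ys. g (take p ys @ brg (xs ! i) (xs ! j) # drop p ys)) (nths xs (- {i, j})))))"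
      by (simp only: scale_sum_right scale_scale sum_rotate mult.commute)
    also have "\<dots> = (\<Sum>p<Suc M. sv ((-1) ^ p) (sv (- 1 / 2)
          (alternation sv (Suc (Suc M)) (\<lambda>ys. g (contract brg p ys)) xs)))"
    proof (intro sum.cong refl arg_cong[where f = "sv _"])
      fix p assume "p \<in> {..<Suc M}"
      then have "alternation sv (Suc (Suc M)) (\<lambda>ys. g (contract brg p ys)) xs =
        sv (- 2) (\<Sum>j<Suc (Suc M). \<Sum>i<j. sv ((-1) ^ (i + j))
          (alternation sv M (\<lambda>ys. g (take p ys @ brg (xs ! i) (xs ! j) # drop p ys)) (nths xs (- {i, j}))))"
        using xs Suc by (intro alternation_contract[OF assms(1) _ _ br odd]) auto
      then show "(\<Sum>j<Suc (Suc M). \<Sum>i<j. sv ((-1) ^ (i + j))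
          (alternation sv M (\<lambda>ys. g (take p ys @ brg (xs ! i) (xs ! j) # drop p ys)) (nths xs (- {i, j}))))
        = sv (- 1 / 2) (alternation sv (Suc (Suc M)) (\<lambda>ys. g (contract brg p ys)) xs)"
        by (simp only: scale_scale) simp
    qed
    also have "\<dots> = alternation sv (Suc N) (\<lambda>ys. sv (- 1 / 2) (\<Sum>j<N. sv ((-1) ^ j) (g (contract brg j ys)))) xs"
      unfolding Suc alternation_scale alternation_sum
      by (simp only: scale_sum_right scale_scale mult.commute[of "-1 / 2"])
    finally show ?thesis .
  qed
  show ?thesis
    unfolding ce_diff_def first second alternation_add[symmetric]
    by (simp add: del: alternation.simps)
qed

section \<open>Wedge products of cochains under an invariant symmetric map\<close>

abbreviation total_degree :: "(nat \<times> 'c) list \<Rightarrow> nat"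
  where "total_degree \<phi>s \<equiv> sum_list (map fst \<phi>s)"

lemma apply_blocks_append:
  "apply_blocks (\<phi>s @ \<psi>s) xs = apply_blocks \<phi>s xs @ apply_blocks \<psi>s (drop (total_degree \<phi>s) xs)"
  by (induction \<phi>s xs rule: apply_blocks.induct) (auto simp: add.commute)

lemma length_apply_blocks [simp]: "length (apply_blocks \<phi>s xs) = length \<phi>s"
  by (induction \<phi>s xs rule: apply_blocks.induct) auto

lemma apply_blocks_prefix:
  "length us = total_degree \<phi>s \<Longrightarrow> apply_blocks \<phi>s (us @ vs) = apply_blocks \<phi>s us"
  by (induction \<phi>s us rule: apply_blocks.induct) auto

lemma apply_blocks_slot:
  assumes "length us = total_degree \<phi>s" "length ws = p"
  shows "apply_blocks (\<phi>s @ (p, \<phi>) # \<psi>s) (us @ ws @ vs)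
    = apply_blocks \<phi>s us @ \<phi> ws # apply_blocks \<psi>s vs"
  using assms by (simp add: apply_blocks_append apply_blocks_prefix)

lemma sum_over_blocks:
  fixes F :: "nat \<Rightarrow> 'a::comm_monoid_add"
  shows "(\<Sum>j<total_degree \<phi>s. F j)
    = (\<Sum>i<length \<phi>s. \<Sum>j<fst (\<phi>s ! i). F (total_degree (take i \<phi>s) + j))"
proof (induction \<phi>s arbitrary: F)
  case (Cons a \<phi>s)
  have split: "(\<Sum>j<p + m. F j) = sum F {..<p} + (\<Sum>j<m. F (p + j))" for F :: "nat \<Rightarrow> 'a" and p m
    by (induction m) (simp_all add: add.assoc)
  have "(\<Sum>j<total_degree (a # \<phi>s). F j) = (\<Sum>j<fst a. F j) + (\<Sum>j<total_degree \<phi>s. F (fst a + j))"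
    using split[of F "fst a" "total_degree \<phi>s"] by simp
  then show ?case
    by (simp add: Cons.IH sum.lessThan_Suc_shift add.assoc del: sum.lessThan_Suc)
qed simp

text \<open>The block of length \<open>q\<close> at position \<open>a\<close> changes places with the block of length \<open>p\<close> after it.\<close>

definition swap_blocks :: "nat \<Rightarrow> nat \<Rightarrow> nat \<Rightarrow> 'x list \<Rightarrow> 'x list"
  where "swap_blocks a q p ys =
    take a ys @ take p (drop (a + q) ys) @ take q (drop a ys) @ drop (a + q + p) ys"

lemma split_list_lengths:
  assumes "length ys = a + b"
  obtains us vs where "ys = us @ vs" "length us = a" "length vs = b"
  by (rule that[of "take a ys" "drop a ys"]) (use assms in auto)

context vector_space
begin

lemma alternation_swap_blocks_one:
  fixes g :: "'x list \<Rightarrow> 'b"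
  assumes "a + 1 + p \<le> N" "length xs = N"
  shows "alternation scale N (\<lambda>ys. g (swap_blocks a 1 p ys)) xs = scale ((-1) ^ p) (alternation scale N g xs)"
  using assms
proof (induction p arbitrary: g)
  case 0
  have "swap_blocks a 1 0 ys = ys" if "length ys = N" for ys :: "'x list"
  proof -
    have "take a ys @ take 1 (drop a ys) @ drop 1 (drop a ys) = ys" by (simp only: append_take_drop_id)
    then show ?thesis by (simp add: swap_blocks_def)
  qed
  then show ?case by (simp cong: alternation_cong)
next
  case (Suc p)
  have "swap_blocks a 1 (Suc p) ys = swap_adjacent (a + p) (swap_blocks a 1 p ys)"
    if len: "length ys = N" for ys :: "'x list"
  proof -
    obtain us ws where ys: "ys = us @ ws" "length us = a" "length ws = N - a"
      by (rule split_list_lengths[of ys a "N - a"]) (use len Suc.prems in auto)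
    then obtain x zs where "ws = x # zs" using Suc.prems by (cases ws) auto
    moreover obtain w zs' where "zs = w @ zs'" "length w = p" "length zs' = N - a - 1 - p"
      by (rule split_list_lengths[of zs p "N - a - 1 - p"]) (use ys calculation Suc.prems in auto)
    moreover obtain y vs where "zs' = y # vs" using calculation Suc.prems by (cases zs') auto
    ultimately show ?thesis using ys by (simp add: swap_blocks_def swap_adjacent_def nth_append)
  qed
  then have "alternation scale N (\<lambda>ys. g (swap_blocks a 1 (Suc p) ys)) xs
      = alternation scale N (\<lambda>ys. g (swap_adjacent (a + p) (swap_blocks a 1 p ys))) xs"
    by (intro alternation_cong) simp
  also have "\<dots> = scale ((-1) ^ p) (alternation scale N (\<lambda>ys. g (swap_adjacent (a + p) ys)) xs)"
    using Suc.prems by (intro Suc.IH) auto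
  also have "alternation scale N (\<lambda>ys. g (swap_adjacent (a + p) ys)) xs = - alternation scale N g xs"
    using Suc.prems by (intro alternation_swap_adjacent) auto
  finally show ?case by simp
qed

lemma alternation_swap_blocks:
  fixes g :: "'x list \<Rightarrow> 'b"
  assumes "a + q + p \<le> N" "length xs = N"
  shows "alternation scale N (\<lambda>ys. g (swap_blocks a q p ys)) xs
    = scale ((-1) ^ (q * p)) (alternation scale N g xs)"
  using assms
proof (induction q arbitrary: a g)
  case 0
  have "swap_blocks a 0 p ys = ys" if "length ys = N" for ys :: "'x list"
  proof -
    have "take a ys @ take p (drop a ys) @ drop p (drop a ys) = ys" by (simp only: append_take_drop_id)
    then show ?thesis by (simp add: swap_blocks_def add.commute)
  qed
  then show ?case by (simp cong: alternation_cong)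
next
  case (Suc q)
  have "swap_blocks a (Suc q) p ys = swap_blocks a 1 p (swap_blocks (Suc a) q p ys)"
    if len: "length ys = N" for ys :: "'x list"
  proof -
    obtain us ws where ys: "ys = us @ ws" "length us = a" "length ws = N - a"
      by (rule split_list_lengths[of ys a "N - a"]) (use len Suc.prems in auto)
    then obtain x zs where "ws = x # zs" using Suc.prems by (cases ws) auto
    moreover obtain w zs' where "zs = w @ zs'" "length w = q" "length zs' = N - a - 1 - q"
      by (rule split_list_lengths[of zs q "N - a - 1 - q"]) (use ys calculation Suc.prems in auto)
    moreover obtain w' vs where "zs' = w' @ vs" "length w' = p"
      by (rule split_list_lengths[of zs' p "N - a - 1 - q - p"]) (use calculation Suc.prems in auto)
    ultimately show ?thesis using ys by (simp add: swap_blocks_def)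
  qed
  then have "alternation scale N (\<lambda>ys. g (swap_blocks a (Suc q) p ys)) xs
      = alternation scale N (\<lambda>ys. g (swap_blocks a 1 p (swap_blocks (Suc a) q p ys))) xs"
    by (intro alternation_cong) simp
  also have "\<dots> = scale ((-1) ^ (q * p)) (alternation scale N (\<lambda>ys. g (swap_blocks a 1 p ys)) xs)"
    using Suc.prems by (intro Suc.IH) auto
  also have "alternation scale N (\<lambda>ys. g (swap_blocks a 1 p ys)) xs = scale ((-1) ^ p) (alternation scale N g xs)"
    using Suc.prems by (intro alternation_swap_blocks_one) auto
  finally show ?case by (simp add: power_add)
qed

end

text \<open>The extension, the module and the invariant symmetric map, over any field of characteristic
  zero: all statements at a fixed section are algebraic.\<close>

locale invariant_form =
  E: lie_extension sh brh sg brg q + M: lie_module sg brg sv act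
  for sh :: "'k::field_char_0 \<Rightarrow> 'h::ab_group_add \<Rightarrow> 'h"
    and brh :: "'h \<Rightarrow> 'h \<Rightarrow> 'h"
    and sg :: "'k \<Rightarrow> 'g::ab_group_add \<Rightarrow> 'g"
    and brg :: "'g \<Rightarrow> 'g \<Rightarrow> 'g"
    and q :: "'h \<Rightarrow> 'g"
    and sv :: "'k \<Rightarrow> 'v::ab_group_add \<Rightarrow> 'v"
    and act :: "'g \<Rightarrow> 'v \<Rightarrow> 'v" +
  fixes k :: nat and f :: "'h list \<Rightarrow> 'v"
  assumes f_sym_multilinear: "sym_multilinear_on sh sv (ext_kernel q) k f"
    and f_equivariant: "equivariant_on brh act q (ext_kernel q) k f"
begin

sublocale Q: Vector_Spaces.linear sh sg q by (rule E.q_linear)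

lemma kernel_0: "0 \<in> ext_kernel q" by (simp add: ext_kernel_def Q.zero)
lemma kernel_add: "a \<in> ext_kernel q \<Longrightarrow> b \<in> ext_kernel q \<Longrightarrow> a + b \<in> ext_kernel q"
  by (simp add: ext_kernel_def Q.add)
lemma kernel_diff: "a \<in> ext_kernel q \<Longrightarrow> b \<in> ext_kernel q \<Longrightarrow> a - b \<in> ext_kernel q"
  by (simp add: ext_kernel_def Q.diff)
lemma kernel_scale: "a \<in> ext_kernel q \<Longrightarrow> sh c a \<in> ext_kernel q"
  by (simp add: ext_kernel_def Q.scale)
lemma kernel_sum: "(\<And>i. i \<in> I \<Longrightarrow> a i \<in> ext_kernel q) \<Longrightarrow> (\<Sum>i\<in>I. a i) \<in> ext_kernel q"
  by (simp add: ext_kernel_def Q.sum)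
lemma kernel_minus: "a \<in> ext_kernel q \<Longrightarrow> - a \<in> ext_kernel q"
  by (simp add: ext_kernel_def Q.neg)
lemma kernel_br: "a \<in> ext_kernel q \<Longrightarrow> brh x a \<in> ext_kernel q"
proof -
  have "brg y 0 = 0" for y
  proof -
    interpret Vector_Spaces.linear sg sg "brg y" by (rule E.G.br_linear_right)
    show ?thesis by (rule zero)
  qed
  then show "a \<in> ext_kernel q \<Longrightarrow> brh x a \<in> ext_kernel q" by (simp add: ext_kernel_def E.q_br)
qed
lemmas kernel_intros = kernel_0 kernel_add kernel_diff kernel_scale kernel_sum kernel_minus kernel_br

lemma
  assumes "length us + length vs + 1 = k" "set us \<subseteq> ext_kernel q" "set vs \<subseteq> ext_kernel q"
    and "a \<in> ext_kernel q"
  shows f_add: "b \<in> ext_kernel q \<Longrightarrow> f (us @ (a + b) # vs) = f (us @ a # vs) + f (us @ b # vs)"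
    and f_scale: "f (us @ sh c a # vs) = sv c (f (us @ a # vs))"
proof -
  have *: "length (us @ a # vs) = k \<and> set (us @ a # vs) \<subseteq> ext_kernel q" "length us < k"
    using assms by auto
  note f = f_sym_multilinear[unfolded sym_multilinear_on_def, rule_format, OF *(1)]
  show "f (us @ (a + b) # vs) = f (us @ a # vs) + f (us @ b # vs)" if "b \<in> ext_kernel q"
    using conjunct1[OF f, rule_format, OF *(2) assms(4) that] by simp
  show "f (us @ sh c a # vs) = sv c (f (us @ a # vs))"
    using conjunct1[OF conjunct2[OF f], rule_format, OF *(2) assms(4)] by simp
qed

lemma f_swap:
  assumes "length us + length vs + 2 = k" "set us \<subseteq> ext_kernel q" "set vs \<subseteq> ext_kernel q"
    and "a \<in> ext_kernel q" "b \<in> ext_kernel q"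
  shows "f (us @ b # a # vs) = f (us @ a # b # vs)"
proof -
  let ?\<tau> = "Transposition.transpose (length us) (Suc (length us))"
  have \<tau>: "?\<tau> permutes {..<k}" using assms(1) by (intro permutes_swap_id) auto
  have "length (us @ a # b # vs) = k \<and> set (us @ a # b # vs) \<subseteq> ext_kernel q" using assms by auto
  note f = f_sym_multilinear[unfolded sym_multilinear_on_def, rule_format, OF this]
  have "permute_list ?\<tau> (us @ a # b # vs) = us @ b # a # vs"
    using assms(1) \<tau>
    by (intro nth_equalityI)
      (auto simp: permute_list_nth nth_append nth_Cons' Transposition.transpose_def)
  with conjunct2[OF conjunct2[OF f], rule_format, OF \<tau>] show ?thesis by simp
qed

lemma f_zero:
  assumes "length us + length vs + 1 = k" "set us \<subseteq> ext_kernel q" "set vs \<subseteq> ext_kernel q"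
  shows "f (us @ 0 # vs) = 0"
  using f_scale[OF assms kernel_0, of 0] by simp

lemma f_minus:
  assumes "length us + length vs + 1 = k" "set us \<subseteq> ext_kernel q" "set vs \<subseteq> ext_kernel q"
    and "a \<in> ext_kernel q"
  shows "f (us @ - a # vs) = - f (us @ a # vs)"
  using f_scale[OF assms, of "-1"] by simp

lemma f_diff:
  assumes "length us + length vs + 1 = k" "set us \<subseteq> ext_kernel q" "set vs \<subseteq> ext_kernel q"
    and "a \<in> ext_kernel q" "b \<in> ext_kernel q"
  shows "f (us @ (a - b) # vs) = f (us @ a # vs) - f (us @ b # vs)"
  using f_add[OF assms(1-4) kernel_minus[OF assms(5)]] f_minus[OF assms(1-3,5)] by simp

lemma f_sum:
  assumes "length us + length vs + 1 = k" "set us \<subseteq> ext_kernel q" "set vs \<subseteq> ext_kernel q"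
    and "\<And>i. i \<in> I \<Longrightarrow> a i \<in> ext_kernel q"
  shows "f (us @ (\<Sum>i\<in>I. a i) # vs) = (\<Sum>i\<in>I. f (us @ a i # vs))"
  using assms(4)
  by (induction I rule: infinite_finite_induct)
    (simp_all add: f_zero[OF assms(1-3)] f_add[OF assms(1-3)] kernel_sum)

text \<open>Compatibility with the sign in each argument carries the antisymmetry of the bracket over to the
  values of a cochain, as \<open>ce_diff_alternation\<close> requires.\<close>

definition odd_cochains :: "(nat \<times> ('g list \<Rightarrow> 'h)) list \<Rightarrow> bool"
  where "odd_cochains \<phi>s \<longleftrightarrow> (\<forall>(p, \<phi>)\<in>set \<phi>s. \<forall>us a vs.
    length us + length vs + 1 = p \<longrightarrow> \<phi> (us @ - a # vs) = - \<phi> (us @ a # vs))"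

definition kernel_valued :: "(nat \<times> ('g list \<Rightarrow> 'h)) list \<Rightarrow> bool"
  where "kernel_valued \<phi>s \<longleftrightarrow> (\<forall>(p, \<phi>)\<in>set \<phi>s. \<forall>ys. \<phi> ys \<in> ext_kernel q)"

lemma kernel_valued_simps [simp]:
  "kernel_valued []"
  "kernel_valued ((p, \<phi>) # \<phi>s) \<longleftrightarrow> (\<forall>ys. \<phi> ys \<in> ext_kernel q) \<and> kernel_valued \<phi>s"
  "kernel_valued (\<phi>s @ \<psi>s) \<longleftrightarrow> kernel_valued \<phi>s \<and> kernel_valued \<psi>s"
  by (auto simp: kernel_valued_def)

lemma set_apply_blocks: "kernel_valued \<phi>s \<Longrightarrow> set (apply_blocks \<phi>s xs) \<subseteq> ext_kernel q"
  by (induction \<phi>s xs rule: apply_blocks.induct) auto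

text \<open>This is \<open>p\<^sub>1! \<cdots> p\<^sub>k!\<close> times \<open>f\<close> of the wedge product. The entries
  need not be alternating; only their antisymmetrisations have an effect.\<close>

definition wedge :: "(nat \<times> ('g list \<Rightarrow> 'h)) list \<Rightarrow> 'g list \<Rightarrow> 'v"
  where "wedge \<phi>s = alternation sv (total_degree \<phi>s) (\<lambda>ys. f (apply_blocks \<phi>s ys))"

end

context vector_space
begin

lemma alternation_blocks_cong:
  assumes "\<And>us ws vs. length us = a \<Longrightarrow> length ws = p \<Longrightarrow> length vs = b \<Longrightarrow> g (us @ ws @ vs) = h (us @ ws @ vs)"
  shows "alternation scale (a + (p + b)) g xs = alternation scale (a + (p + b)) h xs"
proof (rule alternation_cong)
  fix ys :: "'c list" assume "length ys = a + (p + b)"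
  then obtain us zs where "ys = us @ zs" "length us = a" "length zs = p + b"
    by (rule split_list_lengths)
  moreover obtain ws vs where "zs = ws @ vs" "length ws = p" "length vs = b"
    using calculation(3) by (rule split_list_lengths)
  ultimately show "g ys = h ys" using assms by simp
qed

end

context invariant_form
begin

lemma wedge_slot_cong:
  assumes "\<And>ws. length ws = p \<Longrightarrow> \<phi> ws = \<phi>' ws"
  shows "wedge (\<phi>s @ (p, \<phi>) # \<psi>s) xs = wedge (\<phi>s @ (p, \<phi>') # \<psi>s) xs"
  unfolding wedge_def
  by simp (rule M.V.alternation_blocks_cong, simp add: apply_blocks_slot assms)

lemma wedge_slot_add:
  assumes "length \<phi>s + length \<psi>s + 1 = k" "kernel_valued \<phi>s" "kernel_valued \<psi>s"
    and "\<And>ws. \<phi> ws \<in> ext_kernel q" "\<And>ws. \<phi>' ws \<in> ext_kernel q"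
  shows "wedge (\<phi>s @ (p, \<lambda>ws. \<phi> ws + \<phi>' ws) # \<psi>s) xs
    = wedge (\<phi>s @ (p, \<phi>) # \<psi>s) xs + wedge (\<phi>s @ (p, \<phi>') # \<psi>s) xs"
  unfolding wedge_def
  by (simp add: M.V.alternation_add[symmetric], rule M.V.alternation_blocks_cong)
    (use assms in \<open>simp add: apply_blocks_slot f_add set_apply_blocks\<close>)

lemma wedge_slot_scale:
  assumes "length \<phi>s + length \<psi>s + 1 = k" "kernel_valued \<phi>s" "kernel_valued \<psi>s"
    and "\<And>ws. \<phi> ws \<in> ext_kernel q"
  shows "wedge (\<phi>s @ (p, \<lambda>ws. sh c (\<phi> ws)) # \<psi>s) xs = sv c (wedge (\<phi>s @ (p, \<phi>) # \<psi>s) xs)"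
  unfolding wedge_def
  by (simp add: M.V.alternation_scale[symmetric], rule M.V.alternation_blocks_cong)
    (use assms in \<open>simp add: apply_blocks_slot f_scale set_apply_blocks\<close>)

text \<open>Antisymmetry of the whole wedge product holds within each block, so an entry matters only up to
  antisymmetrisation. In the sequel this replaces \<open>raw_covariant_diff\<close> by \<open>covariant_diff\<close>, and it
  reduces the vanishing for the curvature to a cyclic sum.\<close>

lemma wedge_slot_swap_adjacent:
  assumes "Suc j < p" "length xs = total_degree (\<phi>s @ (p, \<phi>) # \<psi>s)"
  shows "wedge (\<phi>s @ (p, \<lambda>ws. \<phi> (swap_adjacent j ws)) # \<psi>s) xs = - wedge (\<phi>s @ (p, \<phi>) # \<psi>s) xs"
proof -
  let ?a = "total_degree \<phi>s" and ?b = "total_degree \<psi>s"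
  let ?g = "\<lambda>ys. f (apply_blocks (\<phi>s @ (p, \<phi>) # \<psi>s) ys)"
  have "wedge (\<phi>s @ (p, \<lambda>ws. \<phi> (swap_adjacent j ws)) # \<psi>s) xs
      = alternation sv (?a + (p + ?b)) (\<lambda>ys. ?g (swap_adjacent (?a + j) ys)) xs"
    unfolding wedge_def
  proof (simp, rule M.V.alternation_blocks_cong)
    fix us ws vs :: "'g list"
    assume len: "length us = ?a" "length ws = p" "length vs = ?b"
    have "swap_adjacent (?a + j) (us @ ws @ vs) = us @ swap_adjacent j ws @ vs"
      using len assms(1) by (simp add: swap_adjacent_def nth_append)
    moreover have "length (swap_adjacent j ws) = p"
      using len assms(1) by (simp add: swap_adjacent_def)
    ultimately show "f (apply_blocks (\<phi>s @ (p, \<lambda>ws. \<phi> (swap_adjacent j ws)) # \<psi>s) (us @ ws @ vs))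
        = ?g (swap_adjacent (?a + j) (us @ ws @ vs))"
      using len by (simp add: apply_blocks_slot)
  qed
  also have "\<dots> = - alternation sv (?a + (p + ?b)) ?g xs"
    using assms by (intro M.V.alternation_swap_adjacent) auto
  finally show ?thesis by (simp add: wedge_def)
qed

text \<open>Graded commutativity: \<open>f\<close> is symmetric, so only the exchange of the two blocks of arguments
  contributes a sign.\<close>

lemma wedge_exchange:
  assumes "length \<phi>s + length \<psi>s + 2 = k" "kernel_valued \<phi>s" "kernel_valued \<psi>s"
    and "\<And>ws. \<phi> ws \<in> ext_kernel q" "\<And>ws. \<psi> ws \<in> ext_kernel q"
    and xs: "length xs = total_degree (\<phi>s @ (r, \<psi>) # (p, \<phi>) # \<psi>s)"
  shows "wedge (\<phi>s @ (r, \<psi>) # (p, \<phi>) # \<psi>s) xs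
    = sv ((-1) ^ (r * p)) (wedge (\<phi>s @ (p, \<phi>) # (r, \<psi>) # \<psi>s) xs)"
proof -
  let ?a = "total_degree \<phi>s" and ?b = "total_degree \<psi>s"
  let ?g = "\<lambda>ys. f (apply_blocks (\<phi>s @ (p, \<phi>) # (r, \<psi>) # \<psi>s) ys)"
  have "wedge (\<phi>s @ (r, \<psi>) # (p, \<phi>) # \<psi>s) xs
      = alternation sv (?a + (r + (p + ?b))) (\<lambda>ys. ?g (swap_blocks ?a r p ys)) xs"
    unfolding wedge_def
  proof (simp, rule M.V.alternation_blocks_cong)
    fix us ws zs :: "'g list"
    assume len: "length us = ?a" "length ws = r" "length zs = p + ?b"
    obtain ws' vs where zs: "zs = ws' @ vs" "length ws' = p" "length vs = ?b"
      using len(3) by (rule split_list_lengths)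
    have "swap_blocks ?a r p (us @ ws @ zs) = us @ ws' @ ws @ vs"
      using len zs by (simp add: swap_blocks_def)
    then show "f (apply_blocks (\<phi>s @ (r, \<psi>) # (p, \<phi>) # \<psi>s) (us @ ws @ zs))
        = ?g (swap_blocks ?a r p (us @ ws @ zs))"
      using len zs assms
      by (simp add: apply_blocks_append apply_blocks_prefix f_swap set_apply_blocks)
  qed
  also have "\<dots> = sv ((-1) ^ (r * p)) (alternation sv (?a + (r + (p + ?b))) ?g xs)"
    using xs by (intro M.V.alternation_swap_blocks) auto
  finally show ?thesis by (simp add: wedge_def add.left_commute)
qed

lemma f_apply_blocks_odd:
  assumes "length zs + length \<phi>s = k" "set zs \<subseteq> ext_kernel q" "kernel_valued \<phi>s" "odd_cochains \<phi>s"
    and "length us + length vs + 1 = total_degree \<phi>s"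
  shows "f (zs @ apply_blocks \<phi>s (us @ - a # vs)) = - f (zs @ apply_blocks \<phi>s (us @ a # vs))"
  using assms
proof (induction \<phi>s arbitrary: zs us)
  case Nil
  then show ?case by simp
next
  case (Cons p\<phi> \<phi>s)
  obtain p \<phi> where p\<phi>: "p\<phi> = (p, \<phi>)" by force
  show ?case
  proof (cases "length us < p")
    case True
    define m where "m = p - length us - 1"
    have *: "p - length us = Suc m" using True by (simp add: m_def)
    have "\<phi> (us @ - a # take m vs) = - \<phi> (us @ a # take m vs)"
      using Cons.prems True by (simp add: p\<phi> odd_cochains_def m_def)
    then show ?thesis
      using Cons.prems True by (simp add: p\<phi> * f_minus set_apply_blocks)
  next
    case False
    then show ?thesis
      using Cons.IH[of "zs @ [\<phi> (take p us)]" "drop p us"] Cons.prems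
      by (simp add: p\<phi> odd_cochains_def)
  qed
qed

text \<open>For alternating \<open>\<phi>\<close> of degree \<open>p\<close>, the alternating sum of this expression is \<open>p!\<close> times the
  covariant differential of \<open>\<phi>\<close>. It arises from \<open>ce_diff_alternation\<close> when
  the action is replaced by \<open>x \<mapsto> [s x, _]\<close>.\<close>

definition raw_covariant_diff :: "('g \<Rightarrow> 'h) \<Rightarrow> nat \<Rightarrow> ('g list \<Rightarrow> 'h) \<Rightarrow> 'g list \<Rightarrow> 'h"
  where "raw_covariant_diff s p \<phi> ys =
    brh (s (ys ! 0)) (\<phi> (tl ys)) - sh (1 / 2) (\<Sum>j<p. sh ((-1) ^ j) (\<phi> (contract brg j ys)))"

lemma brg_anti: "brg y x = - brg x y"
proof -
  interpret L: Vector_Spaces.linear sg sg "\<lambda>a. brg a b" for b by (rule E.G.br_linear_left)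
  interpret R: Vector_Spaces.linear sg sg "brg a" for a by (rule E.G.br_linear_right)
  have "brg y x + brg x y = brg (x + y) (x + y)"
    by (simp only: L.add R.add E.G.br_self[of x] E.G.br_self[of y] add_0_left add_0_right add.commute)
  also have "\<dots> = 0" by (rule E.G.br_self)
  finally show ?thesis by (simp only: eq_neg_iff_add_eq_0)
qed

text \<open>The product rule. Equivariance turns the action of \<open>x\<^sub>0 = q (s x\<^sub>0)\<close> on the value of \<open>f\<close> into a sum
  over the entries of \<open>f\<close>, and moving \<open>x\<^sub>0\<close> to the front of the \<open>i\<close>-th block costs \<open>(-1)\<close> to the
  total degree of the earlier blocks. The terms that bracket two neighbours in that block have
  the same sign as a factor once positions are counted from the beginning of the block, and the
  two contributions add up to \<open>raw_covariant_diff\<close>.\<close>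

theorem ce_diff_wedge:
  assumes s: "\<And>x. q (s x) = x" and len: "length \<phi>s = k"
    and ker: "kernel_valued \<phi>s" and odd: "odd_cochains \<phi>s"
    and xs: "length xs = Suc (total_degree \<phi>s)"
  shows "ce_diff brg sv act (wedge \<phi>s) xs =
    (\<Sum>i<k. sv ((-1) ^ total_degree (take i \<phi>s))
      (wedge (\<phi>s[i := (Suc (fst (\<phi>s ! i)), raw_covariant_diff s (fst (\<phi>s ! i)) (snd (\<phi>s ! i)))]) xs))"
proof -
  define N where "N = total_degree \<phi>s"
  define g where "g ys = f (apply_blocks \<phi>s ys)" for ys
  define P where "P i = total_degree (take i \<phi>s)" for i
  define A where "A i ys = f ((apply_blocks \<phi>s (tl ys))[i := brh (s (ys ! 0)) (apply_blocks \<phi>s (tl ys) ! i)])"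
    for i ys
  define B where "B i ys = (\<Sum>j<fst (\<phi>s ! i). sv ((-1) ^ j) (g (contract brg (P i + j) ys)))" for i ys
  have P_less: "P i < Suc N" if "i < k" for i
  proof -
    have "total_degree \<phi>s = total_degree (take i \<phi>s @ drop i \<phi>s)" by simp
    then show ?thesis unfolding P_def N_def
      by (metis le_add1 less_Suc_eq_le map_append sum_list_append)
  qed
  have "ce_diff brg sv act (wedge \<phi>s) xs
      = alternation sv (Suc N) (\<lambda>ys. act (ys ! 0) (g (tl ys))
        - sv (1 / 2) (\<Sum>j<N. sv ((-1) ^ j) (g (contract brg j ys)))) xs"
    unfolding wedge_def g_def[abs_def, symmetric] N_def[symmetric]
    using xs f_apply_blocks_odd[of "[]" \<phi>s] len ker odd
    by (intro ce_diff_alternation M.V.vector_space_axioms M.act_linear_right brg_anti)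
      (auto simp: N_def g_def)
  also have "\<dots> = alternation sv (Suc N) (\<lambda>ys. \<Sum>i<k. A i ys - sv (1 / 2 * (-1) ^ P i) (B i ys)) xs"
  proof (rule M.V.alternation_cong)
    fix ys :: "'g list" assume "length ys = Suc N"
    have "act (q (s (ys ! 0))) (g (tl ys)) = (\<Sum>i<k. A i ys)"
      unfolding g_def A_def using f_equivariant ker len
      by (simp add: equivariant_on_def set_apply_blocks)
    moreover have "(\<Sum>j<N. sv ((-1) ^ j) (g (contract brg j ys))) = (\<Sum>i<k. sv ((-1) ^ P i) (B i ys))"
      unfolding N_def sum_over_blocks len B_def P_def
      by (simp add: M.V.scale_sum_right power_add)
    ultimately show "act (ys ! 0) (g (tl ys)) - sv (1 / 2) (\<Sum>j<N. sv ((-1) ^ j) (g (contract brg j ys)))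
        = (\<Sum>i<k. A i ys - sv (1 / 2 * (-1) ^ P i) (B i ys))"
      by (simp add: s sum_subtractf M.V.scale_sum_right)
  qed
  also have "\<dots> = (\<Sum>i<k. alternation sv (Suc N) (\<lambda>ys. A i ys - sv (1 / 2 * (-1) ^ P i) (B i ys)) xs)"
    by (rule M.V.alternation_sum)
  also have "\<dots> = (\<Sum>i<k. sv ((-1) ^ P i)
      (wedge (\<phi>s[i := (Suc (fst (\<phi>s ! i)), raw_covariant_diff s (fst (\<phi>s ! i)) (snd (\<phi>s ! i)))]) xs))"
  proof (rule sum.cong[OF refl])
    fix i assume "i \<in> {..<k}"
    then have i: "i < k" by simp
    obtain p \<phi> where p\<phi>: "\<phi>s ! i = (p, \<phi>)" by force
    define as bs where "as = take i \<phi>s" and "bs = drop (Suc i) \<phi>s"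
    have split: "\<phi>s = as @ (p, \<phi>) # bs"
      unfolding as_def bs_def using i len p\<phi> by (simp add: id_take_nth_drop[symmetric] flip: p\<phi>)
    have len_as: "length as = i" using i len by (simp add: as_def)
    have kas: "kernel_valued as" "kernel_valued bs" "\<And>ys. \<phi> ys \<in> ext_kernel q"
      using ker by (auto simp: split)
    have N: "Suc N = P i + (Suc p + total_degree bs)"
      unfolding N_def P_def as_def[symmetric] by (simp add: split)
    \<comment> \<open>\<open>pull_front (P i)\<close> takes the acting argument from the beginning of block \<open>i\<close> to the front of the list\<close>
    have "alternation sv (Suc N) (\<lambda>ys. A i ys - sv (1 / 2 * (-1) ^ P i) (B i ys)) xs
        = sv ((-1) ^ P i) (alternation sv (Suc N) (\<lambda>ys. A i (pull_front (P i) ys) - sv (1 / 2) (B i ys)) xs)"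
    proof -
      have "sv ((-1) ^ P i) (alternation sv (Suc N) (\<lambda>ys. A i (pull_front (P i) ys)) xs)
          = alternation sv (Suc N) (A i) xs"
        using P_less[OF i] xs
        by (subst M.V.alternation_pull_front) (simp_all add: N_def power_add[symmetric])
      then show ?thesis
        by (simp add: M.V.alternation_diff M.V.alternation_scale M.V.scale_right_diff_distrib mult.commute
            del: alternation.simps)
    qed
    also have "alternation sv (Suc N) (\<lambda>ys. A i (pull_front (P i) ys) - sv (1 / 2) (B i ys)) xs
        = alternation sv (Suc N)
            (\<lambda>ys. f (apply_blocks (as @ (Suc p, raw_covariant_diff s p \<phi>) # bs) ys)) xs"
      unfolding N
    proof (rule M.V.alternation_blocks_cong)
      fix us ws vs :: "'g list"
      assume lens: "length us = P i" "length ws = Suc p" "length vs = total_degree bs"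
      have us: "length us = total_degree as" using lens(1) by (simp add: P_def as_def)
      let ?U = "apply_blocks as us" and ?V = "apply_blocks bs vs"
      have slot: "length ?U + length ?V + 1 = k" "set ?U \<subseteq> ext_kernel q" "set ?V \<subseteq> ext_kernel q"
        using kas len by (simp_all add: split set_apply_blocks)
      have upd: "(?U @ a # ?V)[i := b] = ?U @ b # ?V" for a b
        using list_update_length[of ?U a ?V b] len_as by simp
      have "pull_front (P i) (us @ ws @ vs) = ws ! 0 # us @ tl ws @ vs"
        using lens by (cases ws) (auto simp: pull_front_def nth_append)
      then have "A i (pull_front (P i) (us @ ws @ vs)) = f (?U @ brh (s (ws ! 0)) (\<phi> (tl ws)) # ?V)"
        using lens us
        by (simp add: A_def split apply_blocks_slot upd nth_append len_as)
      moreover have "B i (us @ ws @ vs) = (\<Sum>j<p. sv ((-1) ^ j) (f (?U @ \<phi> (contract brg j ws) # ?V)))"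
        unfolding B_def p\<phi> fst_conv
      proof (intro sum.cong refl arg_cong[where f = "sv _"])
        fix j assume "j \<in> {..<p}"
        then have "contract brg (P i + j) (us @ ws @ vs) = us @ contract brg j ws @ vs"
            "length (contract brg j ws) = p"
          using lens by (auto simp: contract_def nth_append)
        then show "g (contract brg (P i + j) (us @ ws @ vs)) = f (?U @ \<phi> (contract brg j ws) # ?V)"
          using us by (simp add: g_def split apply_blocks_slot)
      qed
      moreover have "f (?U @ raw_covariant_diff s p \<phi> ws # ?V) = f (?U @ brh (s (ws ! 0)) (\<phi> (tl ws)) # ?V)
          - sv (1 / 2) (\<Sum>j<p. sv ((-1) ^ j) (f (?U @ \<phi> (contract brg j ws) # ?V)))"
        unfolding raw_covariant_diff_def
        by (simp add: f_diff[OF slot] f_scale[OF slot] f_sum[OF slot] kas kernel_intros)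
      ultimately show "A i (pull_front (P i) (us @ ws @ vs)) - sv (1 / 2) (B i (us @ ws @ vs))
          = f (apply_blocks (as @ (Suc p, raw_covariant_diff s p \<phi>) # bs) (us @ ws @ vs))"
        using us lens by (simp add: apply_blocks_slot)
    qed
    also have "\<dots> = wedge (\<phi>s[i := (Suc p, raw_covariant_diff s p \<phi>)]) xs"
      using N by (simp add: wedge_def split len_as[symmetric] P_def del: alternation.simps)
    finally show "alternation sv (Suc N) (\<lambda>ys. A i ys - sv (1 / 2 * (-1) ^ P i) (B i ys)) xs
        = sv ((-1) ^ P i)
          (wedge (\<phi>s[i := (Suc (fst (\<phi>s ! i)), raw_covariant_diff s (fst (\<phi>s ! i)) (snd (\<phi>s ! i)))]) xs)"
      by (simp add: p\<phi>)
  qed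
  finally show ?thesis by (simp add: P_def)
qed

end

section \<open>Covariant derivatives and the Bianchi identity\<close>

context invariant_form
begin

lemma brh_add_left: "brh (x + y) z = brh x z + brh y z"
  and brh_add_right: "brh z (x + y) = brh z x + brh z y"
  and brh_diff_right: "brh z (x - y) = brh z x - brh z y"
  and brh_minus_left: "brh (- x) z = - brh x z"
  and brh_minus_right: "brh z (- x) = - brh z x"
proof -
  interpret L: Vector_Spaces.linear sh sh "\<lambda>x. brh x z" by (rule E.H.br_linear_left)
  interpret R: Vector_Spaces.linear sh sh "brh z" by (rule E.H.br_linear_right)
  show "brh (x + y) z = brh x z + brh y z" "brh z (x + y) = brh z x + brh z y"
    "brh z (x - y) = brh z x - brh z y"
    "brh (- x) z = - brh x z" "brh z (- x) = - brh z x"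
    by (rule L.add R.add R.diff L.neg R.neg)+
qed

lemma brh_anti: "brh y x = - brh x y"
proof -
  have "brh y x + brh x y = brh (x + y) (x + y)"
    by (simp only: brh_add_left brh_add_right E.H.br_self[of x] E.H.br_self[of y] add_0_left add_0_right add.commute)
  also have "\<dots> = 0" by (rule E.H.br_self)
  finally show ?thesis by (simp only: eq_neg_iff_add_eq_0)
qed

lemma curvature_in_kernel:
  assumes "linear_section sh sg q s"
  shows "curvature brh brg s ys \<in> ext_kernel q"
  using assms by (simp add: linear_section_def curvature_def ext_kernel_def Q.diff E.q_br)

lemma odd_curvature:
  assumes "linear_section sh sg q s" "length us + length vs + 1 = 2"
  shows "curvature brh brg s (us @ - a # vs) = - curvature brh brg s (us @ a # vs)"
proof -
  interpret s: Vector_Spaces.linear sg sh s using assms(1) by (simp add: linear_section_def)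
  interpret L: Vector_Spaces.linear sg sg "\<lambda>a. brg a b" for b by (rule E.G.br_linear_left)
  interpret R: Vector_Spaces.linear sg sg "brg a" for a by (rule E.G.br_linear_right)
  consider b where "us = []" "vs = [b]" | b where "us = [b]" "vs = []"
    using assms(2) by (cases us; cases vs) auto
  then show ?thesis
    by cases (simp_all add: curvature_def s.neg brh_minus_left brh_minus_right L.neg R.neg)
qed

text \<open>The terms \<open>[s x, [s y, s z]]\<close> cancel by the Jacobi identity of the extension, the terms
  \<open>s [x, [y, z]]\<close> by that of the quotient, and the mixed terms \<open>[s x, s [y, z]]\<close> cancel between
  \<open>[s x, R(y, z)]\<close> and \<open>R(x, [y, z])\<close>. The two halves of each \<open>R(x, [y, z])\<close> come from two different cyclic rotations.\<close>

theorem bianchi: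
  assumes s: "linear_section sh sg q s"
  defines "D \<equiv> raw_covariant_diff s 2 (curvature brh brg s)"
  shows "D [x, y, z] + D [y, z, x] + D [z, x, y] = 0"
proof -
  interpret s: Vector_Spaces.linear sg sh s using s by (simp add: linear_section_def)
  let ?R = "\<lambda>x y. curvature brh brg s [x, y]"
  have half: "sh (1 / 2) u + sh (1 / 2) u = u" for u
    by (simp flip: E.H.scale_left_distrib)
  have anti: "?R y x = - ?R x y" for x y
    by (simp add: curvature_def brh_anti[of "s x" "s y"] brg_anti[of x y] s.neg)
  have D: "D [x, y, z] = brh (s x) (?R y z) + sh (1 / 2) (?R z (brg x y)) + sh (1 / 2) (?R x (brg y z))"
    for x y z
    by (simp add: D_def raw_covariant_diff_def contract_def numeral_2_eq_2 anti[of z "brg x y"]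
        E.H.scale_right_distrib algebra_simps)
  have "D [x, y, z] + D [y, z, x] + D [z, x, y]
      = brh (s x) (?R y z) + brh (s y) (?R z x) + brh (s z) (?R x y)
        + (sh (1 / 2) (?R x (brg y z)) + sh (1 / 2) (?R x (brg y z)))
        + (sh (1 / 2) (?R y (brg z x)) + sh (1 / 2) (?R y (brg z x)))
        + (sh (1 / 2) (?R z (brg x y)) + sh (1 / 2) (?R z (brg x y)))"
    unfolding D by (simp only: ac_simps)
  then have 1: "D [x, y, z] + D [y, z, x] + D [z, x, y]
      = (brh (s x) (?R y z) + ?R x (brg y z)) + (brh (s y) (?R z x) + ?R y (brg z x))
        + (brh (s z) (?R x y) + ?R z (brg x y))"
    unfolding half by (simp only: ac_simps)
  have 2: "brh (s x) (?R y z) + ?R x (brg y z) = brh (s x) (brh (s y) (s z)) - s (brg x (brg y z))" for x y z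
    by (simp add: curvature_def brh_diff_right)
  have 3: "s (brg x (brg y z)) + s (brg y (brg z x)) + s (brg z (brg x y)) = 0"
    by (simp only: s.add[symmetric] E.G.jacobi s.zero)
  have "D [x, y, z] + D [y, z, x] + D [z, x, y]
      = (brh (s x) (brh (s y) (s z)) + brh (s y) (brh (s z) (s x)) + brh (s z) (brh (s x) (s y)))
        - (s (brg x (brg y z)) + s (brg y (brg z x)) + s (brg z (brg x y)))"
    unfolding 1 2 by (simp only: algebra_simps)
  then show ?thesis by (simp only: 3 E.H.jacobi diff_self)
qed

lemma raw_covariant_diff_in_kernel:
  "(\<And>ys. \<phi> ys \<in> ext_kernel q) \<Longrightarrow> raw_covariant_diff s p \<phi> ys \<in> ext_kernel q"
  by (simp add: raw_covariant_diff_def kernel_intros)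

lemma wedge_raw_covariant_diff_curvature:
  assumes len: "length \<phi>s + length \<psi>s + 1 = k" and ker: "kernel_valued \<phi>s" "kernel_valued \<psi>s"
    and s: "linear_section sh sg q s"
    and xs: "length xs = total_degree \<phi>s + 3 + total_degree \<psi>s"
  shows "wedge (\<phi>s @ (3, raw_covariant_diff s 2 (curvature brh brg s)) # \<psi>s) xs = 0"
proof -
  define D where "D = raw_covariant_diff s 2 (curvature brh brg s)"
  \<comment> \<open>a cyclic rotation of three arguments, hence an even permutation\<close>
  define rot where "rot ws = swap_adjacent 0 (swap_adjacent 1 ws)" for ws :: "'g list"
  let ?W = "\<lambda>\<phi>. wedge (\<phi>s @ (3, \<phi>) # \<psi>s) xs"
  have D: "D ws \<in> ext_kernel q" for ws
    unfolding D_def by (intro raw_covariant_diff_in_kernel curvature_in_kernel s)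
  have rot: "?W (\<lambda>ws. \<phi> (rot ws)) = ?W \<phi>" for \<phi>
  proof -
    have "?W (\<lambda>ws. \<phi> (rot ws)) = - ?W (\<lambda>ws. \<phi> (swap_adjacent 0 ws))"
      unfolding rot_def by (rule wedge_slot_swap_adjacent) (use xs in auto)
    also have "?W (\<lambda>ws. \<phi> (swap_adjacent 0 ws)) = - ?W \<phi>"
      by (rule wedge_slot_swap_adjacent) (use xs in auto)
    finally show ?thesis by simp
  qed
  have "?W D + ?W D + ?W D = ?W D + ?W (\<lambda>ws. D (rot ws)) + ?W (\<lambda>ws. D (rot (rot ws)))"
    using rot[of D] rot[of "\<lambda>ws. D (rot ws)"] by simp
  also have "\<dots> = ?W (\<lambda>ws. D ws + D (rot ws) + D (rot (rot ws)))"
    by (simp add: wedge_slot_add[OF len ker] D kernel_add)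
  also have "\<dots> = ?W (\<lambda>ws. sh 0 0)"
  proof (rule wedge_slot_cong)
    fix ws :: "'g list" assume "length ws = 3"
    then obtain x y z where ws: "ws = [x, y, z]" by (auto simp: numeral_3_eq_3 length_Suc_conv)
    then have "rot ws = [z, x, y]" "rot (rot ws) = [y, z, x]"
      by (simp_all add: rot_def swap_adjacent_def)
    then show "D ws + D (rot ws) + D (rot (rot ws)) = sh 0 0"
      using bianchi[OF s, folded D_def, of x y z] by (simp add: ws ac_simps)
  qed
  also have "\<dots> = 0"
    by (subst wedge_slot_scale[OF len ker]) (simp_all add: kernel_0)
  finally have "sv 3 (?W D) = 0"
    using M.V.scale_left_distrib[of 1 2 "?W D"] M.V.scale_left_distrib[of 1 1 "?W D"]
    by (simp add: add.assoc)
  then show ?thesis by (simp add: D_def)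
qed

text \<open>The covariant differential of a \<open>1\<close>-cochain.\<close>

definition covariant_diff :: "('g \<Rightarrow> 'h) \<Rightarrow> ('g list \<Rightarrow> 'h) \<Rightarrow> 'g list \<Rightarrow> 'h"
  where "covariant_diff s \<alpha> ys =
    brh (s (ys ! 0)) (\<alpha> [ys ! 1]) - brh (s (ys ! 1)) (\<alpha> [ys ! 0]) - \<alpha> [brg (ys ! 0) (ys ! 1)]"

lemma covariant_diff_in_kernel: "(\<And>ys. \<alpha> ys \<in> ext_kernel q) \<Longrightarrow> covariant_diff s \<alpha> ys \<in> ext_kernel q"
  by (simp add: covariant_diff_def kernel_intros)

lemma wedge_raw_covariant_diff_one:
  assumes len: "length \<phi>s + length \<psi>s + 1 = k" and ker: "kernel_valued \<phi>s" "kernel_valued \<psi>s"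
    and \<alpha>: "\<And>ys. \<alpha> ys \<in> ext_kernel q" and odd: "\<And>x. \<alpha> [- x] = - \<alpha> [x]"
    and xs: "length xs = total_degree \<phi>s + 2 + total_degree \<psi>s"
  shows "wedge (\<phi>s @ (2, raw_covariant_diff s 1 \<alpha>) # \<psi>s) xs
    = sv (1 / 2) (wedge (\<phi>s @ (2, covariant_diff s \<alpha>) # \<psi>s) xs)"
proof -
  let ?W = "\<lambda>\<phi>. wedge (\<phi>s @ (2, \<phi>) # \<psi>s) xs"
  define D where "D = raw_covariant_diff s 1 \<alpha>"
  have D: "D ws \<in> ext_kernel q" for ws unfolding D_def by (intro raw_covariant_diff_in_kernel \<alpha>)
  have half: "sh (1 / 2) u + sh (1 / 2) u = u" for u
    by (simp flip: E.H.scale_left_distrib)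
  have "?W (covariant_diff s \<alpha>) = ?W (\<lambda>ws. D ws + sh (-1) (D (swap_adjacent 0 ws)))"
  proof (rule wedge_slot_cong)
    fix ws :: "'g list" assume "length ws = 2"
    then obtain x y where ws: "ws = [x, y]" by (auto simp: numeral_2_eq_2 length_Suc_conv)
    have "\<alpha> [brg y x] = - \<alpha> [brg x y]" by (simp add: brg_anti[of x y] odd)
    with half[of "\<alpha> [brg x y]"] show "covariant_diff s \<alpha> ws = D ws + sh (-1) (D (swap_adjacent 0 ws))"
      by (simp add: ws D_def covariant_diff_def raw_covariant_diff_def swap_adjacent_def contract_def algebra_simps)
  qed
  also have "\<dots> = ?W D + sv (-1) (?W (\<lambda>ws. D (swap_adjacent 0 ws)))"
    by (simp add: wedge_slot_add[OF len ker] wedge_slot_scale[OF len ker] D kernel_scale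
        del: E.H.scale_minus_left M.V.scale_minus_left)
  also have "?W (\<lambda>ws. D (swap_adjacent 0 ws)) = - ?W D"
    by (rule wedge_slot_swap_adjacent) (use xs in auto)
  finally have "?W (covariant_diff s \<alpha>) = ?W D + ?W D" by simp
  then show ?thesis unfolding D_def[symmetric]
    by (simp add: M.V.scale_right_distrib flip: M.V.scale_left_distrib)
qed

definition degree_one :: "('g list \<Rightarrow> 'h) list \<Rightarrow> (nat \<times> ('g list \<Rightarrow> 'h)) list"
  where "degree_one \<alpha>s = map (Pair 1) \<alpha>s"

lemma degree_one_simps [simp]:
  "degree_one [] = []"
  "degree_one (\<alpha> # \<alpha>s) = (1, \<alpha>) # degree_one \<alpha>s"
  "degree_one (\<alpha>s @ \<beta>s) = degree_one \<alpha>s @ degree_one \<beta>s"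
  "length (degree_one \<alpha>s) = length \<alpha>s"
  "i < length \<alpha>s \<Longrightarrow> degree_one \<alpha>s ! i = (1, \<alpha>s ! i)"
  "take i (degree_one \<alpha>s) = degree_one (take i \<alpha>s)"
  "drop i (degree_one \<alpha>s) = degree_one (drop i \<alpha>s)"
  "set (degree_one \<alpha>s) = Pair 1 ` set \<alpha>s"
  by (simp_all add: degree_one_def take_map drop_map)

lemma total_degree_degree_one [simp]: "total_degree (degree_one \<alpha>s) = length \<alpha>s"
  by (induction \<alpha>s) auto

lemma total_degree_replicate [simp]: "total_degree (replicate r (p, \<phi>)) = r * p"
  by (induction r) auto

lemma sum_list_replicate_nat [simp]: "sum_list (replicate r (p::nat)) = r * p"
  by (induction r) auto

lemma kernel_valued_degree_one [simp]:
  "kernel_valued (degree_one \<alpha>s) \<longleftrightarrow> (\<forall>\<alpha>\<in>set \<alpha>s. \<forall>ys. \<alpha> ys \<in> ext_kernel q)"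
  by (induction \<alpha>s) auto

lemma kernel_valued_replicate:
  "(\<And>ys. \<phi> ys \<in> ext_kernel q) \<Longrightarrow> kernel_valued (replicate r (p, \<phi>))"
  by (induction r) auto

text \<open>A \<open>2\<close>-form commutes with every cochain, so the place of a curvature or of a
  covariant differential of a \<open>1\<close>-form is irrelevant.\<close>

lemma wedge_move_two_form:
  assumes "length \<phi>s + length \<alpha>s + length \<psi>s + 1 = k" "kernel_valued \<phi>s" "kernel_valued \<psi>s"
    and "\<And>\<alpha> ys. \<alpha> \<in> set \<alpha>s \<Longrightarrow> snd \<alpha> ys \<in> ext_kernel q"
    and "\<And>ys. \<beta> ys \<in> ext_kernel q"
    and xs: "length xs = total_degree \<phi>s + 2 + total_degree \<alpha>s + total_degree \<psi>s"
  shows "wedge (\<phi>s @ (2, \<beta>) # \<alpha>s @ \<psi>s) xs = wedge (\<phi>s @ \<alpha>s @ (2, \<beta>) # \<psi>s) xs"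
  using assms
proof (induction \<alpha>s arbitrary: \<phi>s)
  case Nil
  then show ?case by simp
next
  case (Cons a \<alpha>s)
  obtain p \<alpha> where a: "a = (p, \<alpha>)" by force
  have ker: "kernel_valued (\<alpha>s @ \<psi>s)" using Cons.prems(3,4) by (force simp: kernel_valued_def)
  have \<alpha>: "\<alpha> ys \<in> ext_kernel q" for ys using Cons.prems(4)[of a] by (simp add: a)
  have "wedge (\<phi>s @ (2, \<beta>) # (p, \<alpha>) # \<alpha>s @ \<psi>s) xs
      = sv ((-1) ^ (2 * p)) (wedge (\<phi>s @ (p, \<alpha>) # (2, \<beta>) # \<alpha>s @ \<psi>s) xs)"
    using Cons.prems ker \<alpha> by (intro wedge_exchange) (auto simp: a)
  also have "wedge (\<phi>s @ (p, \<alpha>) # (2, \<beta>) # \<alpha>s @ \<psi>s) xs = wedge (\<phi>s @ (p, \<alpha>) # \<alpha>s @ (2, \<beta>) # \<psi>s) xs"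
    using Cons.IH[of "\<phi>s @ [(p, \<alpha>)]"] Cons.prems \<alpha> by (simp add: a)
  finally show ?case by (simp add: a)
qed

text \<open>The product rule for one-forms and curvatures: the entries \<open>R\<close> drop out by the Bianchi identity,
  and the covariant differential of the \<open>i\<close>-th one-form, a \<open>2\<close>-form, is moved behind the
  remaining one-forms without a sign.\<close>

theorem ce_diff_wedge_curvature:
  assumes s: "linear_section sh sg q s" and len: "length \<alpha>s + r = k"
    and ker: "\<And>\<alpha> ys. \<alpha> \<in> set \<alpha>s \<Longrightarrow> \<alpha> ys \<in> ext_kernel q"
    and odd: "\<And>\<alpha> x. \<alpha> \<in> set \<alpha>s \<Longrightarrow> \<alpha> [- x] = - \<alpha> [x]"
    and xs: "length xs = length \<alpha>s + 2 * r + 1"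
  defines "R \<equiv> (2::nat, curvature brh brg s)"
  shows "ce_diff brg sv act (wedge (degree_one \<alpha>s @ replicate r R)) xs =
    (\<Sum>i<length \<alpha>s. sv ((-1) ^ i * (1 / 2))
      (wedge (degree_one (take i \<alpha>s @ drop (Suc i) \<alpha>s) @ (2, covariant_diff s (\<alpha>s ! i)) # replicate r R) xs))"
proof -
  let ?\<phi>s = "degree_one \<alpha>s @ replicate r R"
  have kR: "kernel_valued (replicate m R)" for m
    unfolding R_def by (intro kernel_valued_replicate curvature_in_kernel s)
  have kA: "kernel_valued (degree_one \<beta>s)" if "set \<beta>s \<subseteq> set \<alpha>s" for \<beta>s
    using ker that by auto
  have qs: "q (s x) = x" for x using s by (simp add: linear_section_def)
  have "\<phi> (us @ - a # vs) = - \<phi> (us @ a # vs)"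
    if *: "(p, \<phi>) \<in> set ?\<phi>s" "length us + length vs + 1 = p" for p \<phi> us a vs
  proof -
    from * consider "\<phi> \<in> set \<alpha>s" "us = []" "vs = []" | "p = 2" "\<phi> = curvature brh brg s"
      by (auto simp: R_def)
    then show ?thesis
      by cases (use odd odd_curvature[OF s] * in auto)
  qed
  then have oddc: "odd_cochains ?\<phi>s"
    unfolding odd_cochains_def by blast
  define T where "T i = sv ((-1) ^ total_degree (take i ?\<phi>s))
      (wedge (?\<phi>s[i := (Suc (fst (?\<phi>s ! i)), raw_covariant_diff s (fst (?\<phi>s ! i)) (snd (?\<phi>s ! i)))]) xs)" for i
  have "ce_diff brg sv act (wedge ?\<phi>s) xs = (\<Sum>i<k. T i)"
    unfolding T_def
  proof (rule ce_diff_wedge[OF qs _ _ oddc])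
    show "length xs = Suc (total_degree ?\<phi>s)" using xs by (simp add: R_def mult.commute)
  qed (use len kA kR in auto)
  also have "\<dots> = (\<Sum>i<length \<alpha>s. T i)"
  proof (rule sum.mono_neutral_right)
    show "\<forall>i\<in>{..<k} - {..<length \<alpha>s}. T i = 0"
    proof
      fix i assume "i \<in> {..<k} - {..<length \<alpha>s}"
      then obtain j where i: "i = length \<alpha>s + j" "j < r" using len
        by (metis Diff_iff add_less_cancel_left le_Suc_ex lessThan_iff not_less)
      define D where "D = raw_covariant_diff s 2 (curvature brh brg s)"
      have *: "(replicate r R)[j := x] = replicate j R @ x # replicate (r - Suc j) R" for x
        using i(2) by (simp add: upd_conv_take_nth_drop min_def)
      have "?\<phi>s[i := (Suc (fst (?\<phi>s ! i)), raw_covariant_diff s (fst (?\<phi>s ! i)) (snd (?\<phi>s ! i)))]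
          = (degree_one \<alpha>s @ replicate j R) @ (3, D) # replicate (r - Suc j) R"
        using i(2) by (simp add: i(1) * nth_append D_def list_update_append) (simp add: R_def)
      \<comment> \<open>here the Bianchi identity enters\<close>
      moreover have "wedge ((degree_one \<alpha>s @ replicate j R) @ (3, D) # replicate (r - Suc j) R) xs = 0"
        unfolding D_def
      proof (rule wedge_raw_covariant_diff_curvature)
        have "j * 2 + (r - Suc j) * 2 + 2 = r * 2" using i(2) by (simp add: algebra_simps)
        then show "length xs = total_degree (degree_one \<alpha>s @ replicate j R) + 3 + total_degree (replicate (r - Suc j) R)"
          using xs by (simp add: R_def)
      qed (use i(2) len kA kR s in auto)
      ultimately show "T i = 0" by (simp add: T_def)
    qed
  qed (use len in auto)
  also have "\<dots> = (\<Sum>i<length \<alpha>s. sv ((-1) ^ i * (1 / 2))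
      (wedge (degree_one (take i \<alpha>s @ drop (Suc i) \<alpha>s) @ (2, covariant_diff s (\<alpha>s ! i)) # replicate r R) xs))"
  proof (rule sum.cong[OF refl])
    fix i assume "i \<in> {..<length \<alpha>s}"
    then have i: "i < length \<alpha>s" by simp
    let ?A = "degree_one (take i \<alpha>s)" and ?B = "degree_one (drop (Suc i) \<alpha>s)"
    have AB: "kernel_valued ?A" "kernel_valued ?B"
      by (rule kA, simp add: set_take_subset set_drop_subset)+
    have cker: "covariant_diff s (\<alpha>s ! i) ys \<in> ext_kernel q" for ys
      using i by (intro covariant_diff_in_kernel ker) auto
    have "total_degree (take i ?\<phi>s) = i" using i by (simp add: take_map min_def)
    moreover have "?\<phi>s[i := (Suc (fst (?\<phi>s ! i)), raw_covariant_diff s (fst (?\<phi>s ! i)) (snd (?\<phi>s ! i)))]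
        = ?A @ (2, raw_covariant_diff s 1 (\<alpha>s ! i)) # ?B @ replicate r R"
      using i by (simp add: upd_conv_take_nth_drop take_map drop_map nth_append numeral_2_eq_2)
    ultimately have "T i = sv ((-1) ^ i) (wedge (?A @ (2, raw_covariant_diff s 1 (\<alpha>s ! i)) # ?B @ replicate r R) xs)"
      by (simp only: T_def)
    also have "wedge (?A @ (2, raw_covariant_diff s 1 (\<alpha>s ! i)) # ?B @ replicate r R) xs
        = sv (1 / 2) (wedge (?A @ (2, covariant_diff s (\<alpha>s ! i)) # ?B @ replicate r R) xs)"
      using i len xs AB kR ker[of "\<alpha>s ! i"] odd[of "\<alpha>s ! i"]
      by (intro wedge_raw_covariant_diff_one) (auto simp: R_def)
    also have "wedge (?A @ (2, covariant_diff s (\<alpha>s ! i)) # ?B @ replicate r R) xs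
        = wedge (?A @ ?B @ (2, covariant_diff s (\<alpha>s ! i)) # replicate r R) xs"
    proof (rule wedge_move_two_form)
      show "length xs = total_degree ?A + 2 + total_degree ?B + total_degree (replicate r R)"
        using xs i by (simp add: R_def)
    qed (use i len AB kR cker ker in \<open>auto dest!: in_set_dropD\<close>)
    finally show "T i = sv ((-1) ^ i * (1 / 2))
      (wedge (degree_one (take i \<alpha>s @ drop (Suc i) \<alpha>s) @ (2, covariant_diff s (\<alpha>s ! i)) # replicate r R) xs)"
      by simp
  qed
  finally show ?thesis .
qed

end

section \<open>The Dirichlet integral\<close>

text \<open>Integration by parts lowers \<open>a\<close> and raises \<open>d\<close>: the derivative of
  \<open>y ^ Suc a * (s - y) ^ Suc d\<close> has integral zero over \<open>{0..s}\<close>.\<close>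

lemma has_integral_beta_nat:
  fixes s :: real
  assumes "0 \<le> s"
  shows "((\<lambda>y. y ^ a * (s - y) ^ d) has_integral s ^ (a + d + 1) * fact a * fact d / fact (a + d + 1)) {0..s}"
proof (induction a arbitrary: d)
  case 0
  have "((\<lambda>y. (s - y) ^ d) has_integral (- ((s - s) ^ Suc d / Suc d)) - (- ((s - 0) ^ Suc d / Suc d))) {0..s}"
    by (rule fundamental_theorem_of_calculus[OF assms])
      (auto intro!: derivative_eq_intros simp del: power_Suc of_nat_Suc
        simp flip: has_real_derivative_iff_has_vector_derivative)
  moreover have "s ^ (0 + d + 1) * fact 0 * fact d / fact (0 + d + 1) = s * s ^ d / (1 + real d)"
    by simp
  ultimately show ?case by simp
next
  case (Suc a)
  have "((\<lambda>y. Suc a * (y ^ a * (s - y) ^ Suc d) - Suc d * (y ^ Suc a * (s - y) ^ d))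
      has_integral s ^ Suc a * (s - s) ^ Suc d - 0 ^ Suc a * (s - 0) ^ Suc d) {0..s}"
    by (rule fundamental_theorem_of_calculus[OF assms])
      (auto intro!: derivative_eq_intros simp del: power_Suc of_nat_Suc
        simp flip: has_real_derivative_iff_has_vector_derivative)
  then have "((\<lambda>y. Suc a * (y ^ a * (s - y) ^ Suc d) - Suc d * (y ^ Suc a * (s - y) ^ d)) has_integral 0) {0..s}"
    by simp
  from has_integral_diff[OF has_integral_mult_right[OF Suc.IH[of "Suc d"], of "Suc a"] this]
  have "((\<lambda>y. Suc d * (y ^ Suc a * (s - y) ^ d))
      has_integral Suc a * (s ^ (a + Suc d + 1) * fact a * fact (Suc d) / fact (a + Suc d + 1))) {0..s}"
    by simp
  from has_integral_mult_right[OF this, of "1 / Suc d"] show ?case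
    by (simp add: field_simps del: power_Suc of_nat_Suc)
qed

text \<open>The power of \<open>s - (\<Sum>i\<in>A. x i)\<close> plays the role of the dependent barycentric coordinate, and a variable
  size \<open>s\<close> of the simplex makes an induction over the coordinates possible.\<close>

definition dirichlet_integrand :: "'a set \<Rightarrow> real \<Rightarrow> nat \<Rightarrow> ('a \<Rightarrow> nat) \<Rightarrow> ('a \<Rightarrow> real) \<Rightarrow> real"
  where "dirichlet_integrand A s b m x =
    (if (\<forall>i\<in>A. 0 \<le> x i) \<and> (\<Sum>i\<in>A. x i) \<le> s
     then (s - (\<Sum>i\<in>A. x i)) ^ b * (\<Prod>i\<in>A. x i ^ m i) else 0)"

lemma dirichlet_integrand_nonneg: "0 \<le> dirichlet_integrand A s b m x"
  by (auto simp: dirichlet_integrand_def intro!: mult_nonneg_nonneg prod_nonneg)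

lemma measurable_dirichlet_integrand:
  assumes [simp]: "finite A"
  shows "dirichlet_integrand A s b m \<in> borel_measurable (\<Pi>\<^sub>M i\<in>A. lborel)"
  unfolding dirichlet_integrand_def[abs_def] by measurable

text \<open>Fixing the new coordinate at \<open>y\<close> leaves the same integral over a simplex of size \<open>s - y\<close>, whose value
  is a multiple of a power of \<open>s - y\<close>; the integral over \<open>y\<close> is then a beta integral.\<close>

lemma nn_integral_dirichlet:
  assumes "finite A" "0 \<le> s"
  shows "(\<integral>\<^sup>+x. ennreal (dirichlet_integrand A s b m x) \<partial>(\<Pi>\<^sub>M i\<in>A. lborel))
    = ennreal (s ^ (card A + b + sum m A) * fact b * (\<Prod>i\<in>A. fact (m i)) / fact (card A + b + sum m A))"
  using assms
proof (induction A arbitrary: s rule: finite_induct)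
  case empty
  then show ?case by (simp add: PiM_empty dirichlet_integrand_def)
next
  case (insert c A)
  interpret product_sigma_finite "\<lambda>_. lborel :: real measure" ..
  define d where "d = card A + b + sum m A"
  define C where "C = (fact b * (\<Prod>i\<in>A. fact (m i)) / fact d :: real)"
  have C: "0 \<le> C" unfolding C_def by (intro divide_nonneg_nonneg mult_nonneg_nonneg prod_nonneg) auto
  have step: "dirichlet_integrand (insert c A) s b m (x(c := y))
      = (y ^ m c * indicator {0..s} y) * dirichlet_integrand A (s - y) b m x" for x y
  proof -
    have 1: "(\<Sum>i\<in>A. (x(c := y)) i) = (\<Sum>i\<in>A. x i)" "(\<Prod>i\<in>A. (x(c := y)) i ^ m i) = (\<Prod>i\<in>A. x i ^ m i)"
      using insert.hyps by (auto intro!: sum.cong prod.cong)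
    have 2: "(\<forall>i\<in>insert c A. 0 \<le> (x(c := y)) i) \<longleftrightarrow> 0 \<le> y \<and> (\<forall>i\<in>A. 0 \<le> x i)"
      using insert.hyps by auto
    have 3: "y \<le> s" if "\<forall>i\<in>A. 0 \<le> x i" "y + (\<Sum>i\<in>A. x i) \<le> s"
      using sum_nonneg[of A x] that by force
    have 4: "(\<Sum>i\<in>insert c A. (x(c := y)) i) = y + (\<Sum>i\<in>A. x i)"
      "(\<Prod>i\<in>insert c A. (x(c := y)) i ^ m i) = y ^ m c * (\<Prod>i\<in>A. x i ^ m i)"
      using insert.hyps 1 by simp_all
    show ?thesis
      unfolding dirichlet_integrand_def 2 4 using 3
      by (auto simp: indicator_def algebra_simps)
  qed
  have "(\<integral>\<^sup>+x. ennreal (dirichlet_integrand (insert c A) s b m x) \<partial>(\<Pi>\<^sub>M i\<in>insert c A. lborel))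
      = (\<integral>\<^sup>+y. \<integral>\<^sup>+x. ennreal (dirichlet_integrand (insert c A) s b m (x(c := y))) \<partial>(\<Pi>\<^sub>M i\<in>A. lborel) \<partial>lborel)"
    using insert.hyps measurable_dirichlet_integrand[of "insert c A" s b m]
    by (intro product_nn_integral_insert_rev) auto
  also have "\<dots> = (\<integral>\<^sup>+y. ennreal (C * (y ^ m c * (s - y) ^ d)) * indicator {0..s} y \<partial>lborel)"
  proof (rule nn_integral_cong)
    fix y :: real
    show "(\<integral>\<^sup>+x. ennreal (dirichlet_integrand (insert c A) s b m (x(c := y))) \<partial>(\<Pi>\<^sub>M i\<in>A. lborel))
        = ennreal (C * (y ^ m c * (s - y) ^ d)) * indicator {0..s} y"
    proof (cases "y \<in> {0..s}")
      case True
      then have "(\<integral>\<^sup>+x. ennreal (dirichlet_integrand (insert c A) s b m (x(c := y))) \<partial>(\<Pi>\<^sub>M i\<in>A. lborel))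
          = (\<integral>\<^sup>+x. ennreal (y ^ m c) * ennreal (dirichlet_integrand A (s - y) b m x) \<partial>(\<Pi>\<^sub>M i\<in>A. lborel))"
        unfolding step by (intro nn_integral_cong) (simp add: ennreal_mult dirichlet_integrand_nonneg)
      also have "\<dots> = ennreal (y ^ m c) * (\<integral>\<^sup>+x. ennreal (dirichlet_integrand A (s - y) b m x) \<partial>(\<Pi>\<^sub>M i\<in>A. lborel))"
        using measurable_dirichlet_integrand[OF insert.hyps(1), of "s - y" b m] by (intro nn_integral_cmult) simp
      also have "\<dots> = ennreal (y ^ m c) * ennreal ((s - y) ^ d * C)"
        using True by (subst insert.IH) (auto simp: d_def C_def mult_ac)
      finally show ?thesis
        using True C by (simp add: ennreal_mult[symmetric] mult_ac)
    qed (simp add: step)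
  qed
  also have "\<dots> = ennreal (C * (s ^ (m c + d + 1) * fact (m c) * fact d / fact (m c + d + 1)))"
    using C by (intro nn_integral_has_integral_lebesgue' has_integral_mult_right
        has_integral_beta_nat insert.prems) (auto intro!: mult_nonneg_nonneg)
  also have "C * (s ^ (m c + d + 1) * fact (m c) * fact d / fact (m c + d + 1))
      = s ^ (m c + d + 1) * fact b * (fact (m c) * (\<Prod>i\<in>A. fact (m i))) / fact (m c + d + 1)"
    by (simp add: C_def)
  also have "m c + d + 1 = card (insert c A) + b + sum m (insert c A)"
    using insert.hyps by (simp add: d_def)
  also have "fact (m c) * (\<Prod>i\<in>A. fact (m i)) = (\<Prod>i\<in>insert c A. fact (m i) :: real)"
    using insert.hyps by simp
  finally show ?case .
qed

text \<open>Dirichlet's formula: the case \<open>s = 1\<close>, with the exponent of the dependent coordinate as \<open>b\<close>.\<close>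

theorem simplex_integral_monomial:
  "simplex_integral n (\<lambda>t. \<Prod>i\<le>n. t i ^ m i) = (\<Prod>i\<le>n. fact (m i)) / fact (n + (\<Sum>i\<le>n. m i))"
proof -
  let ?P = "(\<Pi>\<^sub>M i\<in>{1..n}. lborel) :: (nat \<Rightarrow> real) measure"
  let ?A = "{t \<in> {1..n} \<rightarrow>\<^sub>E UNIV. (\<forall>i\<in>{1..n}. 0 \<le> t i) \<and> (\<Sum>i=1..n. t i) \<le> (1::real)}"
  have split: "{..n} = insert 0 {1..n}" by auto
  have "simplex_integral n (\<lambda>t. \<Prod>i\<le>n. t i ^ m i) = (LINT t|?P. dirichlet_integrand {1..n} 1 (m 0) m t)"
    unfolding simplex_integral_def set_lebesgue_integral_def
  proof (rule Bochner_Integration.integral_cong)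
    fix t assume "t \<in> space ?P"
    then have "t \<in> ?A \<longleftrightarrow> (\<forall>i\<in>{1..n}. 0 \<le> t i) \<and> (\<Sum>i=1..n. t i) \<le> 1"
      by (auto simp: space_PiM)
    then have ind: "indicator ?A t = (if (\<forall>i\<in>{1..n}. 0 \<le> t i) \<and> (\<Sum>i=1..n. t i) \<le> 1 then 1 else (0::real))"
      unfolding indicator_def of_bool_def by (rule if_weak_cong)
    have "(\<Prod>i\<le>n. bary n t i ^ m i) = (1 - (\<Sum>i=1..n. t i)) ^ m 0 * (\<Prod>i=1..n. t i ^ m i)"
      unfolding split by (subst prod.insert) (auto simp: bary_def intro!: prod.cong)
    then show "indicator ?A t *\<^sub>R (\<Prod>i\<le>n. bary n t i ^ m i) = dirichlet_integrand {1..n} 1 (m 0) m t"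
      unfolding ind dirichlet_integrand_def by simp
  qed simp
  also have "\<dots> = enn2real (\<integral>\<^sup>+t. ennreal (dirichlet_integrand {1..n} 1 (m 0) m t) \<partial>?P)"
    by (intro integral_eq_nn_integral measurable_dirichlet_integrand)
      (auto simp: dirichlet_integrand_nonneg)
  also have "\<dots> = fact (m 0) * (\<Prod>i=1..n. fact (m i)) / fact (n + m 0 + sum m {1..n})"
    by (subst nn_integral_dirichlet) (auto intro!: enn2real_ennreal divide_nonneg_nonneg mult_nonneg_nonneg prod_nonneg)
  also have "\<dots> = (\<Prod>i\<le>n. fact (m i)) / fact (n + (\<Sum>i\<le>n. m i))"
    unfolding split by (simp add: add.assoc)
  finally show ?thesis .
qed

section \<open>Vector-valued polynomials and Stokes' theorem on a simplex\<close>

lemma has_poly_simplex_integral_cong: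
  assumes "has_poly_simplex_integral sv n F v" "\<And>t. t \<in> standard_simplex n \<Longrightarrow> G t = F t"
  shows "has_poly_simplex_integral sv n G v"
  using assms unfolding has_poly_simplex_integral_def by simp

locale poly_integration = vector_space sv
  for sv :: "'k::real_normed_field \<Rightarrow> 'v::ab_group_add \<Rightarrow> 'v"
begin

lemma has_poly_simplex_integral_monomial:
  "has_poly_simplex_integral sv n (\<lambda>t. sv (of_real (\<Prod>i\<le>n. t i ^ m i)) v)
     (sv (of_real (simplex_integral n (\<lambda>t. \<Prod>i\<le>n. t i ^ m i))) v)"
  unfolding has_poly_simplex_integral_def
  by (intro exI[of _ "{m}"] exI[of _ "\<lambda>_. v"]) simp

lemma has_poly_simplex_integral_zero: "has_poly_simplex_integral sv n (\<lambda>t. 0) 0"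
  unfolding has_poly_simplex_integral_def
  by (intro exI[of _ "{}"] exI[of _ "\<lambda>_. 0"]) simp

lemma has_poly_simplex_integral_add:
  assumes "has_poly_simplex_integral sv n F v" "has_poly_simplex_integral sv n G w"
  shows "has_poly_simplex_integral sv n (\<lambda>t. F t + G t) (v + w)"
proof -
  obtain M :: "(nat \<Rightarrow> nat) set" and c where M: "finite M"
      "\<forall>t\<in>standard_simplex n. F t = (\<Sum>m\<in>M. sv (of_real (\<Prod>i\<le>n. t i ^ m i)) (c m))"
      "v = (\<Sum>m\<in>M. sv (of_real (simplex_integral n (\<lambda>t. \<Prod>i\<le>n. t i ^ m i))) (c m))"
    using assms(1) unfolding has_poly_simplex_integral_def by blast
  obtain M' :: "(nat \<Rightarrow> nat) set" and c' where M': "finite M'"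
      "\<forall>t\<in>standard_simplex n. G t = (\<Sum>m\<in>M'. sv (of_real (\<Prod>i\<le>n. t i ^ m i)) (c' m))"
      "w = (\<Sum>m\<in>M'. sv (of_real (simplex_integral n (\<lambda>t. \<Prod>i\<le>n. t i ^ m i))) (c' m))"
    using assms(2) unfolding has_poly_simplex_integral_def by blast
  let ?c = "\<lambda>m. if m \<in> M then c m else 0" and ?c' = "\<lambda>m. if m \<in> M' then c' m else 0"
  have *: "(\<Sum>m\<in>M. sv (a m) (c m)) + (\<Sum>m\<in>M'. sv (a m) (c' m))
      = (\<Sum>m\<in>M \<union> M'. sv (a m) (?c m + ?c' m))" for a
  proof -
    have "(\<Sum>m\<in>M. sv (a m) (c m)) = (\<Sum>m\<in>M \<union> M'. sv (a m) (?c m))"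
      using M(1) M'(1) by (intro sum.mono_neutral_cong_left) auto
    moreover have "(\<Sum>m\<in>M'. sv (a m) (c' m)) = (\<Sum>m\<in>M \<union> M'. sv (a m) (?c' m))"
      using M(1) M'(1) by (intro sum.mono_neutral_cong_left) auto
    ultimately show ?thesis by (simp only: scale_right_distrib sum.distrib)
  qed
  show ?thesis
    unfolding has_poly_simplex_integral_def
  proof (intro exI conjI)
    show "finite (M \<union> M')" using M(1) M'(1) by simp
    show "\<forall>t\<in>standard_simplex n. F t + G t
        = (\<Sum>m\<in>M \<union> M'. sv (of_real (\<Prod>i\<le>n. t i ^ m i)) (?c m + ?c' m))"
      unfolding *[symmetric] using M(2) M'(2) by simp
    show "v + w = (\<Sum>m\<in>M \<union> M'. sv (of_real (simplex_integral n (\<lambda>t. \<Prod>i\<le>n. t i ^ m i))) (?c m + ?c' m))"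
      unfolding *[symmetric] M(3) M'(3) ..
  qed
qed

lemma has_poly_simplex_integral_linear:
  assumes "has_poly_simplex_integral sv n F v"
    and "Vector_Spaces.linear sv sv L"
  shows "has_poly_simplex_integral sv n (\<lambda>t. L (F t)) (L v)"
proof -
  interpret L: Vector_Spaces.linear sv sv L by fact
  obtain M :: "(nat \<Rightarrow> nat) set" and c where M: "finite M"
      "\<forall>t\<in>standard_simplex n. F t = (\<Sum>m\<in>M. sv (of_real (\<Prod>i\<le>n. t i ^ m i)) (c m))"
      "v = (\<Sum>m\<in>M. sv (of_real (simplex_integral n (\<lambda>t. \<Prod>i\<le>n. t i ^ m i))) (c m))"
    using assms(1) unfolding has_poly_simplex_integral_def by blast
  show ?thesis
    unfolding has_poly_simplex_integral_def
    by (intro exI[of _ M] exI[of _ "\<lambda>m. L (c m)"]) (simp add: M L.sum L.scale)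
qed

lemma has_poly_simplex_integral_scale:
  assumes "has_poly_simplex_integral sv n F v"
  shows "has_poly_simplex_integral sv n (\<lambda>t. sv a (F t)) (sv a v)"
  by (rule has_poly_simplex_integral_linear[OF assms linear_scale_self])

lemma has_poly_simplex_integral_sum:
  assumes "\<And>i. i \<in> I \<Longrightarrow> has_poly_simplex_integral sv n (F i) (v i)"
  shows "has_poly_simplex_integral sv n (\<lambda>t. \<Sum>i\<in>I. F i t) (\<Sum>i\<in>I. v i)"
  using assms
  by (induction I rule: infinite_finite_induct)
    (simp_all add: has_poly_simplex_integral_zero has_poly_simplex_integral_add)

end

text \<open>\<open>poly_deriv rs S n w F F'\<close> says that \<open>F\<close> is, on the standard simplex, a polynomial with
  coefficients in \<open>S\<close>, and \<open>F'\<close> its derivative in the direction \<open>w\<close>. Only the values on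
  the simplex matter (rule \<open>cong\<close>): the curvature of an affine combination of sections takes
  values in the kernel only there. A given \<open>F\<close> has several such polynomials; the relation makes a
  choice unnecessary. The truncation in \<open>m j - 1\<close> is harmless, since the term has the factor \<open>m j\<close>.\<close>

inductive poly_deriv ::
    "(real \<Rightarrow> 'b::ab_group_add \<Rightarrow> 'b) \<Rightarrow> 'b set \<Rightarrow> nat \<Rightarrow> (nat \<Rightarrow> real)
      \<Rightarrow> ((nat \<Rightarrow> real) \<Rightarrow> 'b) \<Rightarrow> ((nat \<Rightarrow> real) \<Rightarrow> 'b) \<Rightarrow> bool"
  for rs S n w
  where
    monomial: "v \<in> S \<Longrightarrow> poly_deriv rs S n w (\<lambda>t. rs (\<Prod>i\<le>n. t i ^ m i) v)
      (\<lambda>t. rs (\<Sum>j\<le>n. w j * (m j * (\<Prod>i\<le>n. t i ^ (m(j := m j - 1)) i))) v)"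
  | add: "poly_deriv rs S n w F F' \<Longrightarrow> poly_deriv rs S n w G G'
      \<Longrightarrow> poly_deriv rs S n w (\<lambda>t. F t + G t) (\<lambda>t. F' t + G' t)"
  | cong: "poly_deriv rs S n w F F' \<Longrightarrow> (\<And>t. t \<in> standard_simplex n \<Longrightarrow> G t = F t)
      \<Longrightarrow> (\<And>t. t \<in> standard_simplex n \<Longrightarrow> G' t = F' t) \<Longrightarrow> poly_deriv rs S n w G G'"

text \<open>Membership in \<open>S\<close> is part of the conclusion because the additivity of \<open>L\<close> on \<open>S\<close> is applied to
  the values of \<open>F\<close> and \<open>F'\<close> during the same induction.\<close>

lemma poly_deriv_linear:
  assumes "poly_deriv rs S n w F F'" "vector_space rs" "module.subspace rs S" "vector_space rs'"
    and L: "\<And>a. a \<in> S \<Longrightarrow> L a \<in> S'"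
    and L_add: "\<And>a b. a \<in> S \<Longrightarrow> b \<in> S \<Longrightarrow> L (a + b) = L a + L b"
    and L_scale: "\<And>r a. a \<in> S \<Longrightarrow> L (rs r a) = rs' r (L a)"
  shows "poly_deriv rs' S' n w (\<lambda>t. L (F t)) (\<lambda>t. L (F' t))
    \<and> (\<forall>t\<in>standard_simplex n. F t \<in> S \<and> F' t \<in> S)"
proof -
  interpret vector_space rs by fact
  note sub = subspace_scale[OF assms(3)] subspace_add[OF assms(3)]
  show ?thesis
    using assms(1)
  proof induction
    case (monomial v m)
    have "poly_deriv rs' S' n w (\<lambda>t. rs' (\<Prod>i\<le>n. t i ^ m i) (L v))
        (\<lambda>t. rs' (\<Sum>j\<le>n. w j * (m j * (\<Prod>i\<le>n. t i ^ (m(j := m j - 1)) i))) (L v))"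
      by (rule poly_deriv.monomial) (rule L, rule monomial)
    then show ?case
      unfolding L_scale[OF monomial] using sub(1)[OF monomial] by blast
  next
    case (add F F' G G')
    then have "poly_deriv rs' S' n w (\<lambda>t. L (F t) + L (G t)) (\<lambda>t. L (F' t) + L (G' t))"
      by (intro poly_deriv.add) auto
    then have "poly_deriv rs' S' n w (\<lambda>t. L (F t + G t)) (\<lambda>t. L (F' t + G' t))"
      by (rule poly_deriv.cong) (use add in \<open>auto simp: L_add\<close>)
    with add show ?case by (auto intro: sub)
  next
    case (cong F F' G G')
    then have "poly_deriv rs' S' n w (\<lambda>t. L (G t)) (\<lambda>t. L (G' t))"
      by (elim conjE) (rule poly_deriv.cong[of _ _ _ _ "\<lambda>t. L (F t)" "\<lambda>t. L (F' t)"], auto)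
    with cong show ?case by auto
  qed
qed

locale real_subspace = vector_space rs
  for rs :: "real \<Rightarrow> 'b::ab_group_add \<Rightarrow> 'b" +
  fixes S :: "'b set"
  assumes subspace_S: "subspace S"
begin

lemma poly_deriv_in_S:
  assumes "poly_deriv rs S n w F F'" "t \<in> standard_simplex n"
  shows "F t \<in> S" "F' t \<in> S"
  using poly_deriv_linear[OF assms(1) vector_space_axioms subspace_S vector_space_axioms, of "\<lambda>x. x" S]
    assms(2) by auto

lemma poly_deriv_const: "v \<in> S \<Longrightarrow> poly_deriv rs S n w (\<lambda>t. v) (\<lambda>t. 0)"
  by (rule poly_deriv.cong[OF poly_deriv.monomial[of v S rs n w "\<lambda>_. 0"]]) auto

lemma poly_deriv_sum:
  "(\<And>i. i \<in> I \<Longrightarrow> poly_deriv rs S n w (F i) (F' i))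
    \<Longrightarrow> poly_deriv rs S n w (\<lambda>t. \<Sum>i\<in>I. F i t) (\<lambda>t. \<Sum>i\<in>I. F' i t)"
proof (induction I rule: infinite_finite_induct)
  case (insert x I)
  then have "poly_deriv rs S n w (\<lambda>t. F x t + (\<Sum>i\<in>I. F i t)) (\<lambda>t. F' x t + (\<Sum>i\<in>I. F' i t))"
    by (intro poly_deriv.add) auto
  then show ?case using insert.hyps by simp
qed (simp_all add: poly_deriv_const subspace_0[OF subspace_S])

lemma poly_deriv_mult_monomial:
  assumes "poly_deriv rs S n w F F'"
  shows "poly_deriv rs S n w (\<lambda>t. rs (\<Prod>i\<le>n. t i ^ m i) (F t))
    (\<lambda>t. rs (\<Sum>j\<le>n. w j * (m j * (\<Prod>i\<le>n. t i ^ (m(j := m j - 1)) i))) (F t)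
      + rs (\<Prod>i\<le>n. t i ^ m i) (F' t))"
  using assms
proof induction
  case (monomial u l)
  have 1: "(\<Prod>i\<le>n. t i ^ (\<lambda>i. m i + l i) i) = (\<Prod>i\<le>n. t i ^ m i) * (\<Prod>i\<le>n. t i ^ l i)"
    for t :: "nat \<Rightarrow> real" and m l :: "nat \<Rightarrow> nat"
    by (simp add: power_add prod.distrib)
  have 2: "(\<lambda>i. m i + l i)(j := (m j + l j) - 1) = (\<lambda>i. (m(j := m j - 1)) i + l i)" if "m j \<noteq> 0" for j
    using that by auto
  have 3: "(\<lambda>i. m i + l i)(j := (m j + l j) - 1) = (\<lambda>i. m i + (l(j := l j - 1)) i)" if "l j \<noteq> 0" for j
    using that by auto
  have 4: "(m j + l j) * (\<Prod>i\<le>n. t i ^ ((\<lambda>i. m i + l i)(j := (m j + l j) - 1)) i)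
      = (m j * (\<Prod>i\<le>n. t i ^ (m(j := m j - 1)) i)) * (\<Prod>i\<le>n. t i ^ l i)
        + (\<Prod>i\<le>n. t i ^ m i) * (l j * (\<Prod>i\<le>n. t i ^ (l(j := l j - 1)) i))"
    for t :: "nat \<Rightarrow> real" and j
  proof -
    let ?Q = "\<Prod>i\<le>n. t i ^ ((\<lambda>i. m i + l i)(j := (m j + l j) - 1)) i"
    have "m j * ?Q = (m j * (\<Prod>i\<le>n. t i ^ (m(j := m j - 1)) i)) * (\<Prod>i\<le>n. t i ^ l i)"
      by (cases "m j = 0") (simp, simp only: 2 1 mult.assoc simp_thms if_False)
    moreover have "l j * ?Q = (\<Prod>i\<le>n. t i ^ m i) * (l j * (\<Prod>i\<le>n. t i ^ (l(j := l j - 1)) i))"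
      by (cases "l j = 0") (simp, simp only: 3 1 mult.left_commute simp_thms if_False)
    ultimately show ?thesis by (simp only: of_nat_add distrib_right)
  qed
  from poly_deriv.monomial[OF monomial, of rs n w "\<lambda>i. m i + l i"] show ?case
    unfolding 1 4
    by (simp only: scale_scale scale_left_distrib[symmetric] sum_distrib_left sum_distrib_right
        sum.distrib distrib_left mult.assoc mult.left_commute mult.commute)
next
  case (add F F' G G')
  from poly_deriv.add[OF add.IH] show ?case
    by (simp add: scale_right_distrib algebra_simps)
next
  case (cong F F' G G')
  from poly_deriv.cong[OF cong.IH] cong.hyps show ?case by simp
qed

lemma poly_deriv_mult_coordinate:
  assumes "poly_deriv rs S n w F F'" "j \<le> n"
  shows "poly_deriv rs S n w (\<lambda>t. rs (t j) (F t)) (\<lambda>t. rs (w j) (F t) + rs (t j) (F' t))"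
proof -
  let ?m = "\<lambda>i. if i = j then 1 else 0 :: nat"
  have 1: "(\<Prod>i\<le>n. t i ^ ?m i) = t j" for t :: "nat \<Rightarrow> real"
    using assms(2) by (simp add: if_distrib[of "\<lambda>a. b ^ a" for b] cong: if_cong)
  have "(\<Sum>l\<le>n. w l * (?m l * (\<Prod>i\<le>n. t i ^ (?m(l := ?m l - 1)) i))) = (\<Sum>l\<le>n. if l = j then w l else 0)"
    for t :: "nat \<Rightarrow> real"
  proof (rule sum.cong[OF refl])
    fix l
    have "?m(j := 0) = (\<lambda>_. 0)" by auto
    then show "w l * (?m l * (\<Prod>i\<le>n. t i ^ (?m(l := ?m l - 1)) i)) = (if l = j then w l else 0)"
      by (cases "l = j") simp_all
  qed
  then have 2: "(\<Sum>l\<le>n. w l * (?m l * (\<Prod>i\<le>n. t i ^ (?m(l := ?m l - 1)) i))) = w j"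
    for t :: "nat \<Rightarrow> real"
    using assms(2) by simp
  from poly_deriv_mult_monomial[OF assms(1), of ?m] show ?thesis unfolding 1 2 .
qed

end

text \<open>The product rule for a pairing \<open>G\<close> that is linear in its first argument and polynomial in \<open>t\<close>. By
  induction on \<open>y\<close> the first argument becomes a monomial times a constant vector, and the
  pairing becomes the monomial times a polynomial.\<close>

lemma poly_deriv_product:
  fixes G G' :: "'b::ab_group_add \<Rightarrow> (nat \<Rightarrow> real) \<Rightarrow> 'c::ab_group_add"
  assumes "real_subspace rs S" "real_subspace rs' S'"
    and y: "poly_deriv rs S n w y y'"
    and G: "\<And>a. a \<in> S \<Longrightarrow> poly_deriv rs' S' n w (G a) (G' a)"
    and add: "\<And>a b t. a \<in> S \<Longrightarrow> b \<in> S \<Longrightarrow> t \<in> standard_simplex n \<Longrightarrow> G (a + b) t = G a t + G b t"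
      "\<And>a b t. a \<in> S \<Longrightarrow> b \<in> S \<Longrightarrow> t \<in> standard_simplex n \<Longrightarrow> G' (a + b) t = G' a t + G' b t"
    and scale: "\<And>a r t. a \<in> S \<Longrightarrow> t \<in> standard_simplex n \<Longrightarrow> G (rs r a) t = rs' r (G a t)"
      "\<And>a r t. a \<in> S \<Longrightarrow> t \<in> standard_simplex n \<Longrightarrow> G' (rs r a) t = rs' r (G' a t)"
  shows "poly_deriv rs' S' n w (\<lambda>t. G (y t) t) (\<lambda>t. G (y' t) t + G' (y t) t)"
proof -
  interpret S: real_subspace rs S by fact
  interpret S': real_subspace rs' S' by fact
  show ?thesis
    using y
  proof induction
    case (monomial v m)
    from S'.poly_deriv_mult_monomial[OF G[OF monomial]] show ?case
      by (rule poly_deriv.cong) (simp_all add: scale monomial)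
  next
    case (add F F' H H')
    have "F t \<in> S" "H t \<in> S" "F' t \<in> S" "H' t \<in> S" if "t \<in> standard_simplex n" for t
      using S.poly_deriv_in_S[OF add.hyps(1) that] S.poly_deriv_in_S[OF add.hyps(2) that] by auto
    with poly_deriv.add[OF add.IH] show ?case
      by (elim poly_deriv.cong) (simp_all add: assms(5,6) algebra_simps)
  next
    case (cong F F' H H')
    from cong.IH show ?case
      by (rule poly_deriv.cong) (simp_all add: cong.hyps)
  qed
qed

text \<open>The strictly increasing enumeration of the natural numbers other than \<open>l\<close>.\<close>

definition skip :: "nat \<Rightarrow> nat \<Rightarrow> nat"
  where "skip l j = (if j < l then j else Suc j)"

lemma atMost_Suc_eq_insert_skip:
  assumes "l \<le> Suc p"
  shows "{..Suc p} = insert l (skip l ` {..p})" "l \<notin> skip l ` {..p}" "inj_on (skip l) {..p}"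
proof -
  have "j \<in> insert l (skip l ` {..p})" if "j \<le> Suc p" for j
  proof (cases j l rule: linorder_cases)
    case less
    then have "j = skip l j" "j \<le> p" using assms by (auto simp: skip_def)
    then show ?thesis by blast
  next
    case greater
    then have "j = skip l (j - 1)" "j - 1 \<le> p" using that by (auto simp: skip_def)
    then show ?thesis by blast
  qed simp
  then show "{..Suc p} = insert l (skip l ` {..p})"
    using assms by (auto simp: skip_def split: if_splits)
  show "l \<notin> skip l ` {..p}" "inj_on (skip l) {..p}"
    by (auto simp: skip_def inj_on_def split: if_splits)
qed

lemma (in comm_monoid_set) atMost_Suc_skip:
  assumes "l \<le> Suc p"
  shows "F g {..Suc p} = f (g l) (F (g \<circ> skip l) {..p})"
  using atMost_Suc_eq_insert_skip[OF assms] by (simp add: reindex)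

lemma skip_neq: "skip l j \<noteq> l"
  by (simp add: skip_def)

lemma simplical_face_skip: "simplical_face l t (skip l j) = t j" "simplical_face l t l = 0"
  by (simp_all add: simplical_face_def skip_def)

text \<open>The direction from the vertex \<open>0\<close> to the vertex \<open>i\<close>, in barycentric coordinates. It
  is \<open>0\<close> for \<open>i = 0\<close>.\<close>

definition edge_direction :: "nat \<Rightarrow> nat \<Rightarrow> real"
  where "edge_direction i j = of_bool (j = i) - of_bool (j = 0)"

context poly_integration
begin

text \<open>Both sides are additive, so \<open>F\<close> may be a monomial with exponent \<open>m\<close>. With
  \<open>J = \<Prod>\<^sub>j m\<^sub>j! / (p + \<Sum>\<^sub>j m\<^sub>j)!\<close>, the partial derivative by \<open>t\<^sub>j\<close> integrates to \<open>J\<close> over the simplex of dimension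
  \<open>Suc p\<close> if \<open>m\<^sub>j > 0\<close> and to \<open>0\<close> otherwise, while the monomial integrates to \<open>J\<close> over the face
  \<open>t\<^sub>j = 0\<close> if \<open>m\<^sub>j = 0\<close> and to \<open>0\<close> otherwise. Hence derivative and face add up to \<open>J\<close> for every \<open>j\<close>,
  and the difference of the derivatives for \<open>i\<close> and \<open>0\<close> is the difference of the faces for \<open>0\<close>
  and \<open>i\<close>.\<close>

theorem stokes_simplex:
  assumes "poly_deriv (\<lambda>r. sv (of_real r)) UNIV (Suc p) (edge_direction i) F F'"
    and i: "1 \<le> i" "i \<le> Suc p"
  shows "\<exists>a b. has_poly_simplex_integral sv p (\<lambda>t. F (simplical_face 0 t)) a
    \<and> has_poly_simplex_integral sv p (\<lambda>t. F (simplical_face i t)) b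
    \<and> has_poly_simplex_integral sv (Suc p) F' (a - b)"
  using assms(1)
proof induction
  case (monomial v m)
  define J :: real where "J = (\<Prod>j\<le>Suc p. fact (m j)) / fact (p + (\<Sum>j\<le>Suc p. m j))"
  have face: "has_poly_simplex_integral sv p (\<lambda>t. sv (of_real (\<Prod>j\<le>Suc p. simplical_face l t j ^ m j)) v)
      (sv (of_real (of_bool (m l = 0) * J)) v)" if l: "l \<le> Suc p" for l
  proof -
    have eq: "(\<Prod>j\<le>Suc p. simplical_face l t j ^ m j) = of_bool (m l = 0) * (\<Prod>j\<le>p. t j ^ (m \<circ> skip l) j)"
      for t :: "nat \<Rightarrow> real"
      unfolding prod.atMost_Suc_skip[OF l] by (simp add: simplical_face_skip)
    show ?thesis
    proof (cases "m l = 0")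
      case True
      have "simplex_integral p (\<lambda>t. \<Prod>j\<le>p. t j ^ (m \<circ> skip l) j) = J"
        unfolding simplex_integral_monomial J_def prod.atMost_Suc_skip[OF l] sum.atMost_Suc_skip[OF l]
        by (simp add: True)
      with has_poly_simplex_integral_monomial[of p "m \<circ> skip l" v] show ?thesis
        unfolding eq by (simp only: True simp_thms of_bool_eq mult_1_left)
    next
      case False
      then show ?thesis unfolding eq by (simp add: has_poly_simplex_integral_zero)
    qed
  qed
  have lower: "m j * simplex_integral (Suc p) (\<lambda>t. \<Prod>i\<le>Suc p. t i ^ (m(j := m j - 1)) i)
      = of_bool (m j \<noteq> 0) * J" if j: "j \<le> Suc p" for j
  proof (cases "m j")
    case (Suc a)
    have "(\<Sum>i\<le>Suc p. m i) = Suc (\<Sum>i\<le>Suc p. (m(j := m j - 1)) i)"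
      unfolding sum.atMost_Suc_skip[OF j] by (simp add: Suc skip_neq)
    moreover have "(\<Prod>i\<le>Suc p. fact (m i)) = m j * (\<Prod>i\<le>Suc p. fact ((m(j := m j - 1)) i) :: real)"
      unfolding prod.atMost_Suc_skip[OF j] by (simp add: Suc skip_neq)
    ultimately show ?thesis
      unfolding simplex_integral_monomial J_def by (simp add: Suc del: prod.atMost_Suc sum.atMost_Suc)
  qed simp
  let ?I = "\<lambda>j. simplex_integral (Suc p) (\<lambda>t. \<Prod>l\<le>Suc p. t l ^ (m(j := m j - 1)) l)"
  let ?D = "\<lambda>t :: nat \<Rightarrow> real. \<Sum>j\<le>Suc p. edge_direction i j * (m j * (\<Prod>l\<le>Suc p. t l ^ (m(j := m j - 1)) l))"
  have "(\<Sum>j\<le>Suc p. edge_direction i j * (m j * ?I j)) = (\<Sum>j\<le>Suc p. edge_direction i j * (of_bool (m j \<noteq> 0) * J))"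
    by (intro sum.cong refl) (simp only: lower atMost_iff)
  also have "\<dots> = (\<Sum>j\<le>Suc p. if j = i then of_bool (m j \<noteq> 0) * J else 0)
      - (\<Sum>j\<le>Suc p. if j = 0 then of_bool (m j \<noteq> 0) * J else 0)"
    unfolding sum_subtractf[symmetric] by (intro sum.cong refl) (auto simp: edge_direction_def)
  also have "\<dots> = of_bool (m i \<noteq> 0) * J - of_bool (m 0 \<noteq> 0) * J"
    using i by (simp add: sum.delta' del: sum.atMost_Suc)
  also have "\<dots> = of_bool (m 0 = 0) * J - of_bool (m i = 0) * J"
    by simp
  finally have total: "(\<Sum>j\<le>Suc p. edge_direction i j * (m j * ?I j)) = of_bool (m 0 = 0) * J - of_bool (m i = 0) * J" .
  have "has_poly_simplex_integral sv (Suc p)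
      (\<lambda>t. \<Sum>j\<le>Suc p. sv (of_real (edge_direction i j * m j))
        (sv (of_real (\<Prod>l\<le>Suc p. t l ^ (m(j := m j - 1)) l)) v))
      (\<Sum>j\<le>Suc p. sv (of_real (edge_direction i j * m j)) (sv (of_real (?I j)) v))"
    by (intro has_poly_simplex_integral_sum has_poly_simplex_integral_scale has_poly_simplex_integral_monomial)
  then have "has_poly_simplex_integral sv (Suc p) (\<lambda>t. sv (of_real (?D t)) v)
      (sv (of_real (\<Sum>j\<le>Suc p. edge_direction i j * (m j * ?I j))) v)"
    by (simp only: scale_scale of_real_mult[symmetric] mult.assoc scale_sum_left[symmetric] of_real_sum[symmetric])
  then have edge: "has_poly_simplex_integral sv (Suc p) (\<lambda>t. sv (of_real (?D t)) v)
      (sv (of_real (of_bool (m 0 = 0) * J)) v - sv (of_real (of_bool (m i = 0) * J)) v)"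
    unfolding total of_real_diff scale_left_diff_distrib .
  show ?case
    by (rule exI, rule exI, intro conjI, rule face[OF le0], rule face[OF i(2)], rule edge)
next
  case (add F F' G G')
  then obtain a b a' b' where *:
    "has_poly_simplex_integral sv p (\<lambda>t. F (simplical_face 0 t)) a"
    "has_poly_simplex_integral sv p (\<lambda>t. F (simplical_face i t)) b"
    "has_poly_simplex_integral sv (Suc p) F' (a - b)"
    "has_poly_simplex_integral sv p (\<lambda>t. G (simplical_face 0 t)) a'"
    "has_poly_simplex_integral sv p (\<lambda>t. G (simplical_face i t)) b'"
    "has_poly_simplex_integral sv (Suc p) G' (a' - b')"
    by blast
  have sub: "(a + a') - (b + b') = (a - b) + (a' - b')" by simp
  show ?case
    by (rule exI, rule exI, intro conjI, rule has_poly_simplex_integral_add[OF *(1,4)],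
        rule has_poly_simplex_integral_add[OF *(2,5)], unfold sub, rule has_poly_simplex_integral_add[OF *(3,6)])
next
  case (cong F F' G G')
  have "simplical_face l t \<in> standard_simplex (Suc p)" if "l \<le> Suc p" "t \<in> standard_simplex p" for l and t :: "nat \<Rightarrow> real"
    using simplical_face_in_standard_simplex[of "Suc p" l t] that by simp
  note on_face = cong.hyps(2)[OF this]
  obtain a b where *:
    "has_poly_simplex_integral sv p (\<lambda>t. F (simplical_face 0 t)) a"
    "has_poly_simplex_integral sv p (\<lambda>t. F (simplical_face i t)) b"
    "has_poly_simplex_integral sv (Suc p) F' (a - b)"
    using cong.IH by blast
  show ?case
    by (rule exI, rule exI, intro conjI, rule has_poly_simplex_integral_cong[OF *(1) on_face[OF le0]], assumption,
        rule has_poly_simplex_integral_cong[OF *(2) on_face[OF i(2)]], assumption,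
        rule has_poly_simplex_integral_cong[OF *(3) cong.hyps(3)], assumption)
qed

end

section \<open>Derivatives of wedge products along the simplex\<close>

lemma apply_blocks_eq_map:
  "apply_blocks \<phi>s ys
    = map (\<lambda>i. snd (\<phi>s ! i) (take (fst (\<phi>s ! i)) (drop (total_degree (take i \<phi>s)) ys))) [0..<length \<phi>s]"
proof (induction \<phi>s arbitrary: ys)
  case (Cons p\<phi> \<phi>s)
  obtain p \<phi> where "p\<phi> = (p, \<phi>)" by force
  then show ?case
    by (simp add: Cons.IH upt_conv_Cons map_Suc_upt[symmetric] o_def add.commute del: upt_Suc)
qed simp

text \<open>Over a real normed field the simplex parameters act through \<open>of_real\<close>, and polynomials
  in them have values in the real vector spaces underlying the kernel and the module.\<close>

locale real_invariant_form = invariant_form sh brh sg brg q sv act k f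
  for sh :: "'k::real_normed_field \<Rightarrow> 'h::ab_group_add \<Rightarrow> 'h"
    and brh :: "'h \<Rightarrow> 'h \<Rightarrow> 'h"
    and sg :: "'k \<Rightarrow> 'g::ab_group_add \<Rightarrow> 'g"
    and brg :: "'g \<Rightarrow> 'g \<Rightarrow> 'g"
    and q :: "'h \<Rightarrow> 'g"
    and sv :: "'k \<Rightarrow> 'v::ab_group_add \<Rightarrow> 'v"
    and act :: "'g \<Rightarrow> 'v \<Rightarrow> 'v"
    and k :: nat and f :: "'h list \<Rightarrow> 'v"
begin

sublocale I: poly_integration sv
  by unfold_locales

abbreviation rh :: "real \<Rightarrow> 'h \<Rightarrow> 'h" where "rh r \<equiv> sh (of_real r)"
abbreviation rv :: "real \<Rightarrow> 'v \<Rightarrow> 'v" where "rv r \<equiv> sv (of_real r)"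

abbreviation "deriv_h \<equiv> poly_deriv rh (ext_kernel q)"
abbreviation "deriv_v \<equiv> poly_deriv rv UNIV"

lemma real_subspace_kernel: "real_subspace rh (ext_kernel q)"
proof -
  interpret vector_space rh
    by unfold_locales (simp_all add: E.H.scale_right_distrib E.H.scale_left_distrib)
  show ?thesis
    by unfold_locales (auto simp: subspace_def kernel_intros)
qed

lemma real_subspace_UNIV: "real_subspace rv UNIV"
proof -
  interpret vector_space rv
    by unfold_locales (simp_all add: M.V.scale_right_distrib M.V.scale_left_distrib)
  show ?thesis
    by unfold_locales (rule subspace_UNIV)
qed

sublocale RH: real_subspace rh "ext_kernel q" by (rule real_subspace_kernel)
sublocale RV: real_subspace rv UNIV by (rule real_subspace_UNIV)

lemma deriv_v_scale:
  assumes "deriv_v n w F F'"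
  shows "deriv_v n w (\<lambda>t. sv c (F t)) (\<lambda>t. sv c (F' t))"
  using poly_deriv_linear[OF assms RV.vector_space_axioms RV.subspace_S RV.vector_space_axioms, of "sv c" UNIV]
  by (simp add: M.V.scale_right_distrib mult.commute)

lemma deriv_v_alternation:
  assumes "\<And>ys. deriv_v n w (\<lambda>t. g t ys) (\<lambda>t. g' t ys)"
  shows "deriv_v n w (\<lambda>t. alternation sv N (g t) xs) (\<lambda>t. alternation sv N (g' t) xs)"
  using assms
proof (induction N arbitrary: g g' xs)
  case (Suc N)
  show ?case
    unfolding alternation.simps
    by (intro RV.poly_deriv_sum deriv_v_scale Suc.IH Suc.prems)
qed simp

lemma deriv_v_has_integral:
  assumes "deriv_v n w F F'"
  shows "\<exists>v. has_poly_simplex_integral sv n F v"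
  using assms
proof induction
  case (monomial v m)
  show ?case by (rule exI, rule I.has_poly_simplex_integral_monomial)
next
  case (add F F' G G')
  then obtain a b where "has_poly_simplex_integral sv n F a" "has_poly_simplex_integral sv n G b" by blast
  then have "has_poly_simplex_integral sv n (\<lambda>t. F t + G t) (a + b)"
    by (rule I.has_poly_simplex_integral_add)
  then show ?case by blast
next
  case (cong F F' G G')
  then obtain a where a: "has_poly_simplex_integral sv n F a" by blast
  have "has_poly_simplex_integral sv n G a"
    by (rule has_poly_simplex_integral_cong[OF a]) (rule cong.hyps)
  then show ?case by blast
qed

text \<open>The product rule for \<open>f\<close> itself, by induction on the number of arguments that depend on \<open>t\<close>; the
  arguments \<open>ps\<close> are constant.\<close>

lemma deriv_v_f:
  assumes "length ps + length Y = k" "set ps \<subseteq> ext_kernel q"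
    and "\<And>y y'. (y, y') \<in> set Y \<Longrightarrow> deriv_h n w y y'"
  shows "deriv_v n w (\<lambda>t. f (ps @ map (\<lambda>y. fst y t) Y))
    (\<lambda>t. \<Sum>i<length Y. f (ps @ (map (\<lambda>y. fst y t) Y)[i := snd (Y ! i) t]))"
  using assms
proof (induction Y arbitrary: ps)
  case Nil
  show ?case using RV.poly_deriv_const[of "f ps"] by simp
next
  case (Cons yy Y)
  obtain y y' where yy: "yy = (y, y')" by force
  have y: "deriv_h n w y y'" by (rule Cons.prems(3)) (simp add: yy)
  define G where "G a t = f (ps @ a # map (\<lambda>y. fst y t) Y)" for a t
  define G' where "G' a t = (\<Sum>i<length Y. f (ps @ a # (map (\<lambda>y. fst y t) Y)[i := snd (Y ! i) t]))" for a t
  have Y: "fst z t \<in> ext_kernel q" "snd z t \<in> ext_kernel q" if "z \<in> set Y" "t \<in> standard_simplex n" for z t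
    using RH.poly_deriv_in_S[OF Cons.prems(3)[of "fst z" "snd z"] that(2)] that(1) by auto
  have len: "length ps + length zs + 1 = k" if "length zs = length Y" for zs :: "'h list"
    using Cons.prems(1) that by simp
  have S1: "set (map (\<lambda>y. fst y t) Y) \<subseteq> ext_kernel q" if "t \<in> standard_simplex n" for t
    using Y(1)[OF _ that] by auto
  have S2: "set ((map (\<lambda>y. fst y t) Y)[i := snd (Y ! i) t]) \<subseteq> ext_kernel q"
    if "t \<in> standard_simplex n" "i < length Y" for t i
    using S1[OF that(1)] Y(2)[OF nth_mem[OF that(2)] that(1)]
    by (meson insert_subset order_trans set_update_subset_insert)
  have "deriv_v n w (\<lambda>t. G (y t) t) (\<lambda>t. G (y' t) t + G' (y t) t)"
  proof (rule poly_deriv_product[OF real_subspace_kernel real_subspace_UNIV y])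
    fix a assume "a \<in> ext_kernel q"
    then show "deriv_v n w (G a) (G' a)"
      using Cons.IH[of "ps @ [a]"] Cons.prems by (simp add: G_def[abs_def] G'_def[abs_def])
  next
    fix a b and r :: real and t assume a: "a \<in> ext_kernel q" and t: "t \<in> standard_simplex n"
    show "G (rh r a) t = rv r (G a t)"
      unfolding G_def by (rule f_scale[OF len Cons.prems(2) S1[OF t] a]) simp
    show "G' (rh r a) t = rv r (G' a t)"
      unfolding G'_def M.V.scale_sum_right
      by (intro sum.cong refl f_scale[OF len Cons.prems(2) S2[OF t] a]) auto
    assume b: "b \<in> ext_kernel q"
    show "G (a + b) t = G a t + G b t"
      unfolding G_def by (rule f_add[OF len Cons.prems(2) S1[OF t] a b]) simp
    show "G' (a + b) t = G' a t + G' b t"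
      unfolding G'_def sum.distrib[symmetric]
      by (intro sum.cong refl f_add[OF len Cons.prems(2) S2[OF t] a b]) auto
  qed
  then show ?case
    unfolding G_def G'_def yy by (simp add: sum.lessThan_Suc_shift del: sum.lessThan_Suc)
qed

lemma deriv_v_wedge:
  assumes len: "\<And>t. map fst (\<Phi> t) = ps" "length ps = k"
    and deriv: "\<And>i zs. i < k \<Longrightarrow> deriv_h n w (\<lambda>t. snd (\<Phi> t ! i) zs) (\<lambda>t. \<Phi>' i t zs)"
  shows "deriv_v n w (\<lambda>t. wedge (\<Phi> t) xs)
    (\<lambda>t. \<Sum>i<k. wedge ((\<Phi> t)[i := (ps ! i, \<Phi>' i t)]) xs)"
proof -
  have len\<Phi>: "length (\<Phi> t) = k" for t
    using len by (metis length_map)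
  have fst\<Phi>: "fst (\<Phi> t ! i) = ps ! i" if "i < k" for t i
    using that len\<Phi>[of t] by (simp flip: len(1)[of t])
  have upd: "map fst ((\<Phi> t)[i := (ps ! i, \<psi>)]) = ps" for t i \<psi>
    by (simp add: map_update len)
  define seg where "seg ys i = take (ps ! i) (drop (sum_list (take i ps)) ys)" for ys :: "'g list" and i
  have blocks: "apply_blocks \<phi>s ys = map (\<lambda>i. snd (\<phi>s ! i) (seg ys i)) [0..<k]"
    if "map fst \<phi>s = ps" for \<phi>s :: "(nat \<times> ('g list \<Rightarrow> 'h)) list" and ys
  proof -
    have "length \<phi>s = k" using that len(2) by (metis length_map)
    moreover have "fst (\<phi>s ! i) = ps ! i" "total_degree (take i \<phi>s) = sum_list (take i ps)"
      if "i < k" for i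
      using that calculation \<open>map fst \<phi>s = ps\<close> by (auto simp: take_map)
    ultimately show ?thesis unfolding apply_blocks_eq_map by (auto simp: seg_def)
  qed
  define N where "N = sum_list ps"
  have "deriv_v n w (\<lambda>t. alternation sv N (\<lambda>ys. f (apply_blocks (\<Phi> t) ys)) xs)
    (\<lambda>t. alternation sv N (\<lambda>ys. \<Sum>i<k. f (apply_blocks ((\<Phi> t)[i := (ps ! i, \<Phi>' i t)]) ys)) xs)"
  proof (rule deriv_v_alternation)
    fix ys
    let ?Y = "map (\<lambda>i. (\<lambda>t. snd (\<Phi> t ! i) (seg ys i), \<lambda>t. \<Phi>' i t (seg ys i))) [0..<k]"
    have "deriv_v n w (\<lambda>t. f ([] @ map (\<lambda>y. fst y t) ?Y))
        (\<lambda>t. \<Sum>i<length ?Y. f ([] @ (map (\<lambda>y. fst y t) ?Y)[i := snd (?Y ! i) t]))"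
      by (rule deriv_v_f) (auto simp: deriv)
    moreover have "f ([] @ map (\<lambda>y. fst y t) ?Y) = f (apply_blocks (\<Phi> t) ys)" for t
      by (simp add: blocks[OF len(1)] o_def)
    moreover have "(map (\<lambda>y. fst y t) ?Y)[i := snd (?Y ! i) t] = apply_blocks ((\<Phi> t)[i := (ps ! i, \<Phi>' i t)]) ys"
      if "i < k" for t i
      unfolding blocks[OF upd] using that
      by (intro nth_equalityI) (auto simp: nth_list_update len\<Phi>)
    ultimately show "deriv_v n w (\<lambda>t. f (apply_blocks (\<Phi> t) ys))
        (\<lambda>t. \<Sum>i<k. f (apply_blocks ((\<Phi> t)[i := (ps ! i, \<Phi>' i t)]) ys))"
      by simp
  qed
  then show ?thesis
    unfolding wedge_def len(1) upd N_def[symmetric] M.V.alternation_sum .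
qed

end

section \<open>The boundary of the simplex and the variation of the curvature\<close>

context invariant_form
begin

lemma wedge_move_one_form:
  assumes "length as + length bs + length cs + 1 + length \<Psi> = k"
    and ker: "\<And>\<alpha> ys. \<alpha> \<in> set as \<union> set bs \<union> set cs \<Longrightarrow> \<alpha> ys \<in> ext_kernel q" "kernel_valued \<Psi>"
    and \<gamma>: "\<And>ys. \<gamma> ys \<in> ext_kernel q"
    and xs: "length xs = length as + length bs + length cs + 1 + total_degree \<Psi>"
  shows "wedge (degree_one (as @ bs @ \<gamma> # cs) @ \<Psi>) xs
    = sv ((-1) ^ length bs) (wedge (degree_one (as @ \<gamma> # bs @ cs) @ \<Psi>) xs)"
  using assms
proof (induction bs arbitrary: as)
  case Nil
  then show ?case by simp
next
  case (Cons b bs)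
  have "wedge (degree_one (as @ (b # bs) @ \<gamma> # cs) @ \<Psi>) xs
      = sv ((-1) ^ length bs) (wedge (degree_one as @ (1, b) # (1, \<gamma>) # (degree_one (bs @ cs) @ \<Psi>)) xs)"
    using Cons.IH[of "as @ [b]"] Cons.prems by simp
  also have "wedge (degree_one as @ (1, b) # (1, \<gamma>) # (degree_one (bs @ cs) @ \<Psi>)) xs
      = sv ((-1) ^ (1 * 1)) (wedge (degree_one as @ (1, \<gamma>) # (1, b) # (degree_one (bs @ cs) @ \<Psi>)) xs)"
    by (rule wedge_exchange) (use Cons.prems in auto)
  finally show ?case by simp
qed

lemma wedge_repeated_one_form:
  assumes "length as + length bs + length cs + 2 + length \<Psi> = k"
    and ker: "\<And>\<alpha> ys. \<alpha> \<in> set as \<union> set bs \<union> set cs \<Longrightarrow> \<alpha> ys \<in> ext_kernel q" "kernel_valued \<Psi>"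
    and \<gamma>: "\<And>ys. \<gamma> ys \<in> ext_kernel q"
    and xs: "length xs = length as + length bs + length cs + 2 + total_degree \<Psi>"
  shows "wedge (degree_one (as @ \<gamma> # bs @ \<gamma> # cs) @ \<Psi>) xs = 0"
proof -
  define W where "W = wedge (degree_one as @ (1, \<gamma>) # (1, \<gamma>) # (degree_one (bs @ cs) @ \<Psi>)) xs"
  have "W = sv ((-1) ^ (1 * 1)) W"
    unfolding W_def by (rule wedge_exchange) (use assms in auto)
  then have "W = - W" by simp
  then have "W + W = 0" by (rule eq_neg_iff_add_eq_0[THEN iffD1])
  then have "sv 2 W = 0"
    using M.V.scale_left_distrib[of 1 1 W] by simp
  then have "W = 0" by simp
  moreover have "wedge (degree_one (as @ \<gamma> # bs @ \<gamma> # cs) @ \<Psi>) xs = sv ((-1) ^ length bs) W"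
    using wedge_move_one_form[of "as @ [\<gamma>]" bs cs \<Psi> \<gamma> xs] assms by (auto simp: W_def)
  ultimately show ?thesis by simp
qed

text \<open>Expanding the differences from the left: once \<open>\<gamma>\<close> has been chosen in one place, every further \<open>\<gamma>\<close>
  gives \<open>0\<close>, so only the terms with at most one \<open>\<gamma>\<close> remain. The differences that are already expanded
  are collected in \<open>ps\<close>.\<close>

lemma wedge_subtract_one_form:
  assumes "length ps + length bs + length \<Psi> = k"
    and ker: "\<And>\<alpha> ys. \<alpha> \<in> set ps \<union> set bs \<Longrightarrow> \<alpha> ys \<in> ext_kernel q" "kernel_valued \<Psi>"
    and \<gamma>: "\<And>ys. \<gamma> ys \<in> ext_kernel q"
    and xs: "length xs = length ps + length bs + total_degree \<Psi>"
  shows "wedge (degree_one (ps @ map (\<lambda>b ys. b ys - \<gamma> ys) bs) @ \<Psi>) xs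
    = wedge (degree_one (ps @ bs) @ \<Psi>) xs
      - (\<Sum>i<length bs. wedge (degree_one (ps @ bs[i := \<gamma>]) @ \<Psi>) xs)"
  using assms
proof (induction bs arbitrary: ps)
  case Nil
  then show ?case by simp
next
  case (Cons b bs)
  let ?bs = "map (\<lambda>b ys. b ys - \<gamma> ys) bs"
  have b: "b ys \<in> ext_kernel q" for ys using Cons.prems(2)[of b] by simp
  have tail: "kernel_valued (degree_one ?bs @ \<Psi>)"
    using Cons.prems by (auto intro!: kernel_diff)
  have len: "length (degree_one ps) + length (degree_one ?bs @ \<Psi>) + 1 = k"
    using Cons.prems by simp
  have head: "kernel_valued (degree_one ps)" using Cons.prems by auto
  have "wedge (degree_one (ps @ (\<lambda>ys. b ys - \<gamma> ys) # ?bs) @ \<Psi>) xs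
      = wedge (degree_one ps @ (1, \<lambda>ys. b ys + sh (- 1) (\<gamma> ys)) # (degree_one ?bs @ \<Psi>)) xs"
    by simp
  also have "\<dots> = wedge (degree_one ((ps @ [b]) @ ?bs) @ \<Psi>) xs - wedge (degree_one ((ps @ [\<gamma>]) @ ?bs) @ \<Psi>) xs"
    by (subst wedge_slot_add[OF len head tail b], simp add: \<gamma> kernel_intros)
      (subst wedge_slot_scale[OF len head tail \<gamma>], simp)
  also have "wedge (degree_one ((ps @ [b]) @ ?bs) @ \<Psi>) xs = wedge (degree_one (ps @ b # bs) @ \<Psi>) xs
      - (\<Sum>i<length bs. wedge (degree_one (ps @ b # bs[i := \<gamma>]) @ \<Psi>) xs)"
    using Cons.IH[of "ps @ [b]"] Cons.prems by simp
  also have "wedge (degree_one ((ps @ [\<gamma>]) @ ?bs) @ \<Psi>) xs = wedge (degree_one (ps @ \<gamma> # bs) @ \<Psi>) xs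
      - (\<Sum>i<length bs. wedge (degree_one (ps @ \<gamma> # bs[i := \<gamma>]) @ \<Psi>) xs)"
    using Cons.IH[of "ps @ [\<gamma>]"] Cons.prems by auto
  also have "(\<Sum>i<length bs. wedge (degree_one (ps @ \<gamma> # bs[i := \<gamma>]) @ \<Psi>) xs) = 0"
  proof (rule sum.neutral, rule ballI)
    fix i assume "i \<in> {..<length bs}"
    then have i: "i < length bs" by simp
    then have "bs[i := \<gamma>] = take i bs @ \<gamma> # drop (Suc i) bs" by (rule upd_conv_take_nth_drop)
    moreover have "wedge (degree_one (ps @ \<gamma> # take i bs @ \<gamma> # drop (Suc i) bs) @ \<Psi>) xs = 0"
      using i Cons.prems
      by (intro wedge_repeated_one_form) (auto dest!: in_set_takeD in_set_dropD)
    ultimately show "wedge (degree_one (ps @ \<gamma> # bs[i := \<gamma>]) @ \<Psi>) xs = 0" by simp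
  qed
  finally show ?case
    by (simp add: sum.lessThan_Suc_shift algebra_simps del: sum.lessThan_Suc)
qed

text \<open>Passing from the one-forms \<open>\<gamma>, b\<^sub>2, \<dots>, b\<^sub>n\<close> relative to one base point to the differences
  \<open>b\<^sub>j - \<gamma>\<close> relative to another: a single \<open>\<gamma>\<close> in the \<open>j\<close>-th place is moved to the front and
  acquires the sign of an alternating omission.\<close>

theorem wedge_change_base_point:
  assumes "length bs + length \<Psi> = k"
    and ker: "\<And>\<alpha> ys. \<alpha> \<in> set bs \<Longrightarrow> \<alpha> ys \<in> ext_kernel q" "kernel_valued \<Psi>"
    and \<gamma>: "\<And>ys. \<gamma> ys \<in> ext_kernel q"
    and xs: "length xs = length bs + total_degree \<Psi>"
  shows "wedge (degree_one (map (\<lambda>b ys. b ys - \<gamma> ys) bs) @ \<Psi>) xs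
    = (\<Sum>i<Suc (length bs). sv ((-1) ^ i)
        (wedge (degree_one (take i (\<gamma> # bs) @ drop (Suc i) (\<gamma> # bs)) @ \<Psi>) xs))"
proof -
  have "wedge (degree_one (bs[i := \<gamma>]) @ \<Psi>) xs
      = sv ((-1) ^ i) (wedge (degree_one (\<gamma> # take i bs @ drop (Suc i) bs) @ \<Psi>) xs)"
    if i: "i < length bs" for i
  proof -
    have "bs[i := \<gamma>] = take i bs @ \<gamma> # drop (Suc i) bs" using i by (rule upd_conv_take_nth_drop)
    moreover have "wedge (degree_one ([] @ take i bs @ \<gamma> # drop (Suc i) bs) @ \<Psi>) xs
        = sv ((-1) ^ length (take i bs)) (wedge (degree_one ([] @ \<gamma> # take i bs @ drop (Suc i) bs) @ \<Psi>) xs)"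
      using i assms by (intro wedge_move_one_form) (auto dest!: in_set_takeD in_set_dropD)
    ultimately show ?thesis using i by (simp add: min_def)
  qed
  then show ?thesis
    using wedge_subtract_one_form[of "[]" bs \<Psi> \<gamma> xs] assms
    by (simp add: sum.lessThan_Suc_shift sum_negf del: sum.lessThan_Suc)
qed

end

context real_invariant_form
begin

text \<open>Besides the affine combinations of sections (coefficient sum \<open>1\<close>) this covers their derivatives
  along the simplex (coefficient sum \<open>0\<close>).\<close>

definition combination :: "('g \<Rightarrow> 'h) list \<Rightarrow> (nat \<Rightarrow> real) \<Rightarrow> 'g \<Rightarrow> 'h"
  where "combination \<sigma>s u x = (\<Sum>a<length \<sigma>s. rh (u a) ((\<sigma>s ! a) x))"

lemma affine_section_eq_combination: "affine_section sh \<sigma>s t = combination \<sigma>s t"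
  by (simp add: affine_section_def combination_def fun_eq_iff)

lemma combination_edge_direction:
  assumes "i < length \<sigma>s"
  shows "combination \<sigma>s (edge_direction i) (xs ! 0) = section_diff \<sigma>s i xs"
proof -
  have "combination \<sigma>s (edge_direction i) (xs ! 0)
      = (\<Sum>a<length \<sigma>s. (if a = i then (\<sigma>s ! a) (xs ! 0) else 0) - (if a = 0 then (\<sigma>s ! a) (xs ! 0) else 0))"
    unfolding combination_def by (intro sum.cong refl) (auto simp: edge_direction_def)
  also have "\<dots> = section_diff \<sigma>s i xs"
    using assms by (auto simp: sum_subtractf section_diff_def)
  finally show ?thesis .
qed

lemma combination_pairing:
  "(\<Sum>a<length \<sigma>s. \<Sum>b<length \<sigma>s. rh (u a) (rh (v b) (brh ((\<sigma>s ! a) x) ((\<sigma>s ! b) y) - (\<sigma>s ! a) z)))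
    = brh (combination \<sigma>s u x) (combination \<sigma>s v y) - rh (\<Sum>b<length \<sigma>s. v b) (combination \<sigma>s u z)"
proof -
  interpret L: Vector_Spaces.linear sh sh "\<lambda>a. brh a b" for b by (rule E.H.br_linear_left)
  interpret R: Vector_Spaces.linear sh sh "brh a" for a by (rule E.H.br_linear_right)
  have "brh (combination \<sigma>s u x) (combination \<sigma>s v y)
      = (\<Sum>a<length \<sigma>s. \<Sum>b<length \<sigma>s. rh (u a) (rh (v b) (brh ((\<sigma>s ! a) x) ((\<sigma>s ! b) y))))"
    unfolding combination_def L.sum L.scale R.sum R.scale E.H.scale_sum_right
    by (subst sum.swap) (intro sum.cong refl E.H.scale_left_commute)
  moreover have "rh (\<Sum>b<length \<sigma>s. v b) (combination \<sigma>s u z)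
      = (\<Sum>a<length \<sigma>s. \<Sum>b<length \<sigma>s. rh (u a) (rh (v b) ((\<sigma>s ! a) z)))"
    by (simp add: combination_def E.H.scale_sum_right E.H.scale_sum_left sum_distrib_left mult.commute)
  ultimately show ?thesis
    by (simp add: sum_subtractf E.H.scale_right_diff_distrib)
qed

lemma linear_section_affine_section:
  assumes "length \<sigma>s = n + 1" "\<forall>s\<in>set \<sigma>s. linear_section sh sg q s" "t \<in> standard_simplex n"
  shows "linear_section sh sg q (affine_section sh \<sigma>s t)"
proof -
  have sec: "Vector_Spaces.linear sg sh (\<sigma>s ! a)" "q ((\<sigma>s ! a) x) = x" if "a < length \<sigma>s" for a x
    using assms(2) nth_mem[OF that] by (auto simp: linear_section_def)
  have add: "(\<sigma>s ! a) (x + y) = (\<sigma>s ! a) x + (\<sigma>s ! a) y" and scale: "(\<sigma>s ! a) (sg c x) = sh c ((\<sigma>s ! a) x)"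
    if "a < length \<sigma>s" for a x y c
    using sec(1)[OF that] by (simp_all add: Vector_Spaces.linear_iff)
  have "(\<Sum>i<length \<sigma>s. t i) = 1"
    using assms(1,3) by (simp add: standard_simplex_def lessThan_Suc_atMost)
  then have "q (affine_section sh \<sigma>s t x) = x" for x
    by (simp add: affine_section_def Q.sum Q.scale sec E.G.scale_sum_left[symmetric] of_real_sum[symmetric] del: of_real_sum)
  moreover have "Vector_Spaces.linear sg sh (affine_section sh \<sigma>s t)"
    unfolding Vector_Spaces.linear_iff
    by (auto simp: E.G.vector_space_axioms E.H.vector_space_axioms affine_section_def add scale
        sum.distrib E.H.scale_right_distrib E.H.scale_sum_right mult.commute)
  ultimately show ?thesis by (simp add: linear_section_def)
qed

lemma section_diff_in_kernel:
  assumes "\<forall>s\<in>set \<sigma>s. linear_section sh sg q s" "i < length \<sigma>s"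
  shows "section_diff \<sigma>s i ys \<in> ext_kernel q"
proof -
  have "q ((\<sigma>s ! a) x) = x" if "a < length \<sigma>s" for a x
    using assms(1) nth_mem[OF that] by (auto simp: linear_section_def)
  moreover have "0 < length \<sigma>s" using assms(2) by linarith
  ultimately show ?thesis
    using assms(2) by (simp add: section_diff_def ext_kernel_def Q.diff)
qed

text \<open>The curvature of \<open>\<sigma>\<^sub>t\<close> is written as the quadratic form \<open>\<Sum>\<^sub>a\<^sub>b t\<^sub>a t\<^sub>b C\<^sub>a\<^sub>b\<close> with
  \<open>C\<^sub>a\<^sub>b = [\<sigma>\<^sub>a x, \<sigma>\<^sub>b y] - \<sigma>\<^sub>a [x, y]\<close>. The linear term has been multiplied by \<open>\<Sum>\<^sub>b t\<^sub>b = 1\<close>,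
  which makes all coefficients elements of the kernel. Differentiating each factor in turn gives
  the two brackets of the covariant differential; since the coordinates of the direction sum
  to \<open>0\<close>, the term \<open>\<alpha> [x, y]\<close> appears only once.\<close>

lemma deriv_h_curvature:
  assumes len: "length \<sigma>s = n + 1" and sec: "\<forall>s\<in>set \<sigma>s. linear_section sh sg q s" and i: "i \<le> n"
  shows "deriv_h n (edge_direction i) (\<lambda>t. curvature brh brg (affine_section sh \<sigma>s t) ys)
    (\<lambda>t. covariant_diff (affine_section sh \<sigma>s t) (section_diff \<sigma>s i) ys)"
proof -
  define x y where "x = ys ! 0" and "y = ys ! 1"
  define C where "C a b = brh ((\<sigma>s ! a) x) ((\<sigma>s ! b) y) - (\<sigma>s ! a) (brg x y)" for a b
  let ?w = "edge_direction i" and ?N = "{..<length \<sigma>s}"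
  have C: "C a b \<in> ext_kernel q" if "a \<in> ?N" "b \<in> ?N" for a b
  proof -
    have "q ((\<sigma>s ! a) u) = u" "q ((\<sigma>s ! b) u) = u" for u
      using sec that by (auto simp: linear_section_def)
    then show ?thesis by (simp add: C_def ext_kernel_def Q.diff E.q_br)
  qed
  have "deriv_h n ?w (\<lambda>t. \<Sum>a\<in>?N. \<Sum>b\<in>?N. rh (t a) (rh (t b) (C a b)))
      (\<lambda>t. \<Sum>a\<in>?N. \<Sum>b\<in>?N. rh (?w a) (rh (t b) (C a b)) + rh (t a) (rh (?w b) (C a b) + rh (t b) 0))"
    by (intro RH.poly_deriv_sum RH.poly_deriv_mult_coordinate RH.poly_deriv_const C) (auto simp: len)
  then show ?thesis
  proof (rule poly_deriv.cong)
    fix t assume t: "t \<in> standard_simplex n"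
    have sum_t: "(\<Sum>a\<in>?N. t a) = 1"
      using t len by (simp add: standard_simplex_def lessThan_Suc_atMost)
    have sum_w: "(\<Sum>a\<in>?N. ?w a) = 0"
    proof -
      have "(\<Sum>a\<in>?N. ?w a) = (\<Sum>a\<in>?N. (if a = i then 1 else 0) - (if a = 0 then 1 else 0))"
        by (intro sum.cong refl) (auto simp: edge_direction_def)
      then show ?thesis using i len by (simp add: sum_subtractf)
    qed
    have \<alpha>: "combination \<sigma>s ?w u = section_diff \<sigma>s i [u]" for u
      using combination_edge_direction[of i \<sigma>s "[u]"] i len by simp
    have anti: "brh (combination \<sigma>s t y) u = - brh u (combination \<sigma>s t y)" for u
      by (rule brh_anti)
    show "curvature brh brg (affine_section sh \<sigma>s t) ys = (\<Sum>a\<in>?N. \<Sum>b\<in>?N. rh (t a) (rh (t b) (C a b)))"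
      unfolding C_def combination_pairing
      by (simp add: sum_t curvature_def affine_section_eq_combination x_def y_def)
    show "covariant_diff (affine_section sh \<sigma>s t) (section_diff \<sigma>s i) ys
        = (\<Sum>a\<in>?N. \<Sum>b\<in>?N. rh (?w a) (rh (t b) (C a b)) + rh (t a) (rh (?w b) (C a b) + rh (t b) 0))"
      unfolding C_def sum.distrib E.H.scale_zero_right add_0_right combination_pairing
      by (simp add: sum_t sum_w \<alpha> covariant_diff_def affine_section_eq_combination anti
          flip: x_def y_def One_nat_def)
  qed
qed

text \<open>The \<open>r\<close> curvatures contribute equal terms, because the derivative of any one of them can be
  moved to the first place.\<close>

lemma deriv_v_wedge_curvature:
  assumes len: "length \<sigma>s = n + 1" and sec: "\<forall>s\<in>set \<sigma>s. linear_section sh sg q s" and i: "i \<le> n"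
    and k: "length \<alpha>s + r = k"
    and ker: "\<And>\<alpha> ys. \<alpha> \<in> set \<alpha>s \<Longrightarrow> \<alpha> ys \<in> ext_kernel q"
    and xs: "length xs = length \<alpha>s + 2 * r"
  defines "R t \<equiv> (2::nat, curvature brh brg (affine_section sh \<sigma>s t))"
    and "DR t \<equiv> (2::nat, covariant_diff (affine_section sh \<sigma>s t) (section_diff \<sigma>s i))"
  shows "deriv_v n (edge_direction i) (\<lambda>t. wedge (degree_one \<alpha>s @ replicate r (R t)) xs)
    (\<lambda>t. sv (of_nat r) (wedge (degree_one \<alpha>s @ DR t # replicate (r - 1) (R t)) xs))"
proof -
  let ?\<Phi> = "\<lambda>t. degree_one \<alpha>s @ replicate r (R t)"
  let ?\<Phi>' = "\<lambda>j t. if j < length \<alpha>s then (\<lambda>_. 0) else snd (DR t)"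
  let ?ps = "replicate (length \<alpha>s) 1 @ replicate r 2"
  have ps: "map fst (?\<Phi> t) = ?ps" for t
    by (simp add: R_def degree_one_def o_def map_replicate_const)
  have "deriv_v n (edge_direction i) (\<lambda>t. wedge (?\<Phi> t) xs)
      (\<lambda>t. \<Sum>j<k. wedge ((?\<Phi> t)[j := (?ps ! j, ?\<Phi>' j t)]) xs)"
  proof (rule deriv_v_wedge[OF ps])
    show "length ?ps = k" using k by simp
    fix j zs assume "j < k"
    then show "deriv_h n (edge_direction i) (\<lambda>t. snd (?\<Phi> t ! j) zs) (\<lambda>t. ?\<Phi>' j t zs)"
      using k deriv_h_curvature[OF len sec i, of zs] RH.poly_deriv_const[OF ker[OF nth_mem]]
      by (cases "j < length \<alpha>s") (simp_all add: nth_append R_def DR_def)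
  qed
  then show ?thesis
  proof (rule poly_deriv.cong[OF _ refl])
    fix t assume t: "t \<in> standard_simplex n"
    have kR: "kernel_valued (replicate m (R t))" for m
      unfolding R_def
      by (intro kernel_valued_replicate curvature_in_kernel linear_section_affine_section[OF len sec t])
    have kDR: "snd (DR t) ys \<in> ext_kernel q" for ys
      using i len unfolding DR_def by (auto intro!: covariant_diff_in_kernel section_diff_in_kernel[OF sec])
    have kA: "kernel_valued (degree_one \<alpha>s)" using ker by auto
    define T where "T j = wedge ((?\<Phi> t)[j := (?ps ! j, ?\<Phi>' j t)]) xs" for j
    have "(\<Sum>j<k. T j) = (\<Sum>j<length \<alpha>s. T j) + (\<Sum>j\<in>{length \<alpha>s..<k}. T j)"
      using k by (subst sum.union_disjoint[symmetric]) (auto intro!: sum.cong)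
    also have "(\<Sum>j<length \<alpha>s. T j) = 0"
    proof (rule sum.neutral, rule ballI)
      fix j assume "j \<in> {..<length \<alpha>s}"
      then have j: "j < length \<alpha>s" by simp
      let ?A = "degree_one (take j \<alpha>s)" and ?B = "degree_one (drop (Suc j) \<alpha>s) @ replicate r (R t)"
      have "T j = wedge (?A @ (1, \<lambda>ys. sh 0 0) # ?B) xs"
        using j by (simp add: T_def upd_conv_take_nth_drop list_update_append1 nth_append)
      also have "\<dots> = sv 0 (wedge (?A @ (1, \<lambda>ys. 0) # ?B) xs)"
        using j k ker kR kernel_0
        by (intro wedge_slot_scale) (auto dest!: in_set_takeD in_set_dropD)
      finally show "T j = 0" by simp
    qed
    also have "(\<Sum>j\<in>{length \<alpha>s..<k}. T j)
        = (\<Sum>j\<in>{length \<alpha>s..<k}. wedge (degree_one \<alpha>s @ DR t # replicate (r - 1) (R t)) xs)"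
    proof (rule sum.cong[OF refl])
      fix j assume "j \<in> {length \<alpha>s..<k}"
      then obtain l where j: "j = length \<alpha>s + l" "l < r"
        using k le_Suc_ex[of "length \<alpha>s" j] by auto
      have rep: "(replicate r (R t))[l := x] = replicate l (R t) @ x # replicate (r - Suc l) (R t)" for x
        using j(2) by (simp add: upd_conv_take_nth_drop min_def)
      have "T j = wedge (degree_one \<alpha>s @ replicate l (R t) @ (2, snd (DR t)) # replicate (r - Suc l) (R t)) xs"
        using j by (simp add: T_def rep list_update_append nth_append)
      also have "\<dots> = wedge (degree_one \<alpha>s @ (2, snd (DR t)) # replicate l (R t) @ replicate (r - Suc l) (R t)) xs"
      proof (rule wedge_move_two_form[symmetric])
        have "2 * r = 2 + 2 * l + 2 * (r - Suc l)" using j(2) by simp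
        then show "length xs = total_degree (degree_one \<alpha>s) + 2 + total_degree (replicate l (R t))
            + total_degree (replicate (r - Suc l) (R t))"
          using xs by (simp add: R_def)
      next
        fix \<alpha> ys assume "\<alpha> \<in> set (replicate l (R t))"
        then show "snd \<alpha> ys \<in> ext_kernel q" using kR[of 1] by (auto simp: R_def)
      qed (use j k kA kR kDR in auto)
      also have "replicate l (R t) @ replicate (r - Suc l) (R t) = replicate (r - 1) (R t)"
        using j(2) by (simp flip: replicate_add)
      finally show "T j = wedge (degree_one \<alpha>s @ DR t # replicate (r - 1) (R t)) xs"
        by (simp add: DR_def)
    qed
    also have "\<dots> = sv (of_nat r) (wedge (degree_one \<alpha>s @ DR t # replicate (r - 1) (R t)) xs)"
      by (simp add: M.V.sum_constant_scale flip: k)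
    finally show "sv (of_nat r) (wedge (degree_one \<alpha>s @ DR t # replicate (r - 1) (R t)) xs)
        = (\<Sum>j<k. wedge ((?\<Phi> t)[j := (?ps ! j, ?\<Phi>' j t)]) xs)"
      by (simp add: T_def)
  qed
qed

end

section \<open>The differential of the simplex cochains\<close>

context real_invariant_form
begin

lemma has_poly_simplex_integral_ce_diff:
  assumes "\<And>ys. length ys = N \<Longrightarrow> has_poly_simplex_integral sv n (\<lambda>t. \<omega> t ys) (c ys)"
    and "length xs = Suc N"
  shows "has_poly_simplex_integral sv n (\<lambda>t. ce_diff brg sv act (\<omega> t) xs) (ce_diff brg sv act c xs)"
  unfolding ce_diff_def
proof (intro I.has_poly_simplex_integral_add I.has_poly_simplex_integral_sum I.has_poly_simplex_integral_scale)
  fix j assume "j \<in> {..<length xs}"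
  then have "length (nths xs (- {j})) = N" using assms(2) by (simp add: length_nths_omit_one)
  then show "has_poly_simplex_integral sv n (\<lambda>t. act (xs ! j) (\<omega> t (nths xs (- {j}))))
      (act (xs ! j) (c (nths xs (- {j}))))"
    by (rule I.has_poly_simplex_integral_linear[OF assms(1) M.act_linear_right])
next
  fix i j assume "j \<in> {..<length xs}" "i \<in> {..<j}"
  then have "length (brg (xs ! i) (xs ! j) # nths xs (- {i, j})) = N"
    using assms(2) by (simp add: nths_omit_two)
  then show "has_poly_simplex_integral sv n (\<lambda>t. \<omega> t (brg (xs ! i) (xs ! j) # nths xs (- {i, j})))
      (c (brg (xs ! i) (xs ! j) # nths xs (- {i, j})))"
    by (rule assms)
qed

lemma ce_diff_scale:
  "ce_diff brg sv act (\<lambda>ys. sv c (\<omega> ys)) xs = sv c (ce_diff brg sv act \<omega> xs)"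
proof -
  interpret A: Vector_Spaces.linear sv sv "act x" for x by (rule M.act_linear_right)
  show ?thesis
    by (simp add: ce_diff_def A.scale M.V.scale_right_distrib M.V.scale_sum_right mult.commute)
qed

definition section_diffs :: "('g \<Rightarrow> 'h) list \<Rightarrow> ('g list \<Rightarrow> 'h) list"
  where "section_diffs \<sigma>s = map (section_diff \<sigma>s) [1..<length \<sigma>s]"

text \<open>The factor \<open>1 / 2 ^ r\<close> normalises the \<open>r\<close> curvatures, which are the only cochains of degree above one.\<close>

definition simplex_integrand ::
    "('g \<Rightarrow> 'h) list \<Rightarrow> nat \<Rightarrow> (nat \<Rightarrow> real) \<Rightarrow> 'g list \<Rightarrow> 'v"
  where "simplex_integrand \<sigma>s r t xs = sv (1 / 2 ^ r)
    (wedge (degree_one (section_diffs \<sigma>s) @ replicate r (2, curvature brh brg (affine_section sh \<sigma>s t))) xs)"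

lemma length_section_diffs [simp]: "length (section_diffs \<sigma>s) = length \<sigma>s - 1"
  by (simp add: section_diffs_def)

lemma nth_section_diffs: "i < length \<sigma>s - 1 \<Longrightarrow> section_diffs \<sigma>s ! i = section_diff \<sigma>s (Suc i)"
  by (simp add: section_diffs_def)

lemma section_diffs_in_kernel:
  assumes "\<forall>s\<in>set \<sigma>s. linear_section sh sg q s" "\<alpha> \<in> set (section_diffs \<sigma>s)"
  shows "\<alpha> ys \<in> ext_kernel q"
  using assms by (auto simp: section_diffs_def intro: section_diff_in_kernel)

text \<open>The cochain was defined by a definite description; it has its meaning because the
  integrand is polynomial in \<open>t\<close>.\<close>

lemma has_poly_simplex_integral_simplex_cochain:
  assumes len: "length \<sigma>s = n + 1" and "n \<le> k" and sec: "\<forall>s\<in>set \<sigma>s. linear_section sh sg q s"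
    and xs: "length xs = 2 * k - n"
  shows "has_poly_simplex_integral sv n (\<lambda>t. simplex_integrand \<sigma>s (k - n) t xs)
    (simplex_cochain sh brh brg sv k f \<sigma>s xs)"
proof -
  have xs': "length xs = length (section_diffs \<sigma>s) + 2 * (k - n)" using xs assms(2) len by simp
  have eq: "sym_wedge sv f (map (\<lambda>i. (1, section_diff \<sigma>s i)) [1..<Suc n]
      @ replicate (k - n) (2, curvature brh brg (affine_section sh \<sigma>s t))) xs
      = simplex_integrand \<sigma>s (k - n) t xs" for t
  proof -
    let ?\<phi>s = "degree_one (section_diffs \<sigma>s) @ replicate (k - n) (2, curvature brh brg (affine_section sh \<sigma>s t))"
    have 1: "map (\<lambda>i. (1, section_diff \<sigma>s i)) [1..<Suc n] = degree_one (section_diffs \<sigma>s)"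
      by (simp add: degree_one_def section_diffs_def len)
    have "(\<Prod>(p, \<phi>)\<leftarrow>degree_one \<alpha>s. fact p) = (1::'k)" for \<alpha>s :: "('g list \<Rightarrow> 'h) list"
      by (induction \<alpha>s) auto
    moreover have "(\<Prod>(p, \<phi>)\<leftarrow>replicate m (2::nat, \<phi>). fact p) = (2 ^ m :: 'k)" for m and \<phi> :: "'g list \<Rightarrow> 'h"
      by (induction m) auto
    ultimately have 2: "(\<Prod>(p, \<phi>)\<leftarrow>?\<phi>s. fact p) = (2 ^ (k - n) :: 'k)" by simp
    have 3: "length xs = total_degree ?\<phi>s" using xs' by (simp add: mult.commute)
    show ?thesis
      unfolding sym_wedge_def 1 2 simplex_integrand_def wedge_def
        M.V.alternation_eq_sum_permutes[OF 3] ..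
  qed
  \<comment> \<open>polynomiality is the only point here, so the zero direction \<open>edge_direction 0\<close> serves; it needs no vertex besides \<open>0\<close>\<close>
  have "deriv_v n (edge_direction 0) (\<lambda>t. simplex_integrand \<sigma>s (k - n) t xs) (\<lambda>t. sv (1 / 2 ^ (k - n))
      (sv (of_nat (k - n)) (wedge (degree_one (section_diffs \<sigma>s)
        @ (2, covariant_diff (affine_section sh \<sigma>s t) (section_diff \<sigma>s 0))
        # replicate (k - n - 1) (2, curvature brh brg (affine_section sh \<sigma>s t))) xs)))"
    unfolding simplex_integrand_def
    by (intro deriv_v_scale deriv_v_wedge_curvature[OF len sec] section_diffs_in_kernel[OF sec] xs')
      (use len assms(2) in auto)
  then obtain v where "has_poly_simplex_integral sv n (\<lambda>t. simplex_integrand \<sigma>s (k - n) t xs) v"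
    using deriv_v_has_integral by blast
  moreover from this have "simplex_cochain sh brh brg sv k f \<sigma>s xs = v"
    unfolding simplex_cochain_def len Let_def add_diff_cancel_right' eq
    by (intro poly_simplex_integral_eqI[OF M.V.vector_space_axioms])
  ultimately show ?thesis by simp
qed

lemma ce_diff_simplex_integrand:
  assumes len: "length \<sigma>s = n + 1" and "n \<le> k" and sec: "\<forall>s\<in>set \<sigma>s. linear_section sh sg q s"
    and xs: "length xs = 2 * k - n + 1" and t: "t \<in> standard_simplex n"
  defines "\<alpha>s \<equiv> section_diffs \<sigma>s" and "s \<equiv> affine_section sh \<sigma>s t"
  shows "ce_diff brg sv act (simplex_integrand \<sigma>s (k - n) t) xs
    = (\<Sum>i<n. sv ((-1) ^ i) (sv (1 / 2 ^ Suc (k - n))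
        (wedge (degree_one (take i \<alpha>s @ drop (Suc i) \<alpha>s) @ (2, covariant_diff s (\<alpha>s ! i))
          # replicate (k - n) (2, curvature brh brg s)) xs)))"
proof -
  have s: "linear_section sh sg q s"
    unfolding s_def by (rule linear_section_affine_section[OF len sec t])
  have odd: "\<alpha> [- x] = - \<alpha> [x]" if \<alpha>: "\<alpha> \<in> set \<alpha>s" for \<alpha> x
  proof -
    obtain i where i: "i < length \<sigma>s" "\<alpha> = section_diff \<sigma>s i"
      using \<alpha> by (auto simp: \<alpha>s_def section_diffs_def)
    have "(\<sigma>s ! a) (- x) = - (\<sigma>s ! a) x" if "a < length \<sigma>s" for a
    proof -
      interpret Vector_Spaces.linear sg sh "\<sigma>s ! a"
        using sec nth_mem[OF that] by (auto simp: linear_section_def)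
      show ?thesis by (rule neg)
    qed
    moreover have "0 < length \<sigma>s" using i(1) by linarith
    ultimately show ?thesis using i by (simp add: section_diff_def)
  qed
  have "ce_diff brg sv act (simplex_integrand \<sigma>s (k - n) t) xs
      = sv (1 / 2 ^ (k - n)) (ce_diff brg sv act
        (wedge (degree_one \<alpha>s @ replicate (k - n) (2, curvature brh brg s))) xs)"
    unfolding simplex_integrand_def[abs_def] ce_diff_scale \<alpha>s_def s_def ..
  also have "\<dots> = sv (1 / 2 ^ (k - n)) (\<Sum>i<length \<alpha>s. sv ((-1) ^ i * (1 / 2))
      (wedge (degree_one (take i \<alpha>s @ drop (Suc i) \<alpha>s) @ (2, covariant_diff s (\<alpha>s ! i))
        # replicate (k - n) (2, curvature brh brg s)) xs))"
  proof (rule arg_cong[where f = "sv _"], rule ce_diff_wedge_curvature[OF s])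
    show "\<alpha> ys \<in> ext_kernel q" if "\<alpha> \<in> set \<alpha>s" for \<alpha> ys
      using section_diffs_in_kernel[OF sec] that by (simp add: \<alpha>s_def)
  qed (use len assms(2) xs odd in \<open>simp_all add: \<alpha>s_def\<close>)
  also have "\<dots> = (\<Sum>i<n. sv ((-1) ^ i) (sv (1 / 2 ^ Suc (k - n))
        (wedge (degree_one (take i \<alpha>s @ drop (Suc i) \<alpha>s) @ (2, covariant_diff s (\<alpha>s ! i))
          # replicate (k - n) (2, curvature brh brg s)) xs)))"
    unfolding M.V.scale_sum_right using len by (simp add: \<alpha>s_def mult.commute)
  finally show ?thesis .
qed

lemma nth_nths_omit_one_skip: "i < length zs \<Longrightarrow> b < length zs - 1 \<Longrightarrow> nths zs (- {i}) ! b = zs ! skip i b"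
  by (simp add: nth_nths_omit_one skip_def)

lemma affine_section_simplical_face:
  assumes "length \<sigma>s = Suc (Suc p)" "i \<le> Suc p"
  shows "affine_section sh \<sigma>s (simplical_face i t) = affine_section sh (nths \<sigma>s (- {i})) t"
proof
  fix x
  have i: "i < length \<sigma>s" using assms by simp
  have nth: "nths \<sigma>s (- {i}) ! b = \<sigma>s ! skip i b" if "b \<le> p" for b
    using nth_nths_omit_one_skip[OF i, of b] that assms by simp
  show "affine_section sh \<sigma>s (simplical_face i t) x = affine_section sh (nths \<sigma>s (- {i})) t x"
    unfolding affine_section_def length_nths_omit_one[OF i] assms(1) lessThan_Suc_atMost
      sum.atMost_Suc_skip[OF assms(2)] diff_Suc_1
    by (simp add: simplical_face_skip nth)
qed

lemma section_diffs_omit_Suc: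
  assumes "Suc i < length \<sigma>s"
  shows "section_diffs (nths \<sigma>s (- {Suc i})) = take i (section_diffs \<sigma>s) @ drop (Suc i) (section_diffs \<sigma>s)"
proof (rule nth_equalityI)
  fix j assume "j < length (section_diffs (nths \<sigma>s (- {Suc i})))"
  then have j: "j < length \<sigma>s - 2" using assms by (simp add: length_nths_omit_one)
  then show "section_diffs (nths \<sigma>s (- {Suc i})) ! j = (take i (section_diffs \<sigma>s) @ drop (Suc i) (section_diffs \<sigma>s)) ! j"
    using assms
    by (auto simp: nth_append nth_section_diffs length_nths_omit_one section_diff_def fun_eq_iff
        nth_nths_omit_one min_def)
qed (use assms in \<open>simp add: length_nths_omit_one\<close>)

lemma section_diffs_omit_0:
  assumes "length \<sigma>s = Suc (Suc p)"
  shows "section_diffs (nths \<sigma>s (- {0}))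
    = map (\<lambda>b ys. b ys - section_diff \<sigma>s 1 ys) (tl (section_diffs \<sigma>s))"
proof (rule nth_equalityI)
  fix j assume "j < length (section_diffs (nths \<sigma>s (- {0})))"
  then have j: "j < p" using assms by (simp add: length_nths_omit_one)
  then show "section_diffs (nths \<sigma>s (- {0})) ! j = map (\<lambda>b ys. b ys - section_diff \<sigma>s 1 ys) (tl (section_diffs \<sigma>s)) ! j"
    using assms
    by (auto simp: nth_tl nth_section_diffs length_nths_omit_one section_diff_def fun_eq_iff nth_nths_omit_one)
qed (use assms in \<open>simp add: length_nths_omit_one\<close>)

text \<open>The functions \<open>G i\<close> are the integrands with the one-form \<open>\<sigma>\<^bsub>i + 1\<^esub> - \<sigma>\<^sub>0\<close> omitted and one more
  curvature. By \<open>ce_diff_wedge_curvature\<close> and \<open>deriv_v_wedge_curvature\<close>, the left-hand side is the integral of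
  \<open>\<Sum>\<^sub>i (-1)\<^sup>i G' i\<close>, where \<open>G' i\<close> is the derivative of \<open>G i\<close> towards the vertex \<open>i + 1\<close>.
  Uniqueness of the coefficientwise integral turns identities of
  integrands into identities of integrals.\<close>

theorem ce_diff_simplex_cochain:
  assumes "n \<le> k" and len: "length \<sigma>s = n + 1" and sec: "\<forall>s\<in>set \<sigma>s. linear_section sh sg q s"
    and xs: "length xs = 2 * k - n + 1"
  shows "sv (of_nat (k - n + 1)) (ce_diff brg sv act (simplex_cochain sh brh brg sv k f \<sigma>s) xs)
    = (if n = 0 then 0
       else \<Sum>i\<le>n. sv ((-1) ^ i) (simplex_cochain sh brh brg sv k f (nths \<sigma>s (- {i})) xs))"
proof -
  let ?c = "simplex_cochain sh brh brg sv k f"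
  let ?d = "ce_diff brg sv act (?c \<sigma>s) xs"
  define r where "r = k - n"
  define \<alpha>s where "\<alpha>s = section_diffs \<sigma>s"
  define R where "R t = (2::nat, curvature brh brg (affine_section sh \<sigma>s t))" for t
  define G where "G i t = sv (1 / 2 ^ Suc r) (wedge (degree_one (take i \<alpha>s @ drop (Suc i) \<alpha>s)
    @ replicate (Suc r) (R t)) xs)" for i t
  define G' where "G' i t = sv (1 / 2 ^ Suc r) (sv (of_nat (Suc r)) (wedge (degree_one (take i \<alpha>s @ drop (Suc i) \<alpha>s)
    @ (2, covariant_diff (affine_section sh \<sigma>s t) (\<alpha>s ! i)) # replicate r (R t)) xs))" for i t
  have "has_poly_simplex_integral sv n (\<lambda>t. ce_diff brg sv act (simplex_integrand \<sigma>s (k - n) t) xs) ?d"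
    using xs by (intro has_poly_simplex_integral_ce_diff[where N = "2 * k - n"]
        has_poly_simplex_integral_simplex_cochain len assms(1) sec) auto
  from I.has_poly_simplex_integral_scale[OF this, of "of_nat (k - n + 1)"]
  have lhs: "has_poly_simplex_integral sv n (\<lambda>t. \<Sum>i<n. sv ((-1) ^ i) (G' i t)) (sv (of_nat (k - n + 1)) ?d)"
  proof (rule has_poly_simplex_integral_cong)
    fix t assume t: "t \<in> standard_simplex n"
    show "(\<Sum>i<n. sv ((-1) ^ i) (G' i t))
        = sv (of_nat (k - n + 1)) (ce_diff brg sv act (simplex_integrand \<sigma>s (k - n) t) xs)"
      unfolding ce_diff_simplex_integrand[OF len assms(1) sec xs t] M.V.scale_sum_right
      by (intro sum.cong refl) (simp add: G'_def r_def R_def \<alpha>s_def mult_ac)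
  qed
  show ?thesis
  proof (cases n)
    case 0
    have "sv (of_nat (k - n + 1)) ?d = 0"
      by (rule has_poly_simplex_integral_unique[OF M.V.vector_space_axioms lhs])
        (simp add: 0 I.has_poly_simplex_integral_zero)
    then show ?thesis using 0 by simp
  next
    case (Suc p)
    have k: "k - p = Suc r" "n - 1 = p" using Suc assms(1) by (auto simp: r_def)
    have deriv: "deriv_v n (edge_direction (Suc i)) (G i) (G' i)" if i: "i < n" for i
    proof -
      have "\<alpha>s ! i = section_diff \<sigma>s (Suc i)"
        using i len by (simp add: \<alpha>s_def nth_section_diffs)
      moreover have "\<alpha> ys \<in> ext_kernel q" if "\<alpha> \<in> set (take i \<alpha>s @ drop (Suc i) \<alpha>s)" for \<alpha> ys
        using that section_diffs_in_kernel[OF sec] by (auto simp: \<alpha>s_def dest: in_set_takeD in_set_dropD)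
      moreover have "length (take i \<alpha>s @ drop (Suc i) \<alpha>s) + Suc r = k"
          "length xs = length (take i \<alpha>s @ drop (Suc i) \<alpha>s) + 2 * Suc r"
        using i len assms(1) xs by (auto simp: \<alpha>s_def r_def)
      ultimately show ?thesis
        unfolding G_def[abs_def] G'_def[abs_def] R_def
        using deriv_v_wedge_curvature[OF len sec, of "Suc i" "take i \<alpha>s @ drop (Suc i) \<alpha>s" "Suc r" xs] i
        by (intro deriv_v_scale) simp
    qed
    have "\<exists>a b. has_poly_simplex_integral sv p (\<lambda>t. G i (simplical_face 0 t)) a
        \<and> has_poly_simplex_integral sv p (\<lambda>t. G i (simplical_face (Suc i) t)) b
        \<and> has_poly_simplex_integral sv n (G' i) (a - b)" if "i < n" for i
      using I.stokes_simplex[of p "Suc i" "G i" "G' i"] deriv[OF that] that by (simp add: Suc)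
    then obtain a b where
        a: "\<And>i. i < n \<Longrightarrow> has_poly_simplex_integral sv p (\<lambda>t. G i (simplical_face 0 t)) (a i)"
      and b: "\<And>i. i < n \<Longrightarrow> has_poly_simplex_integral sv p (\<lambda>t. G i (simplical_face (Suc i) t)) (b i)"
      and ab: "\<And>i. i < n \<Longrightarrow> has_poly_simplex_integral sv n (G' i) (a i - b i)"
      by metis
    have total: "sv (of_nat (k - n + 1)) ?d = (\<Sum>i<n. sv ((-1) ^ i) (a i - b i))"
      by (rule has_poly_simplex_integral_unique[OF M.V.vector_space_axioms lhs],
          intro I.has_poly_simplex_integral_sum I.has_poly_simplex_integral_scale ab) simp
    have faces: "has_poly_simplex_integral sv p (\<lambda>t. simplex_integrand (nths \<sigma>s (- {i})) (Suc r) t xs)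
        (?c (nths \<sigma>s (- {i})) xs)" if "i \<le> n" for i
    proof -
      have "\<forall>s\<in>set (nths \<sigma>s (- {i})). linear_section sh sg q s"
        using sec set_nths_subset[of \<sigma>s "- {i}"] by blast
      moreover have "length (nths \<sigma>s (- {i})) = p + 1" "length xs = 2 * k - p"
        using that len xs Suc assms(1) by (auto simp: length_nths_omit_one)
      ultimately show ?thesis
        using has_poly_simplex_integral_simplex_cochain[of "nths \<sigma>s (- {i})" p xs] Suc assms(1)
        by (simp add: k)
    qed
    have "b i = ?c (nths \<sigma>s (- {Suc i})) xs" if i: "i < n" for i
    proof (rule has_poly_simplex_integral_unique[OF M.V.vector_space_axioms b[OF i]])
      have "G i (simplical_face (Suc i) t) = simplex_integrand (nths \<sigma>s (- {Suc i})) (Suc r) t xs" for t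
        using i len Suc
        by (simp add: G_def R_def simplex_integrand_def section_diffs_omit_Suc \<alpha>s_def
            affine_section_simplical_face[of _ p] del: replicate.simps power_Suc)
      then show "has_poly_simplex_integral sv p (\<lambda>t. G i (simplical_face (Suc i) t)) (?c (nths \<sigma>s (- {Suc i})) xs)"
        using faces[of "Suc i"] i by simp
    qed
    \<comment> \<open>the face opposite to the vertex \<open>0\<close>, where the base section changes from \<open>\<sigma>\<^sub>0\<close> to \<open>\<sigma>\<^sub>1\<close>\<close>
    moreover have "(\<Sum>i<n. sv ((-1) ^ i) (a i)) = ?c (nths \<sigma>s (- {0})) xs"
    proof (rule has_poly_simplex_integral_unique[OF M.V.vector_space_axioms])
      show "has_poly_simplex_integral sv p (\<lambda>t. \<Sum>i<n. sv ((-1) ^ i) (G i (simplical_face 0 t)))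
          (\<Sum>i<n. sv ((-1) ^ i) (a i))"
        by (intro I.has_poly_simplex_integral_sum I.has_poly_simplex_integral_scale a) simp
      show "has_poly_simplex_integral sv p (\<lambda>t. \<Sum>i<n. sv ((-1) ^ i) (G i (simplical_face 0 t))) (?c (nths \<sigma>s (- {0})) xs)"
      proof (rule has_poly_simplex_integral_cong[OF faces[OF le0]])
        fix t assume t: "t \<in> standard_simplex p"
        let ?\<Psi> = "replicate (Suc r) (R (simplical_face 0 t))"
        have face: "simplical_face 0 t \<in> standard_simplex n"
          using simplical_face_in_standard_simplex[of n 0 t] t Suc by simp
        have \<alpha>s: "\<alpha>s = section_diff \<sigma>s 1 # tl \<alpha>s"
          using len Suc by (simp add: \<alpha>s_def section_diffs_def upt_conv_Cons del: upt_Suc)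
        have ker: "\<alpha> ys \<in> ext_kernel q" if "\<alpha> \<in> set \<alpha>s" for \<alpha> ys
          using that section_diffs_in_kernel[OF sec] by (simp add: \<alpha>s_def)
        have len_tl: "length (tl \<alpha>s) = p" using len Suc by (simp add: \<alpha>s_def)
        have k\<Psi>: "kernel_valued ?\<Psi>"
          unfolding R_def
          by (intro kernel_valued_replicate curvature_in_kernel linear_section_affine_section[OF len sec face])
        have "wedge (degree_one (map (\<lambda>b ys. b ys - section_diff \<sigma>s 1 ys) (tl \<alpha>s)) @ ?\<Psi>) xs
            = (\<Sum>i<Suc (length (tl \<alpha>s)). sv ((-1) ^ i)
              (wedge (degree_one (take i (section_diff \<sigma>s 1 # tl \<alpha>s) @ drop (Suc i) (section_diff \<sigma>s 1 # tl \<alpha>s)) @ ?\<Psi>) xs))"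
        proof (rule wedge_change_base_point)
          show "length (tl \<alpha>s) + length ?\<Psi> = k" unfolding len_tl using k(1) Suc assms(1) by simp
          show "length xs = length (tl \<alpha>s) + total_degree ?\<Psi>"
            unfolding len_tl R_def total_degree_replicate using xs Suc assms(1) by (simp add: r_def)
          show "section_diff \<sigma>s 1 ys \<in> ext_kernel q" for ys
            using len Suc by (intro section_diff_in_kernel sec) simp
          show "\<alpha> ys \<in> ext_kernel q" if "\<alpha> \<in> set (tl \<alpha>s)" for \<alpha> ys
            using ker that by (metis \<alpha>s list.set_intros(2))
        qed (rule k\<Psi>)
        then have "simplex_integrand (nths \<sigma>s (- {0})) (Suc r) t xs
            = sv (1 / 2 ^ Suc r) (\<Sum>i<n. sv ((-1) ^ i)
              (wedge (degree_one (take i \<alpha>s @ drop (Suc i) \<alpha>s) @ ?\<Psi>) xs))"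
          unfolding \<alpha>s[symmetric] len_tl Suc[symmetric] simplex_integrand_def R_def
            section_diffs_omit_0[OF len[unfolded Suc, simplified]] \<alpha>s_def[symmetric]
          using affine_section_simplical_face[of \<sigma>s p 0 t] len Suc by simp
        then show "(\<Sum>i<n. sv ((-1) ^ i) (G i (simplical_face 0 t))) = simplex_integrand (nths \<sigma>s (- {0})) (Suc r) t xs"
          by (simp only: G_def M.V.scale_sum_right M.V.scale_left_commute)
      qed
    qed
    ultimately have "sv (of_nat (k - n + 1)) ?d
        = ?c (nths \<sigma>s (- {0})) xs - (\<Sum>i<n. sv ((-1) ^ i) (?c (nths \<sigma>s (- {Suc i})) xs))"
      unfolding total M.V.scale_right_diff_distrib sum_subtractf by simp
    also have "\<dots> = (\<Sum>i\<le>n. sv ((-1) ^ i) (?c (nths \<sigma>s (- {i})) xs))"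
      by (simp add: sum.atMost_shift sum_negf)
    finally show ?thesis using Suc by simp
  qed
qed

end

theorem theorem10p3p4:
  fixes sh :: "'k::real_normed_field \<Rightarrow> 'h::ab_group_add \<Rightarrow> 'h"
    and sg :: "'k \<Rightarrow> 'g::ab_group_add \<Rightarrow> 'g"
    and sv :: "'k \<Rightarrow> 'v::ab_group_add \<Rightarrow> 'v"
    and brh :: "'h \<Rightarrow> 'h \<Rightarrow> 'h"
    and brg :: "'g \<Rightarrow> 'g \<Rightarrow> 'g"
    and act :: "'g \<Rightarrow> 'v \<Rightarrow> 'v"
    and q :: "'h \<Rightarrow> 'g"
    and f :: "'h list \<Rightarrow> 'v"
    and \<sigma>s :: "('g \<Rightarrow> 'h) list"
    and k n :: nat
  assumes "lie_extension sh brh sg brg q"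
    and "lie_module sg brg sv act"
    and "n \<le> k"
    and "length \<sigma>s = n + 1"
    and "\<forall>s\<in>set \<sigma>s. linear_section sh sg q s"
    and "sym_multilinear_on sh sv (ext_kernel q) k f"
    and "equivariant_on brh act q (ext_kernel q) k f"
  shows "\<forall>xs. length xs = 2 * k - n + 1 \<longrightarrow>
    sv (of_nat (k - n + 1)) (ce_diff brg sv act (simplex_cochain sh brh brg sv k f \<sigma>s) xs) =
    (if n = 0 then 0
     else \<Sum>i\<le>n. sv ((-1) ^ i) (simplex_cochain sh brh brg sv k f (nths \<sigma>s (- {i})) xs))"
proof (intro allI impI)
  interpret E: lie_extension sh brh sg brg q by fact
  interpret M: lie_module sg brg sv act by fact
  interpret real_invariant_form sh brh sg brg q sv act k f
    by unfold_locales fact+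
  fix xs :: "'g list" assume "length xs = 2 * k - n + 1"
  then show "sv (of_nat (k - n + 1)) (ce_diff brg sv act (simplex_cochain sh brh brg sv k f \<sigma>s) xs) =
    (if n = 0 then 0
     else \<Sum>i\<le>n. sv ((-1) ^ i) (simplex_cochain sh brh brg sv k f (nths \<sigma>s (- {i})) xs))"
    by (rule ce_diff_simplex_cochain[OF assms(3-5)])
qed

end
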